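(* Let $q$ be an even prime power, let $1\le d\le m$ be integers, and let $Y$ be a nonempty $d$-code in $\mathscr Q(m,q)$. Then \[ \lvert Y\rvert\le\begin{cases} q^{m(m-d+2)/2} & \text{for odd } m \text{ and odd } d,\\ q^{(m+1)(m-d+1)/2} & \text{for even } m \text{ and odd } d,\\ q^{(m-1)(m-d+2)/2} & \text{for even } m \text{ and even } d,\\ q^{m(m-d+1)/2} & \text{for odd } m \text{ and even } d. \end{cases} \] Moreover, if $d$ is odd, equality holds if and only if $Y$ is a $t$-design for $t=2\big(\lfloor (m+1)/2\rfloor-(d-1)/2\big)$.
   Context: Let $q$ be an even prime power, $m\ge1$, and $V$ an $m$-dimensional $\mathbb F_q$-vector space. $\mathscr Q(m,q)$ is the set of quadratic forms on $V$ and $\mathscr S(m,q)$ the set of symmetric bilinear forms on $V$. The rank of $S\in\mathscr S(m,q)$ is the codimension of $\{x\in V:S(x,y)=0\ \forall y\in V\}$. For $Q\in\mathscr Q(m,q)$ let $S_Q(x,y)=Q(x+y)-Q(x)-Q(y)$; the radical of $Q$ is $\{x: S_Q(x,y)=0\ \forall y,\ Q(x)=0\}$ and the rank of $Q$ is its codimension. Quadratic forms $Q,Q'$ are equivalent if $Q'(x)=aQ(Lx)$ for some $a\in\mathbb F_q^*$, $L\in GL(V)$; symmetric bilinear forms $S,S'$ are equivalent if $S'(x,y)=aS(Lx,Ly)$ for such $a,L$. Fix $\lambda\in\mathbb F_q$ of absolute trace $1$. A quadratic form of rank $2s\ge2$ has type $1$ if it is equivalent to the form given in coordinates of some basis by $\sum_{i=1}^s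 x_{2i-1}x_{2i}$, and type $-1$ if equivalent to $\sum_{i=1}^{s-1}x_{2i-1}x_{2i}+x_{2s-1}^2+x_{2s-1}x_{2s}+\lambda x_{2s}^2$. A symmetric bilinear form of rank $2s\ge2$ has type $1$ if equivalent to $\sum_{i=1}^s(x_{2i-1}y_{2i}+x_{2i}y_{2i-1})$ and type $-1$ if equivalent to $\sum_{i=1}^{s-1}(x_{2i-1}y_{2i}+x_{2i}y_{2i-1})+x_{2s-1}y_{2s}+x_{2s}y_{2s-1}+x_{2s}y_{2s}$. Each form of rank $2s\ge2$ has exactly one type; zero forms have rank $0$ and type $1$. Let $I=\{2s+1:s\in\mathbb Z\}\cup\{(2s,\tau):s\in\mathbb Z,\tau=\pm1\}$; $\mathscr Q_{2s+1}$ (resp. $\mathscr S_{2s+1}$) is the set of quadratic (resp. symmetric bilinear) forms of rank $2s+1$, and $\mathscr Q_{2s,\tau}$ (resp. $\mathscr S_{2s,\tau}$) the set of those of rank $2s$ and type $\tau$. Pairing: fix a nontrivial character $\chi$ of $(\mathbb F_q,+)$ and bases $(u_i)$, $(w_i)$ of $V$; for $Q$ pick $A$ with $Q(\sum_i x_iu_i)=\sum_{i,j}A_{ij}x_ix_j$ (unique modulo alternating matrices); for $S$ let $B_{ij}=S(w_i,w_j)$; $\langle Q,S\rangle=\chi(\operatorname{tr}(AB))$. For $k,i\in I$ with $\mathscr Q_i\ne\emptyset$, $Q_k(i)=\sum_{S\in\mathscr S_k}\langle Q,S\rangle$ for any $Q\in\mathscr Q_i$. For $Y\subseteq\mathscr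 Q(m,q)$ the inner distribution is $a_i=\lvert\{(Q,Q')\in Y\times Y:Q-Q'\in\mathscr Q_i\}\rvert/\lvert Y\rvert$ and the dual inner distribution is $a'_k=\sum_{i\in I,\ \mathscr Q_i\ne\emptyset}Q_k(i)\,a_i$. $Y$ is a $d$-code if $\operatorname{rank}(Q-Q')\ge d$ for all distinct $Q,Q'\in Y$. For an integer $t$ let $I_t=\{2s-1:1\le 2s-1\le t\}\cup\{(2s,\pm1):2\le 2s\le t\}$; $Y$ is a $t$-design if $a'_k=0$ for all $k\in I_t$. *)

theory Defs
  imports Complex_Main "HOL-Library.Cardinality"
begin

datatype form_type = Pos | Neg

text \<open>
  The index set \<open>I\<close>: \<open>OddRank s\<close> stands for \<open>2s + 1\<close> and
  \<open>EvenRank s \<tau>\<close> for \<open>(2s, \<tau>)\<close>, with \<open>Pos\<close> and \<open>Neg\<close> the types \<open>1\<close> and \<open>-1\<close>.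
\<close>

datatype form_index = OddRank int | EvenRank int form_type

definition index_upto :: "nat \<Rightarrow> form_index set" where
  "index_upto t =
     {OddRank s | s. 1 \<le> 2 * s + 1 \<and> 2 * s + 1 \<le> int t} \<union>
     {EvenRank s \<tau> | s \<tau>. 2 \<le> 2 * s \<and> 2 * s \<le> int t}"

text \<open>The absolute trace of a field with \<open>2 ^ e\<close> elements; its values lie in the prime field.\<close>

definition abs_trace :: "nat \<Rightarrow> 'a::field \<Rightarrow> 'a" where
  "abs_trace e x = (\<Sum>i<e. x ^ (2 ^ i))"

definition additive_character :: "('a::field \<Rightarrow> complex) \<Rightarrow> bool" where
  "additive_character \<chi> \<longleftrightarrow> \<chi> 0 = 1 \<and> (\<forall>x y. \<chi> (x + y) = \<chi> x * \<chi> y)"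

definition nontrivial_character :: "('a::field \<Rightarrow> complex) \<Rightarrow> bool" where
  "nontrivial_character \<chi> \<longleftrightarrow> additive_character \<chi> \<and> (\<exists>x. \<chi> x \<noteq> 1)"

text \<open>
  The normal forms of rank \<open>2s\<close> (\<open>s \<ge> 1\<close>) as functions of the coordinates \<open>x 1, x 2, \<dots>\<close>.
\<close>

definition quad_normal :: "'a::field \<Rightarrow> nat \<Rightarrow> form_type \<Rightarrow> (nat \<Rightarrow> 'a) \<Rightarrow> 'a" where
  "quad_normal lam s \<tau> x = (case \<tau> of
      Pos \<Rightarrow> (\<Sum>i=1..s. x (2*i-1) * x (2*i))
    | Neg \<Rightarrow> (\<Sum>i=1..s-1. x (2*i-1) * x (2*i))
              + (x (2*s-1))^2 + x (2*s-1) * x (2*s) + lam * (x (2*s))^2)"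

definition sym_normal :: "nat \<Rightarrow> form_type \<Rightarrow> (nat \<Rightarrow> 'a::field) \<Rightarrow> (nat \<Rightarrow> 'a) \<Rightarrow> 'a" where
  "sym_normal s \<tau> x y = (case \<tau> of
      Pos \<Rightarrow> (\<Sum>i=1..s. x (2*i-1) * y (2*i) + x (2*i) * y (2*i-1))
    | Neg \<Rightarrow> (\<Sum>i=1..s-1. x (2*i-1) * y (2*i) + x (2*i) * y (2*i-1))
              + x (2*s-1) * y (2*s) + x (2*s) * y (2*s-1) + x (2*s) * y (2*s))"

text \<open>
  Here \<open>'a\<close> is the field, \<open>'b\<close> the space \<open>V\<close>, and \<open>dim UNIV\<close> its dimension \<open>m\<close>
  (\<open>dim\<close> is \<open>0\<close> on infinite-dimensional spaces).
\<close>

locale form_space = vector_space scale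
  for scale :: "'a::field \<Rightarrow> 'b::ab_group_add \<Rightarrow> 'b"
begin

definition bilinear_form :: "('b \<Rightarrow> 'b \<Rightarrow> 'a) \<Rightarrow> bool" where
  "bilinear_form S \<longleftrightarrow>
     (\<forall>x. Vector_Spaces.linear scale (*) (S x)) \<and>
     (\<forall>y. Vector_Spaces.linear scale (*) (\<lambda>x. S x y))"

definition symmetric_form :: "('b \<Rightarrow> 'b \<Rightarrow> 'a) \<Rightarrow> bool" where
  "symmetric_form S \<longleftrightarrow> bilinear_form S \<and> (\<forall>x y. S x y = S y x)"

definition polar :: "('b \<Rightarrow> 'a) \<Rightarrow> 'b \<Rightarrow> 'b \<Rightarrow> 'a" where
  "polar Q x y = Q (x + y) - Q x - Q y"

definition quadratic_form :: "('b \<Rightarrow> 'a) \<Rightarrow> bool" where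
  "quadratic_form Q \<longleftrightarrow> (\<forall>a x. Q (scale a x) = a^2 * Q x) \<and> bilinear_form (polar Q)"

text \<open>Only applied to subspaces, so that \<open>dim U\<close> is the dimension of \<open>U\<close> itself.\<close>

definition codim :: "'b set \<Rightarrow> nat" where
  "codim U = dim UNIV - dim U"

definition sym_rank :: "('b \<Rightarrow> 'b \<Rightarrow> 'a) \<Rightarrow> nat" where
  "sym_rank S = codim {x. \<forall>y. S x y = 0}"

definition quad_rank :: "('b \<Rightarrow> 'a) \<Rightarrow> nat" where
  "quad_rank Q = codim {x. (\<forall>y. polar Q x y = 0) \<and> Q x = 0}"

definition general_linear :: "('b \<Rightarrow> 'b) \<Rightarrow> bool" where
  "general_linear L \<longleftrightarrow> Vector_Spaces.linear scale scale L \<and> bij L"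

definition quad_equiv :: "('b \<Rightarrow> 'a) \<Rightarrow> ('b \<Rightarrow> 'a) \<Rightarrow> bool" where
  "quad_equiv Q Q' \<longleftrightarrow>
     (\<exists>a L. a \<noteq> 0 \<and> general_linear L \<and> (\<forall>x. Q' x = a * Q (L x)))"

definition sym_equiv :: "('b \<Rightarrow> 'b \<Rightarrow> 'a) \<Rightarrow> ('b \<Rightarrow> 'b \<Rightarrow> 'a) \<Rightarrow> bool" where
  "sym_equiv S S' \<longleftrightarrow>
     (\<exists>a L. a \<noteq> 0 \<and> general_linear L \<and> (\<forall>x y. S' x y = a * S (L x) (L y)))"

text \<open>Bases are indexed by \<open>1, \<dots>, m\<close>; values of \<open>b\<close> at other indices are irrelevant.\<close>

definition indexed_basis :: "(nat \<Rightarrow> 'b) \<Rightarrow> bool" where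
  "indexed_basis b \<longleftrightarrow>
     inj_on b {1..dim UNIV} \<and> independent (b ` {1..dim UNIV}) \<and> span (b ` {1..dim UNIV}) = UNIV"

definition lincomb :: "(nat \<Rightarrow> 'b) \<Rightarrow> (nat \<Rightarrow> 'a) \<Rightarrow> 'b" where
  "lincomb b x = (\<Sum>i=1..dim UNIV. scale (x i) (b i))"

text \<open>
  In the next two definitions \<open>2 * s\<close> is the rank, hence at most \<open>m\<close>, so the normal forms
  only involve genuine coordinates.
\<close>

definition quad_has_type :: "'a \<Rightarrow> ('b \<Rightarrow> 'a) \<Rightarrow> form_type \<Rightarrow> bool" where
  "quad_has_type lam Q \<tau> \<longleftrightarrow>
     (\<exists>s. quad_rank Q = 2 * s \<and>
        (if s = 0 then \<tau> = Pos
         else \<exists>b Q0. indexed_basis b \<and>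
                (\<forall>x. Q0 (lincomb b x) = quad_normal lam s \<tau> x) \<and> quad_equiv Q0 Q))"

definition sym_has_type :: "('b \<Rightarrow> 'b \<Rightarrow> 'a) \<Rightarrow> form_type \<Rightarrow> bool" where
  "sym_has_type S \<tau> \<longleftrightarrow>
     (\<exists>s. sym_rank S = 2 * s \<and>
        (if s = 0 then \<tau> = Pos
         else \<exists>b S0. indexed_basis b \<and>
                (\<forall>x y. S0 (lincomb b x) (lincomb b y) = sym_normal s \<tau> x y) \<and> sym_equiv S0 S))"

definition quad_class :: "'a \<Rightarrow> form_index \<Rightarrow> ('b \<Rightarrow> 'a) set" where
  "quad_class lam i = (case i of
      OddRank s \<Rightarrow> {Q. quadratic_form Q \<and> int (quad_rank Q) = 2 * s + 1}
    | EvenRank s \<tau> \<Rightarrow> {Q. quadratic_form Q \<and> int (quad_rank Q) = 2 * s \<and> quad_has_type lam Q \<tau>})"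

definition sym_class :: "form_index \<Rightarrow> ('b \<Rightarrow> 'b \<Rightarrow> 'a) set" where
  "sym_class i = (case i of
      OddRank s \<Rightarrow> {S. symmetric_form S \<and> int (sym_rank S) = 2 * s + 1}
    | EvenRank s \<tau> \<Rightarrow> {S. symmetric_form S \<and> int (sym_rank S) = 2 * s \<and> sym_has_type S \<tau>})"

text \<open>
  The coefficient matrix is only unique modulo alternating matrices, and only on
  indices in \<open>1, \<dots>, m\<close>; the pairing with a symmetric form does not depend on the choice.
\<close>

definition coeff_matrix :: "(nat \<Rightarrow> 'b) \<Rightarrow> ('b \<Rightarrow> 'a) \<Rightarrow> nat \<Rightarrow> nat \<Rightarrow> 'a" where
  "coeff_matrix u Q =
     (SOME A. \<forall>x. Q (lincomb u x) = (\<Sum>i=1..dim UNIV. \<Sum>j=1..dim UNIV. A i j * x i * x j))"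

definition gram_matrix :: "(nat \<Rightarrow> 'b) \<Rightarrow> ('b \<Rightarrow> 'b \<Rightarrow> 'a) \<Rightarrow> nat \<Rightarrow> nat \<Rightarrow> 'a" where
  "gram_matrix w S i j = S (w i) (w j)"

definition pairing ::
  "('a \<Rightarrow> complex) \<Rightarrow> (nat \<Rightarrow> 'b) \<Rightarrow> (nat \<Rightarrow> 'b) \<Rightarrow> ('b \<Rightarrow> 'a) \<Rightarrow> ('b \<Rightarrow> 'b \<Rightarrow> 'a) \<Rightarrow> complex" where
  "pairing \<chi> u w Q S =
     \<chi> (\<Sum>i=1..dim UNIV. \<Sum>j=1..dim UNIV. coeff_matrix u Q i j * gram_matrix w S j i)"

text \<open>
  \<open>Q_number \<dots> k i\<close> is \<open>Q\<^sub>k(i)\<close>, computed with an arbitrary representative of the \<open>i\<close>-th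
  class; it is meaningful only when that class is nonempty.
\<close>

definition Q_number ::
  "'a \<Rightarrow> ('a \<Rightarrow> complex) \<Rightarrow> (nat \<Rightarrow> 'b) \<Rightarrow> (nat \<Rightarrow> 'b) \<Rightarrow> form_index \<Rightarrow> form_index \<Rightarrow> complex" where
  "Q_number lam \<chi> u w k i =
     (\<Sum>S\<in>sym_class k. pairing \<chi> u w (SOME Q. Q \<in> quad_class lam i) S)"

definition inner_distribution :: "'a \<Rightarrow> ('b \<Rightarrow> 'a) set \<Rightarrow> form_index \<Rightarrow> real" where
  "inner_distribution lam Y i =
     real (card {(Q, Q'). Q \<in> Y \<and> Q' \<in> Y \<and> (\<lambda>x. Q x - Q' x) \<in> quad_class lam i}) / real (card Y)"

definition dual_inner_distribution ::
  "'a \<Rightarrow> ('a \<Rightarrow> complex) \<Rightarrow> (nat \<Rightarrow> 'b) \<Rightarrow> (nat \<Rightarrow> 'b) \<Rightarrow> ('b \<Rightarrow> 'a) set \<Rightarrow> form_index \<Rightarrow> complex" where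
  "dual_inner_distribution lam \<chi> u w Y k =
     (\<Sum>i | quad_class lam i \<noteq> {}. Q_number lam \<chi> u w k i * of_real (inner_distribution lam Y i))"

definition is_code :: "nat \<Rightarrow> ('b \<Rightarrow> 'a) set \<Rightarrow> bool" where
  "is_code d Y \<longleftrightarrow> (\<forall>Q\<in>Y. \<forall>Q'\<in>Y. Q \<noteq> Q' \<longrightarrow> d \<le> quad_rank (\<lambda>x. Q x - Q' x))"

definition is_design ::
  "'a \<Rightarrow> ('a \<Rightarrow> complex) \<Rightarrow> (nat \<Rightarrow> 'b) \<Rightarrow> (nat \<Rightarrow> 'b) \<Rightarrow> nat \<Rightarrow> ('b \<Rightarrow> 'a) set \<Rightarrow> bool" where
  "is_design lam \<chi> u w t Y \<longleftrightarrow>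
     (\<forall>k\<in>index_upto t. dual_inner_distribution lam \<chi> u w Y k = 0)"

end

end

theory Submission
  imports Defs "HOL-Library.FuncSet"
begin

text \<open>
  For \<open>D = UNIV\<close> or \<open>D = {0}\<close> consider the symmetric forms \<open>S\<close> with all \<open>S x x\<close> in \<open>D\<close>; for
  \<open>D = {0}\<close> these are the alternating ones. Put \<open>M = m + 1\<close> or \<open>M = m\<close>, respectively,
  \<open>n = M div 2\<close>, and let \<open>[_, _]\<close> be Gaussian binomials in base \<open>q\<^sup>2\<close>. Let \<open>s(S)\<close> be half the rank
  of \<open>S\<close>, rounded up, and \<open>r(Q)\<close> half the rank of \<open>Q\<close>, rounded up for \<open>D = UNIV\<close> and down for
  \<open>D = {0}\<close>. The key identity (the Delsarte-Goethals identity for alternating forms on \<open>M\<close>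
  coordinates) is
  \<open>\<Sum>\<^sub>S [n - s(S), n - j] \<langle>Q, S\<rangle> = c^j [n - r(Q), j]\<close>, where \<open>c\<close> is \<open>q ^ M\<close> or \<open>q ^ (M - 1)\<close>,
  whichever exponent is odd. Both sides depend only on the equivalence class of \<open>Q\<close>, so \<open>Q\<close> may be
  taken in normal form. Summing over the last row of \<open>S\<close> then removes a coordinate on which \<open>Q\<close>
  does not depend, or a hyperbolic pair, and the coefficients for \<open>n\<close> turn into those for smaller
  dimension; an anisotropic form remains, where \<open>n \<le> 1\<close> and the identity is trivial.

  Choose \<open>j\<close> such that the right-hand side vanishes exactly when \<open>Q\<close> has rank at least \<open>d\<close>, with
  \<open>D = UNIV\<close> for odd and \<open>D = {0}\<close> for even \<open>d\<close>. Summing over all differences in \<open>Y\<close> gives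
  \<open>|Y| c^j [n, j] = \<Sum>\<^sub>S [n - s(S), n - j] (\<Sum>\<^bsub>Q \<in> Y\<^esub> \<langle>Q, S\<rangle>)\<^sup>2\<close>. The term for \<open>S = 0\<close> is
  \<open>[n, j] |Y|\<^sup>2\<close> and the others are nonnegative, whence \<open>|Y| \<le> c^j\<close>. Equality means that the inner
  sums vanish for all \<open>S\<close> of rank between \<open>1\<close> and \<open>2 j\<close>, which is the design property since the dual
  inner distribution sums their squares over the classes.
\<close>

section \<open>Gaussian binomial coefficients\<close>

text \<open>Bordering changes the rank of a symmetric matrix irregularly: a new row inside the
  column space keeps it or raises it by one, a row outside raises it by two. The recursion closes
  because the weights see only the half rank \<sigma>, rounded up. Summing over the new diagonal
  entry gives each row in the image a factor \<open>q ^ (2 * \<sigma> - rk)\<close>; there are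
  \<open>q ^ rk\<close> such rows, and the product depends on \<sigma> alone. A second obstacle is
  that \<open>Q_number\<close> uses an arbitrary representative and the inner distribution counts
  pairs class by class. Hence any two quadratic forms in one class must be equivalent, and every
  form must lie in exactly one class. Normal forms yield the former and the existence of a class;
  the number of zeros separates the two types. On the symmetric side each form has to lie in some
  class, and a design treats both types of an even rank alike.\<close>

fun qbinom :: "real \<Rightarrow> nat \<Rightarrow> nat \<Rightarrow> real" where
  "qbinom b n 0 = 1"
| "qbinom b 0 (Suc k) = 0"
| "qbinom b (Suc n) (Suc k) = qbinom b n k + b ^ Suc k * qbinom b n (Suc k)"

lemma qbinom_eq_0 [simp]: "n < k \<Longrightarrow> qbinom b n k = 0"
  by (induction b n k rule: qbinom.induct) auto

lemma qbinom_nonneg: "0 \<le> b \<Longrightarrow> 0 \<le> qbinom b n k"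
  by (induction b n k rule: qbinom.induct) auto

lemma qbinom_pos: "0 \<le> b \<Longrightarrow> k \<le> n \<Longrightarrow> 0 < qbinom b n k"
proof (induction b n k rule: qbinom.induct)
  case (3 b n k)
  then show ?case
    using qbinom_nonneg[of b n "Suc k"] by (auto intro!: add_pos_nonneg)
qed auto

lemma qbinom_self [simp]: "qbinom b n n = 1"
  by (induction n) auto

declare qbinom.simps(3) [simp del]

text \<open>The mirror image of the defining Pascal rule. Differences of consecutive weights use
  this rule, while the defining one recombines binomials when a zero coordinate is added. In the
  induction both terms are expanded and regrouped, the powers matching since
  \<open>(n - l) + k = Suc k + (n - k)\<close> for \<open>k = Suc l\<close>.\<close>

lemma qbinom_Suc_Suc':
  "k \<le> n \<Longrightarrow> qbinom b (Suc n) (Suc k) = b ^ (n - k) * qbinom b n k + qbinom b n (Suc k)"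
proof (induction n arbitrary: k)
  case (Suc n)
  consider "k = Suc n" | "k = 0" "k \<le> n" | l where "k = Suc l" "k \<le> n"
    using Suc.prems by (metis le_SucE not0_implies_Suc)
  then show ?case
  proof cases
    case 1
    then show ?thesis by simp
  next
    case 2
    have "qbinom b (Suc n) (Suc 0) = b ^ n + qbinom b n (Suc 0)"
      using Suc.IH[of 0] by simp
    moreover have "qbinom b (Suc (Suc n)) (Suc 0) = 1 + b * qbinom b (Suc n) (Suc 0)"
      and "qbinom b (Suc n) (Suc 0) = 1 + b * qbinom b n (Suc 0)"
      by (simp_all add: qbinom.simps(3))
    ultimately show ?thesis unfolding 2 by (simp add: distrib_left)
  next
    case 3
    define X Y Z where "X = qbinom b n l" and "Y = qbinom b n k" and "Z = qbinom b n (Suc k)"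
    have e: "b ^ (n - l) * b ^ k = b ^ Suc k * b ^ (n - k)"
      unfolding power_add[symmetric] using 3 by simp
    have IH: "qbinom b (Suc n) (Suc k) = b ^ (n - k) * Y + Z" "qbinom b (Suc n) k = b ^ (n - l) * X + Y"
      using Suc.IH[of k] Suc.IH[of l] 3 by (simp_all add: X_def Y_def Z_def)
    have D: "qbinom b (Suc n) (Suc k) = Y + b ^ Suc k * Z" "qbinom b (Suc n) k = X + b ^ k * Y"
      using 3 by (simp_all add: X_def Y_def Z_def qbinom.simps(3))
    have "qbinom b (Suc (Suc n)) (Suc k) = (b ^ (n - l) * X + Y) + b ^ Suc k * (b ^ (n - k) * Y + Z)"
      by (simp only: qbinom.simps(3) flip: IH)
    also have "\<dots> = b ^ (n - l) * X + Y + (b ^ Suc k * b ^ (n - k)) * Y + b ^ Suc k * Z"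
      by (simp only: distrib_left mult.assoc add.assoc)
    also have "\<dots> = b ^ (n - l) * (X + b ^ k * Y) + (Y + b ^ Suc k * Z)"
      by (simp only: distrib_left mult.assoc add_ac flip: e)
    also have "\<dots> = b ^ (Suc n - k) * qbinom b (Suc n) k + qbinom b (Suc n) (Suc k)"
      using 3 D by simp
    finally show ?thesis .
  qed
qed simp

lemma qbinom_symmetric: "k \<le> n \<Longrightarrow> qbinom b n (n - k) = qbinom b n k"
proof (induction n arbitrary: k)
  case (Suc n)
  consider "k = 0" | "k = Suc n" | l d where "k = Suc l" "n = l + Suc d"
    using Suc.prems by (cases k; cases "k = Suc n") (auto simp: less_iff_Suc_add le_eq_less_or_eq)
  then show ?case
  proof cases
    case 3
    have "qbinom b (Suc n) (Suc d) = b ^ (n - d) * qbinom b n d + qbinom b n (Suc d)"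
      using qbinom_Suc_Suc' 3 by simp
    also have "qbinom b n d = qbinom b n (Suc l)"
      using Suc.IH[of "Suc l"] 3 by simp
    also have "qbinom b n (Suc d) = qbinom b n l"
      using Suc.IH[of l] 3 by simp
    finally show ?thesis using 3 by (simp add: add.commute qbinom.simps(3))
  qed simp_all
qed simp

section \<open>Symmetric matrices in characteristic two\<close>

text \<open>Reindexing by h multiplies the sum by c, so the sum equals c times itself. With h a
  translation, this is the source of every vanishing character sum below.\<close>

lemma sum_char_zero:
  fixes \<psi> :: "'c \<Rightarrow> real"
  assumes "bij_betw h G G" "\<And>y. y \<in> G \<Longrightarrow> \<psi> (h y) = c * \<psi> y" "c \<noteq> 1"
  shows "(\<Sum>y\<in>G. \<psi> y) = 0"
proof -
  have "(\<Sum>y\<in>G. \<psi> y) = (\<Sum>y\<in>G. \<psi> (h y))"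
    by (rule sum.reindex_bij_betw[OF assms(1), symmetric])
  also have "\<dots> = c * (\<Sum>y\<in>G. \<psi> y)"
    using assms(2) by (simp add: sum_distrib_left)
  finally show ?thesis using assms(3) by simp
qed

text \<open>A character of a group of exponent two satisfies
  \<open>\<chi> x * \<chi> x = \<chi> 0 = 1\<close>. Only the values 1 and -1 occur, so \<chi> may
  be taken real, and squares of character sums are nonnegative.\<close>

locale char2_character =
  fixes \<chi> :: "'a::{field,finite} \<Rightarrow> real" and q :: nat
  assumes card_field: "CARD('a) = q"
    and add_self: "(x::'a) + x = 0"
    and chi_0: "\<chi> 0 = 1"
    and chi_add: "\<chi> (x + y) = \<chi> x * \<chi> y"
    and chi_nontrivial: "\<exists>x. \<chi> x \<noteq> 1"
begin

lemma q_ge_2: "2 \<le> q"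
proof -
  have "card {0, 1::'a} \<le> q" unfolding card_field[symmetric] by (rule card_mono) auto
  then show ?thesis by simp
qed

lemma uminus_eq: "- x = (x::'a)"
  using add_self minus_unique by blast

lemma minus_eq: "x - y = (x::'a) + y"
  using uminus_eq[of y] by (metis diff_conv_add_uminus)

lemma add_eq_0_iff_eq: "x + y = (0::'a) \<longleftrightarrow> x = y"
  by (metis add_self add_left_cancel)

text \<open>Vectors are total functions that vanish outside the index set. Equality is then plain
  equality of functions, and an index can be added without changing the type.\<close>

definition vecs :: "'i set \<Rightarrow> ('i \<Rightarrow> 'a) set" where
  "vecs I = {x. \<forall>i. i \<notin> I \<longrightarrow> x i = 0}"

definition dot :: "'i set \<Rightarrow> ('i \<Rightarrow> 'a) \<Rightarrow> ('i \<Rightarrow> 'a) \<Rightarrow> 'a" where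
  "dot I x y = (\<Sum>i\<in>I. x i * y i)"

definition app :: "'i set \<Rightarrow> ('i \<Rightarrow> 'i \<Rightarrow> 'a) \<Rightarrow> ('i \<Rightarrow> 'a) \<Rightarrow> 'i \<Rightarrow> 'a" where
  "app I S x = (\<lambda>i. \<Sum>j\<in>I. S i j * x j)"

definition symm_mats :: "'a set \<Rightarrow> 'i set \<Rightarrow> ('i \<Rightarrow> 'i \<Rightarrow> 'a) set" where
  "symm_mats D I = {S. (\<forall>i j. S i j = S j i) \<and> (\<forall>i j. i \<notin> I \<longrightarrow> S i j = 0) \<and> (\<forall>i\<in>I. S i i \<in> D)}"

definition null :: "'i set \<Rightarrow> ('i \<Rightarrow> 'i \<Rightarrow> 'a) \<Rightarrow> ('i \<Rightarrow> 'a) set" where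
  "null I S = {x \<in> vecs I. app I S x = (\<lambda>_. 0)}"

definition img :: "'i set \<Rightarrow> ('i \<Rightarrow> 'i \<Rightarrow> 'a) \<Rightarrow> ('i \<Rightarrow> 'a) set" where
  "img I S = app I S ` vecs I"

lemma bij_vecs_insert:
  assumes "p \<notin> I"
  shows "bij_betw (\<lambda>(x, z). x(p := z)) (vecs I \<times> UNIV) (vecs (insert p I))"
  by (rule bij_betwI[where g = "\<lambda>y. (y(p := 0), y p)"])
    (use assms in \<open>auto simp: vecs_def fun_eq_iff\<close>)

lemma vecs_empty [simp]: "vecs {} = {\<lambda>_. 0}"
  by (auto simp: vecs_def)

lemma finite_vecs [simp]: "finite I \<Longrightarrow> finite (vecs I)"
  and card_vecs: "finite I \<Longrightarrow> card (vecs I) = q ^ card I"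
proof (induction I rule: finite_induct)
  case (insert p I)
  case 1
  show ?case using bij_betw_finite[OF bij_vecs_insert[OF insert(2)]] insert by simp
  case 2
  show ?case using bij_betw_same_card[OF bij_vecs_insert[OF insert(2)]] insert
    by (simp add: card_cartesian_product card_field mult.commute)
qed auto

lemma sum_chi_vecs:
  assumes "finite I"
  shows "(\<Sum>x\<in>vecs I. \<chi> (dot I x v)) = (if \<forall>i\<in>I. v i = 0 then q ^ card I else 0)"
proof (cases "\<forall>i\<in>I. v i = 0")
  case True
  then have "dot I x v = 0" for x by (simp add: dot_def)
  then show ?thesis using True assms by (simp add: chi_0 card_vecs)
next
  case False
  then obtain i where i: "i \<in> I" "v i \<noteq> 0" by blast
  obtain z where z: "\<chi> z \<noteq> 1" using chi_nontrivial by blast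
  define h where "h = (\<lambda>x. x(i := x i + z / v i))"
  have "(\<Sum>x\<in>vecs I. \<chi> (dot I x v)) = 0"
  proof (rule sum_char_zero[where h = h and c = "\<chi> z"])
    show "bij_betw h (vecs I) (vecs I)"
      by (rule bij_betwI[where g = "\<lambda>x. x(i := x i - z / v i)"])
        (use i in \<open>auto simp: h_def vecs_def fun_eq_iff\<close>)
    fix y
    have "dot I (h y) v = (\<Sum>j\<in>I. y j * v j + (if j = i then z else 0))"
      unfolding dot_def by (rule sum.cong) (use i in \<open>auto simp: h_def field_simps\<close>)
    also have "\<dots> = dot I y v + z"
      using assms i by (simp add: sum.distrib dot_def)
    finally show "\<chi> (dot I (h y) v) = \<chi> z * \<chi> (dot I y v)"
      by (simp add: chi_add)
  qed (use z in auto)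
  then show ?thesis using False by auto
qed

lemma app_vecs: "S \<in> symm_mats D I \<Longrightarrow> app I S x \<in> vecs I"
  by (auto simp: app_def vecs_def symm_mats_def)

lemma dot_app:
  assumes "S \<in> symm_mats D I"
  shows "dot I x (app I S y) = dot I (app I S x) y"
proof -
  have "dot I x (app I S y) = (\<Sum>i\<in>I. \<Sum>j\<in>I. x i * S i j * y j)"
    by (simp add: dot_def app_def sum_distrib_left mult.assoc)
  also have "\<dots> = (\<Sum>j\<in>I. \<Sum>i\<in>I. x i * S i j * y j)" by (rule sum.swap)
  also have "\<dots> = dot I (app I S x) y"
    unfolding dot_def app_def sum_distrib_right
    by (intro sum.cong refl) (use assms in \<open>auto simp: symm_mats_def mult.commute\<close>)
  finally show ?thesis .
qed

lemma dot_add_right: "dot I x (\<lambda>i. y i + z i) = dot I x y + dot I x z"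
  and dot_add_left: "dot I (\<lambda>i. y i + z i) x = dot I y x + dot I z x"
  and dot_scale_right: "dot I x (\<lambda>i. c * y i) = c * dot I x y"
  and dot_scale_left: "dot I (\<lambda>i. c * y i) x = c * dot I y x"
  by (simp_all add: dot_def sum.distrib algebra_simps sum_distrib_left)

lemma dot_commute: "dot I x y = dot I y x"
  by (simp add: dot_def mult.commute)

lemma app_add: "app I S (\<lambda>i. x i + y i) = (\<lambda>i. app I S x i + app I S y i)"
  and app_scale: "app I S (\<lambda>i. c * x i) = (\<lambda>i. c * app I S x i)"
  by (simp_all add: app_def sum.distrib algebra_simps sum_distrib_left fun_eq_iff)

lemma vecs_zero [simp]: "(\<lambda>_. 0) \<in> vecs I"
  and vecs_add: "x \<in> vecs I \<Longrightarrow> y \<in> vecs I \<Longrightarrow> (\<lambda>i. x i + y i) \<in> vecs I"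
  and vecs_scale: "x \<in> vecs I \<Longrightarrow> (\<lambda>i. c * x i) \<in> vecs I"
  by (auto simp: vecs_def)

lemma zero_in_null: "(\<lambda>_. 0) \<in> null I S"
  by (simp add: null_def app_def)

text \<open>Counting solutions of \<open>S y = v\<close> with characters shows that the image of a symmetric
  matrix is the orthogonal complement of its kernel.\<close>

lemma not_img_witness:
  assumes fin: "finite I" and S: "S \<in> symm_mats D I" and v: "v \<in> vecs I" "v \<notin> img I S"
  obtains x where "x \<in> null I S" "dot I x v \<noteq> 0"
proof (rule ccontr)
  assume "\<not> thesis"
  with that have perp: "dot I x v = 0" if "x \<in> null I S" for x using that by blast
  \<comment> \<open>If v were orthogonal to the kernel, \<open>?T\<close> would have two values.
    Summed over y first it is \<open>q ^ card I\<close> times the order of the kernel; summed over x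
    first each inner sum is 0, since \<open>app I S y + v\<close> never vanishes.\<close>
  let ?T = "\<Sum>x\<in>vecs I. \<Sum>y\<in>vecs I. \<chi> (dot I y (app I S x) + dot I x v)"
  have "(\<Sum>y\<in>vecs I. \<chi> (dot I y (app I S x) + dot I x v)) =
      (if x \<in> null I S then real (q ^ card I) else 0)" if x: "x \<in> vecs I" for x
  proof -
    have "(\<forall>i\<in>I. app I S x i = 0) \<longleftrightarrow> x \<in> null I S"
      using x app_vecs[OF S, of x] by (auto simp: null_def vecs_def fun_eq_iff)
    then show ?thesis
      using sum_chi_vecs[OF fin, of "app I S x"] perp[of x]
      by (auto simp: chi_add chi_0 sum_distrib_right[symmetric])
  qed
  then have "?T = (\<Sum>x\<in>vecs I. (if x \<in> null I S then real (q ^ card I) else 0))"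
    by simp
  also have "\<dots> = (\<Sum>x\<in>vecs I \<inter> null I S. real (q ^ card I))"
    by (rule sum.inter_restrict[symmetric]) (use fin in simp)
  also have "\<dots> = real (q ^ card I * card (vecs I \<inter> null I S))"
    by simp
  finally have T1: "?T = real (q ^ card I * card (vecs I \<inter> null I S))" .
  have "?T = (\<Sum>y\<in>vecs I. \<Sum>x\<in>vecs I. \<chi> (dot I x (\<lambda>i. app I S y i + v i)))"
  proof -
    have "dot I y (app I S x) + dot I x v = dot I x (\<lambda>i. app I S y i + v i)" for x y
      using dot_app[OF S, of y x] dot_commute[of I "app I S y" x] by (simp add: dot_add_right)
    then show ?thesis by (subst sum.swap) simp
  qed
  also have "\<dots> = (\<Sum>y\<in>vecs I. 0)"
  proof (rule sum.cong[OF refl])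
    fix y assume y: "y \<in> vecs I"
    have "\<not> (\<forall>i\<in>I. app I S y i + v i = 0)"
    proof
      assume "\<forall>i\<in>I. app I S y i + v i = 0"
      then have "v i = app I S y i" for i
        using v(1) app_vecs[OF S, of y] by (cases "i \<in> I") (auto simp: vecs_def add_eq_0_iff_eq)
      then have "v = app I S y" by blast
      then show False using v(2) y by (auto simp: img_def)
    qed
    then show "(\<Sum>x\<in>vecs I. \<chi> (dot I x (\<lambda>i. app I S y i + v i))) = 0"
      unfolding sum_chi_vecs[OF fin] by (simp only: if_False of_nat_0)
  qed
  finally have "card (vecs I \<inter> null I S) = 0" using T1 q_ge_2 by simp
  then have "vecs I \<inter> null I S = {}" using fin by simp
  then show False using zero_in_null[of I S] vecs_zero[of I] by blast
qed

section \<open>Bordering by one row and column: the kernel\<close>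

definition bordered :: "'i \<Rightarrow> ('i \<Rightarrow> 'i \<Rightarrow> 'a) \<Rightarrow> ('i \<Rightarrow> 'a) \<Rightarrow> 'a \<Rightarrow> 'i \<Rightarrow> 'i \<Rightarrow> 'a" where
  "bordered p S v a = (\<lambda>i j. if i = p then (if j = p then a else v j) else if j = p then v i else S i j)"

lemma bij_bordered:
  assumes "p \<notin> I"
  shows "bij_betw (\<lambda>(S, v, a). bordered p S v a) (symm_mats D I \<times> vecs I \<times> D) (symm_mats D (insert p I))"
proof (rule bij_betwI[where g = "\<lambda>T. (\<lambda>i j. if i = p \<or> j = p then 0 else T i j, (\<lambda>i. if i = p then 0 else T i p), T p p)"])
  show "(\<lambda>(S, v, a). bordered p S v a) \<in> symm_mats D I \<times> vecs I \<times> D \<rightarrow> symm_mats D (insert p I)"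
    using assms by (fastforce simp: symm_mats_def bordered_def vecs_def)
  show "(\<lambda>T. (\<lambda>i j. if i = p \<or> j = p then 0 else T i j, (\<lambda>i. if i = p then 0 else T i p), T p p))
    \<in> symm_mats D (insert p I) \<rightarrow> symm_mats D I \<times> vecs I \<times> D"
    using assms by (fastforce simp: symm_mats_def vecs_def)
next
  fix x assume x: "x \<in> symm_mats D I \<times> vecs I \<times> D"
  obtain S v a where Sva: "x = (S, v, a)" by (cases x)
  have "S p j = 0" "S i p = 0" "v p = 0" for i j
    using x assms Sva by (auto simp: symm_mats_def vecs_def)
  then show "(\<lambda>T. (\<lambda>i j. if i = p \<or> j = p then 0 else T i j, (\<lambda>i. if i = p then 0 else T i p), T p p))
     ((\<lambda>(S, v, a). bordered p S v a) x) = x"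
    unfolding Sva by (auto simp: bordered_def fun_eq_iff)
next
  fix T assume "T \<in> symm_mats D (insert p I)"
  then have "T i j = T j i" for i j by (auto simp: symm_mats_def)
  then show "(\<lambda>(S, v, a). bordered p S v a) (\<lambda>i j. if i = p \<or> j = p then 0 else T i j, (\<lambda>i. if i = p then 0 else T i p), T p p) = T"
    by (auto simp: bordered_def fun_eq_iff)
qed

lemma symm_mats_empty: "symm_mats D {} = {\<lambda>_ _. 0}"
  by (auto simp: symm_mats_def fun_eq_iff)

lemma finite_symm_mats [simp]: "finite I \<Longrightarrow> finite (symm_mats D I)"
proof (induction I rule: finite_induct)
  case (insert p I)
  then show ?case using bij_betw_finite[OF bij_bordered[OF insert(2), of D]] by simp
qed (simp add: symm_mats_empty)

lemma sum_symm_mats_insert: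
  assumes "finite I" "p \<notin> I"
  shows "(\<Sum>S\<in>symm_mats D (insert p I). f S) =
    (\<Sum>S\<in>symm_mats D I. \<Sum>v\<in>vecs I. \<Sum>a\<in>D. (f (bordered p S v a) :: real))"
proof -
  have "(\<Sum>S\<in>symm_mats D (insert p I). f S) =
    (\<Sum>(S, v, a)\<in>symm_mats D I \<times> vecs I \<times> D. f (bordered p S v a))"
    using sum.reindex_bij_betw[OF bij_bordered[OF assms(2), of D], of f]
    by (simp add: case_prod_unfold)
  then show ?thesis using assms by (simp add: sum.cartesian_product)
qed

lemma null_bordered:
  assumes p: "p \<notin> I" and fin: "finite I" and S: "S \<in> symm_mats D I" and v: "v \<in> vecs I"
  shows "card (null (insert p I) (bordered p S v a)) =
    card {(y, z). y \<in> vecs I \<and> (\<lambda>i. app I S y i + z * v i) = (\<lambda>_. 0) \<and> dot I y v + a * z = 0}"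
    (is "_ = card ?X")
proof -
  let ?f = "\<lambda>(x :: 'b \<Rightarrow> 'a, z). x(p := z)"
  have app: "app (insert p I) (bordered p S v a) (y(p := z)) =
      (\<lambda>i. if i = p then dot I y v + a * z else app I S y i + z * v i)" (is "?l = ?r") 
    if "y \<in> vecs I" for y z
  proof
    fix i
    have *: "(\<Sum>j\<in>I. bordered p S v a i j * (y(p := z)) j)
        = (\<Sum>j\<in>I. (if i = p then v j else S i j) * y j)"
      by (rule sum.cong[OF refl]) (use p in \<open>auto simp: bordered_def\<close>)
    show "?l i = ?r i"
      unfolding app_def sum.insert[OF fin p] *
      by (auto simp: bordered_def dot_def mult.commute add.commute)
  qed
  have "null (insert p I) (bordered p S v a) = ?f ` ?X"
  proof safe
    fix x assume x: "x \<in> null (insert p I) (bordered p S v a)"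
    then have xv: "x \<in> vecs (insert p I)" by (simp add: null_def)
    define y z where "y = x(p := 0)" and "z = x p"
    have y: "y \<in> vecs I" and xy: "x = y(p := z)"
      using xv by (auto simp: y_def z_def vecs_def)
    have 0: "(\<lambda>i. if i = p then dot I y v + a * z else app I S y i + z * v i) = (\<lambda>_. 0)"
      using x app[OF y, of z] by (simp add: null_def xy)
    have "app I S y i + z * v i = 0" for i
    proof (cases "i = p")
      case True
      then show ?thesis using app_vecs[OF S, of y] v p by (simp add: vecs_def)
    qed (use fun_cong[OF 0, of i] in simp)
    then show "x \<in> ?f ` ?X"
      using y xy fun_cong[OF 0, of p] by (auto intro!: image_eqI[where x = "(y, z)"])
  next
    fix y z assume y: "y \<in> vecs I" and yz: "(\<lambda>i. app I S y i + z * v i) = (\<lambda>_. 0)" "dot I y v + a * z = 0"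
    show "y(p := z) \<in> null (insert p I) (bordered p S v a)"
      using y yz fun_cong[OF yz(1)] by (auto simp: null_def app[OF y] vecs_def fun_eq_iff)
  qed
  moreover have "inj_on ?f ?X"
    using bij_vecs_insert[OF p] by (auto simp: bij_betw_def intro: inj_on_subset)
  ultimately show ?thesis by (simp add: card_image)
qed

lemma finite_null [simp]: "finite I \<Longrightarrow> finite (null I S)"
  by (simp add: null_def)

lemma null_add: "x \<in> null I S \<Longrightarrow> y \<in> null I S \<Longrightarrow> (\<lambda>i. x i + y i) \<in> null I S"
  and null_scale: "x \<in> null I S \<Longrightarrow> (\<lambda>i. c * x i) \<in> null I S"
  by (auto simp: null_def vecs_add vecs_scale app_add app_scale fun_eq_iff)

text \<open>A kernel vector of the bordered matrix has last entry 0, otherwise v would be an image.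
  What remains are the y in the kernel of S orthogonal to v; by \<open>not_img_witness\<close> they
  form a proper hyperplane, and \<open>x1\<close> spans a complement.\<close>

lemma card_null_bordered_notin:
  assumes p: "p \<notin> I" and fin: "finite I" and S: "S \<in> symm_mats D I"
    and v: "v \<in> vecs I" "v \<notin> img I S"
  shows "q * card (null (insert p I) (bordered p S v a)) = card (null I S)"
proof -
  obtain x where x: "x \<in> null I S" "dot I x v \<noteq> 0" using not_img_witness[OF fin S v] .
  define x1 where "x1 = (\<lambda>i. (1 / dot I x v) * x i)"
  have x1: "x1 \<in> null I S" "dot I x1 v = 1"
    unfolding x1_def dot_scale_left by (rule null_scale) (use x in simp_all)
  let ?K = "{y \<in> null I S. dot I y v = 0}"
  have z0: "z = 0" if "y \<in> vecs I" "(\<lambda>i. app I S y i + z * v i) = (\<lambda>_. 0)" for y z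
  proof (rule ccontr)
    assume "z \<noteq> 0"
    have "app I S y i = z * v i" for i
      using fun_cong[OF that(2), of i] by (simp add: add_eq_0_iff_eq)
    then have "v = app I S (\<lambda>i. (1 / z) * y i)"
      unfolding app_scale using \<open>z \<noteq> 0\<close> by auto
    then show False using v(2) that(1) by (simp only: img_def) (blast intro!: vecs_scale)
  qed
  have "{(y, z). y \<in> vecs I \<and> (\<lambda>i. app I S y i + z * v i) = (\<lambda>_. 0) \<and> dot I y v + a * z = 0}
    = (\<lambda>y. (y, 0)) ` ?K"
    using z0 by (fastforce simp: null_def)
  then have 1: "card (null (insert p I) (bordered p S v a)) = card ?K"
    by (simp add: null_bordered[OF p fin S v(1)] card_image inj_on_def)
  have "bij_betw (\<lambda>(y, c). (\<lambda>i. y i + c * x1 i)) (?K \<times> UNIV) (null I S)"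
  proof (rule bij_betwI[where g = "\<lambda>y. (\<lambda>i. y i + dot I y v * x1 i, dot I y v)"])
    show "(\<lambda>(y, c). (\<lambda>i. y i + c * x1 i)) \<in> ?K \<times> UNIV \<rightarrow> null I S"
      by (auto intro!: null_add null_scale x1)
    show "(\<lambda>y. (\<lambda>i. y i + dot I y v * x1 i, dot I y v)) \<in> null I S \<rightarrow> ?K \<times> UNIV"
      by (auto intro!: null_add null_scale x1 simp: dot_add_left dot_scale_left x1 add_self)
  qed (auto simp: dot_add_left dot_scale_left x1 add_self add.assoc fun_eq_iff)
  from bij_betw_same_card[OF this] show ?thesis
    by (simp add: 1 card_cartesian_product card_field mult.commute)
qed

text \<open>Replacing y by \<open>y + z * y0\<close> turns the first kernel equation into membership
  in the kernel of S and the second into \<open>z * (dot I y0 v + a) = 0\<close>. So z is free if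
  \<open>a = dot I y0 v\<close> and zero otherwise.\<close>

lemma card_null_bordered_in:
  assumes p: "p \<notin> I" and fin: "finite I" and S: "S \<in> symm_mats D I"
    and y0: "y0 \<in> vecs I" and v: "v = app I S y0"
  shows "card (null (insert p I) (bordered p S v a)) =
    (if a = dot I y0 v then q * card (null I S) else card (null I S))"
proof -
  let ?X = "{(y, z). y \<in> vecs I \<and> (\<lambda>i. app I S y i + z * v i) = (\<lambda>_. 0) \<and> dot I y v + a * z = 0}"
  let ?e = "dot I y0 v"
  have vv: "v \<in> vecs I" using app_vecs[OF S] v by simp
  have dot: "dot I y v = z * ?e" if "(\<lambda>i. app I S y i + z * v i) = (\<lambda>_. 0)" for y z
  proof -
    have "app I S y = (\<lambda>i. z * v i)"
      using fun_cong[OF that] by (auto simp: add_eq_0_iff_eq)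
    then show ?thesis
      using dot_app[OF S, of y y0] by (simp add: v dot_scale_left dot_commute)
  qed
  have mem: "(\<lambda>i. app I S y i + z * v i) = (\<lambda>_. 0) \<longleftrightarrow> (\<lambda>i. y i + z * y0 i) \<in> null I S"
    if "y \<in> vecs I" for y z
    using that y0 by (auto simp: null_def app_add app_scale v intro!: vecs_add vecs_scale)
  show ?thesis
  proof (cases "a = ?e")
    case True
    have "bij_betw (\<lambda>(k, z). (\<lambda>i. k i + z * y0 i, z)) (null I S \<times> UNIV) ?X"
    proof (rule bij_betwI[where g = "\<lambda>(y, z). (\<lambda>i. y i + z * y0 i, z)"])
      show "(\<lambda>(k, z). (\<lambda>i. k i + z * y0 i, z)) \<in> null I S \<times> UNIV \<rightarrow> ?X"
      proof safe
        fix k z assume k: "k \<in> null I S"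
        then have kv: "k \<in> vecs I" by (simp add: null_def)
        then show y: "(\<lambda>i. k i + z * y0 i) \<in> vecs I"
          by (intro vecs_add vecs_scale y0)
        have "(\<lambda>i. (k i + z * y0 i) + z * y0 i) = k"
          by (simp add: add.assoc add_self)
        then show 1: "(\<lambda>i. app I S (\<lambda>i. k i + z * y0 i) i + z * v i) = (\<lambda>_. 0)"
          using mem[OF y, of z] k by simp
        show "dot I (\<lambda>i. k i + z * y0 i) v + a * z = 0"
          using dot[OF 1] by (simp add: True mult.commute add_self)
      qed
      show "(\<lambda>(y, z). (\<lambda>i. y i + z * y0 i, z)) \<in> ?X \<rightarrow> null I S \<times> UNIV"
        using mem by auto
    qed (auto simp: add.assoc add_self)
    from bij_betw_same_card[OF this] show ?thesis
      by (simp add: null_bordered[OF p fin S vv] True card_cartesian_product card_field mult.commute)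
  next
    case False
    have "?X = (\<lambda>y. (y, 0)) ` null I S"
    proof safe
      fix y z assume y: "y \<in> vecs I" and yz: "(\<lambda>i. app I S y i + z * v i) = (\<lambda>_. 0)" "dot I y v + a * z = 0"
      have "z * (?e + a) = 0" using dot[OF yz(1)] yz(2) by (simp add: algebra_simps)
      then have "z = 0" using False by (auto simp: add_eq_0_iff_eq)
      then show "(y, z) \<in> (\<lambda>y. (y, 0)) ` null I S" using mem[OF y, of z] yz by auto
    next
      fix y assume y: "y \<in> null I S"
      then show yv: "y \<in> vecs I" by (simp add: null_def)
      show 1: "(\<lambda>i. app I S y i + 0 * v i) = (\<lambda>_. 0)" using mem[OF yv, of 0] y by simp
      show "dot I y v + a * 0 = 0" using dot[OF 1] by simp
    qed
    then show ?thesis using False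
      by (simp add: null_bordered[OF p fin S vv] card_image inj_on_def)
  qed
qed

lemma symm_mats_insertE:
  assumes "S \<in> symm_mats D (insert p I)" "p \<notin> I"
  obtains S' v a where "S' \<in> symm_mats D I" "v \<in> vecs I" "a \<in> D" "S = bordered p S' v a"
proof -
  have "S \<in> (\<lambda>(S, v, a). bordered p S v a) ` (symm_mats D I \<times> vecs I \<times> D)"
    using bij_bordered[OF assms(2), of D] assms(1) by (simp only: bij_betw_def)
  then obtain x where "x \<in> symm_mats D I \<times> vecs I \<times> D" "S = (\<lambda>(S, v, a). bordered p S v a) x"
    by (elim imageE)
  then show thesis using that by (cases x) auto
qed

lemma bordered_in:
  assumes "p \<notin> I" "S \<in> symm_mats D I" "v \<in> vecs I" "a \<in> D"
  shows "bordered p S v a \<in> symm_mats D (insert p I)"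
  using bij_betw_apply[OF bij_bordered[OF assms(1), of D], of "(S, v, a)"] assms by simp

section \<open>Rank, defined by counting\<close>

definition nullity :: "'i set \<Rightarrow> ('i \<Rightarrow> 'i \<Rightarrow> 'a) \<Rightarrow> nat" where
  "nullity I S = (THE h. card (null I S) = q ^ h)"

definition rk :: "'i set \<Rightarrow> ('i \<Rightarrow> 'i \<Rightarrow> 'a) \<Rightarrow> nat" where
  "rk I S = card I - nullity I S"

lemma q_pow_eq_iff [simp]: "q ^ x = q ^ y \<longleftrightarrow> x = y"
  using q_ge_2 by (simp add: power_inject_exp)

lemma nullityI: "card (null I S) = q ^ h \<Longrightarrow> nullity I S = h"
  unfolding nullity_def by (rule the_equality) auto

text \<open>Justifies the definite description in \<open>nullity\<close>. Bordering keeps the order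
  of the kernel, multiplies it by q or divides it by q, so it stays a power of q.\<close>

lemma card_null:
  assumes "finite I" "S \<in> symm_mats D I"
  shows "card (null I S) = q ^ nullity I S"
proof -
  have "\<exists>h. card (null I S) = q ^ h"
    using assms
  proof (induction I arbitrary: S rule: finite_induct)
    case empty
    have "null {} S = {\<lambda>_. 0}" by (auto simp: null_def app_def)
    then show ?case by (auto intro: exI[of _ 0])
  next
    case (insert p I)
    obtain S' v a where S: "S' \<in> symm_mats D I" "v \<in> vecs I" "a \<in> D" "S = bordered p S' v a"
      using symm_mats_insertE[OF insert.prems insert(2)] .
    obtain h where h: "card (null I S') = q ^ h" using insert.IH[OF S(1)] by blast
    show ?case
    proof (cases "v \<in> img I S'")
      case True
      then obtain y0 where "y0 \<in> vecs I" "v = app I S' y0" by (auto simp: img_def)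
      from card_null_bordered_in[OF insert(2,1) S(1) this, of a] h S(4)
      show ?thesis by (metis power_Suc)
    next
      case False
      have "h \<noteq> 0" 
      proof
        assume "h = 0"
        then have "q * card (null (insert p I) S) = 1"
          using card_null_bordered_notin[OF insert(2,1) S(1,2) False, of a] h S(4) by simp
        then show False using q_ge_2 by simp
      qed
      then obtain h' where "h = Suc h'" using not0_implies_Suc by blast
      then have "q * card (null (insert p I) S) = q * q ^ h'"
        using card_null_bordered_notin[OF insert(2,1) S(1,2) False, of a] h S(4) by simp
      then show ?thesis using q_ge_2 by auto
    qed
  qed
  then show ?thesis using nullityI by blast
qed

lemma nullity_le:
  assumes "finite I" "S \<in> symm_mats D I"
  shows "nullity I S \<le> card I"
proof -
  have "card (null I S) \<le> card (vecs I)"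
    by (rule card_mono) (use assms in \<open>auto simp: null_def\<close>)
  then show ?thesis using assms q_ge_2 by (simp add: card_null card_vecs)
qed

lemma rk_le: "rk I S \<le> card I"
  by (simp add: rk_def)

lemma rk_bordered_notin:
  assumes p: "p \<notin> I" and fin: "finite I" and S: "S \<in> symm_mats D I"
    and v: "v \<in> vecs I" "v \<notin> img I S" and a: "a \<in> D"
  shows "rk (insert p I) (bordered p S v a) = rk I S + 2"
proof -
  have "q ^ Suc (nullity (insert p I) (bordered p S v a)) = q ^ nullity I S"
    using card_null_bordered_notin[OF p fin S v, of a] card_null[OF fin S]
      card_null[OF _ bordered_in[OF p S v(1) a]] fin by simp
  then have "Suc (nullity (insert p I) (bordered p S v a)) = nullity I S"
    by (simp only: q_pow_eq_iff)
  then show ?thesis using nullity_le[OF fin S] p fin by (simp add: rk_def)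
qed

lemma rk_bordered_in:
  assumes p: "p \<notin> I" and fin: "finite I" and S: "S \<in> symm_mats D I"
    and y0: "y0 \<in> vecs I" "v = app I S y0" and a: "a \<in> D"
  shows "rk (insert p I) (bordered p S v a) = (if a = dot I y0 v then rk I S else rk I S + 1)"
proof -
  have v: "v \<in> vecs I" using y0 app_vecs[OF S] by simp
  have "q ^ (nullity (insert p I) (bordered p S v a)) =
    q ^ (if a = dot I y0 v then Suc (nullity I S) else nullity I S)"
    using card_null_bordered_in[OF p fin S y0, of a] card_null[OF fin S]
      card_null[OF _ bordered_in[OF p S v a]] fin by simp
  then have "nullity (insert p I) (bordered p S v a) =
     (if a = dot I y0 v then Suc (nullity I S) else nullity I S)"
    by (simp only: q_pow_eq_iff)
  then show ?thesis using nullity_le[OF fin S] p fin by (auto simp: rk_def)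
qed

lemma card_img:
  assumes fin: "finite I" and S: "S \<in> symm_mats D I"
  shows "card (img I S) = q ^ rk I S"
proof -
  have fib: "card {x \<in> vecs I. app I S x = w} = card (null I S)" if "w \<in> img I S" for w
  proof -
    obtain x0 where x0: "x0 \<in> vecs I" "w = app I S x0"
      using \<open>w \<in> img I S\<close> by (auto simp: img_def)
    have "bij_betw (\<lambda>x i. x i + x0 i) (null I S) {x \<in> vecs I. app I S x = w}"
      by (rule bij_betwI[where g = "\<lambda>x i. x i + x0 i"])
        (use x0 in \<open>auto simp: null_def app_add add.assoc add_self intro!: vecs_add\<close>)
    from bij_betw_same_card[OF this] show ?thesis by simp
  qed
  have "card (vecs I) = (\<Sum>w\<in>img I S. card {x \<in> vecs I. app I S x = w})"
    using sum.image_gen[of "vecs I" "\<lambda>_. 1::nat" "app I S"] fin by (simp add: img_def)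
  also have "\<dots> = card (img I S) * card (null I S)" using fib by simp
  finally have "q ^ card I = card (img I S) * q ^ nullity I S"
    using fin S by (simp add: card_vecs card_null)
  moreover have "q ^ card I = q ^ rk I S * q ^ nullity I S"
    using nullity_le[OF fin S] by (simp add: rk_def flip: power_add)
  ultimately show ?thesis using q_ge_2 by simp
qed

text \<open>Off-diagonal terms occur in equal pairs and cancel in characteristic two. The lemma
  serves both for alternating forms and for the independence of the pairing from the coefficient
  matrix.\<close>

lemma alternating_sum_eq_0:
  assumes "finite I" "\<And>i j. i \<in> I \<Longrightarrow> j \<in> I \<Longrightarrow> S i j = S j i" "\<And>i. i \<in> I \<Longrightarrow> S i i = (0::'a)"
  shows "(\<Sum>i\<in>I. \<Sum>j\<in>I. S i j * (x i * x j)) = 0"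
  using assms
proof (induction I rule: finite_induct)
  case (insert p I)
  have "(\<Sum>i\<in>insert p I. \<Sum>j\<in>insert p I. S i j * (x i * x j))
    = (\<Sum>j\<in>I. S p j * (x p * x j)) + (\<Sum>i\<in>I. S i p * (x i * x p))"
    using insert.hyps insert.IH insert.prems by (simp add: sum.distrib)
  also have "(\<Sum>i\<in>I. S i p * (x i * x p)) = (\<Sum>j\<in>I. S p j * (x p * x j))"
    by (intro sum.cong refl) (simp add: insert.prems(1)[of _ p] mult.commute)
  finally show ?case by (simp add: add_self)
qed simp

lemma alternating_dot_app:
  assumes "finite I" "S \<in> symm_mats {0} I"
  shows "dot I x (app I S x) = 0"
proof -
  have "dot I x (app I S x) = (\<Sum>i\<in>I. \<Sum>j\<in>I. S i j * (x i * x j))"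
    by (simp add: dot_def app_def sum_distrib_left mult_ac)
  also have "\<dots> = 0"
    by (rule alternating_sum_eq_0) (use assms in \<open>auto simp: symm_mats_def\<close>)
  finally show ?thesis .
qed

text \<open>Bordering an alternating matrix by v with diagonal entry 0 changes the rank by 0 or 2:
  if \<open>v = app I S y0\<close>, then \<open>dot I y0 v = 0\<close> equals that entry, so the
  rank is kept.\<close>

lemma even_rk:
  assumes "finite I" "S \<in> symm_mats {0} I"
  shows "even (rk I S)"
  using assms
proof (induction I arbitrary: S rule: finite_induct)
  case empty
  then show ?case by (simp add: rk_def)
next
  case (insert p I)
  obtain S' v a where S: "S' \<in> symm_mats {0} I" "v \<in> vecs I" "a \<in> {0}" "S = bordered p S' v a"
    using symm_mats_insertE[OF insert.prems insert(2)] .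
  show ?case
  proof (cases "v \<in> img I S'")
    case True
    then obtain y0 where "y0 \<in> vecs I" "v = app I S' y0" by (auto simp: img_def)
    then show ?thesis
      using rk_bordered_in[OF insert(2,1) S(1), of y0 v a] S insert alternating_dot_app[OF insert(1) S(1)]
      by simp
  next
    case False
    then show ?thesis using rk_bordered_notin[OF insert(2,1) S(1,2) False S(3)] insert.IH S by simp
  qed
qed

definition hrk :: "'i set \<Rightarrow> ('i \<Rightarrow> 'i \<Rightarrow> 'a) \<Rightarrow> nat" where
  "hrk I S = (rk I S + 1) div 2"

text \<open>A row outside the image raises the rank by two for every a. For a row inside it, one
  value of a keeps the rank and all others in D raise it by one. From even rank this moves the half
  rank to \<open>\<sigma> + 1\<close>; from odd rank it does not, so all q values of a then give
  \<sigma>. The exponent \<open>2 * \<sigma> - rk I S\<close>, which is 0 or 1, covers both parities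
  and also the alternating case.\<close>

lemma sum_bordered:
  fixes g :: "nat \<Rightarrow> real"
  assumes D: "D = UNIV \<or> D = {0}" and p: "p \<notin> I" and fin: "finite I"
    and S: "S \<in> symm_mats D I" and v: "v \<in> vecs I"
  defines "\<sigma> \<equiv> hrk I S"
  shows "(\<Sum>a\<in>D. g (hrk (insert p I) (bordered p S v a))) =
    card D * g (\<sigma> + 1) + (if v \<in> img I S then q ^ (2 * \<sigma> - rk I S) * (g \<sigma> - g (\<sigma> + 1)) else (0::real))"
proof (cases "v \<in> img I S")
  case False
  then have "hrk (insert p I) (bordered p S v a) = \<sigma> + 1" if "a \<in> D" for a
    using rk_bordered_notin[OF p fin S v False that] by (simp add: hrk_def \<sigma>_def)
  then show ?thesis using False by simp
next
  case True
  then obtain y0 where y0: "y0 \<in> vecs I" "v = app I S y0" by (auto simp: img_def)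
  let ?e = "dot I y0 v" and ?\<rho> = "rk I S"
  have G: "g (hrk (insert p I) (bordered p S v a)) =
      (if a = ?e then g ((?\<rho> + 1) div 2) else g ((?\<rho> + 2) div 2))" if "a \<in> D" for a
    using rk_bordered_in[OF p fin S y0 that] by (simp add: hrk_def)
  show ?thesis
  proof (cases "D = {0}")
    case True
    have "?e = 0" using alternating_dot_app[OF fin] S True y0 by simp
    moreover have "even ?\<rho>" using even_rk fin S True by blast
    then obtain k where "?\<rho> = 2 * k" by (elim evenE)
    ultimately show ?thesis using G[of 0] True \<open>v \<in> img I S\<close> by (simp add: \<sigma>_def hrk_def)
  next
    case False
    then have D: "D = UNIV" using D by simp
    have "(\<Sum>a\<in>D. g (hrk (insert p I) (bordered p S v a))) =
      (\<Sum>a\<in>UNIV. (if a = ?e then g ((?\<rho> + 1) div 2) - g ((?\<rho> + 2) div 2) else 0) + g ((?\<rho> + 2) div 2))"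
      using G D by (intro sum.cong) auto
    also have "\<dots> = (g ((?\<rho> + 1) div 2) - g ((?\<rho> + 2) div 2)) + q * g ((?\<rho> + 2) div 2)"
      unfolding sum.distrib by (simp add: card_field)
    finally have *: "(\<Sum>a\<in>D. g (hrk (insert p I) (bordered p S v a))) =
       (g ((?\<rho> + 1) div 2) - g ((?\<rho> + 2) div 2)) + q * g ((?\<rho> + 2) div 2)" .
    show ?thesis
    proof (cases "even ?\<rho>")
      case True
      then obtain k where k: "?\<rho> = 2 * k" by (elim evenE)
      then show ?thesis unfolding * using D \<open>v \<in> img I S\<close> by (simp add: \<sigma>_def hrk_def card_field)
    next
      case False
      then obtain k where k: "?\<rho> = 2 * k + 1" by (elim oddE)
      then have "(?\<rho> + 2) div 2 = k + 1" "\<sigma> = k + 1" "2 * \<sigma> - ?\<rho> = 1"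
        by (simp_all add: \<sigma>_def hrk_def)
      then show ?thesis unfolding * using k D \<open>v \<in> img I S\<close> by (simp add: card_field algebra_simps)
    qed
  qed
qed

end

section \<open>Character sums over symmetric matrices\<close>

text \<open>What is left of a quadratic form, modulo its radical, when hyperbolic planes are split
  off: nothing, a square, or an anisotropic plane. The same tags later label the remainders of
  symmetric bilinear forms.\<close>

datatype kernel_kind = Trivial | Square | Elliptic

fun kernel_dim :: "kernel_kind \<Rightarrow> nat" where
  "kernel_dim Trivial = 0"
| "kernel_dim Square = 1"
| "kernel_dim Elliptic = 2"

definition kernel_part :: "'a::field \<Rightarrow> nat \<Rightarrow> kernel_kind \<Rightarrow> (nat \<Rightarrow> nat \<Rightarrow> 'a) \<Rightarrow> 'a" where
  "kernel_part lam s K M = (case K of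
      Trivial \<Rightarrow> 0
    | Square \<Rightarrow> M (2*s+1) (2*s+1)
    | Elliptic \<Rightarrow> M (2*s+1) (2*s+1) + M (2*s+1) (2*s+2) + lam * M (2*s+2) (2*s+2))"

text \<open>Applied to the matrix \<open>x\<^sub>i x\<^sub>j\<close> this is the value at \<open>x\<close> of a quadratic form in
  normal form; applied to a symmetric matrix it is the argument of \<open>\<chi>\<close> in its pairing with
  that form.\<close>

definition normal_sum :: "'a::field \<Rightarrow> nat \<Rightarrow> kernel_kind \<Rightarrow> (nat \<Rightarrow> nat \<Rightarrow> 'a) \<Rightarrow> 'a" where
  "normal_sum lam s K M = (\<Sum>i=1..s. M (2*i-1) (2*i)) + kernel_part lam s K M"

context char2_character
begin

section \<open>Summing out the last rows of a matrix\<close>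

definition esum :: "'a set \<Rightarrow> 'i set \<Rightarrow> (('i \<Rightarrow> 'i \<Rightarrow> 'a) \<Rightarrow> 'a) \<Rightarrow> (nat \<Rightarrow> real) \<Rightarrow> real" where
  "esum D I \<phi> g = (\<Sum>S\<in>symm_mats D I. g (hrk I S) * \<chi> (\<phi> S))"

lemma img_subset_vecs: "S \<in> symm_mats D I \<Longrightarrow> img I S \<subseteq> vecs I"
  by (auto simp: img_def app_vecs)

lemma q_pow_hrk: "real q ^ rk I S * real q ^ (2 * hrk I S - rk I S) = real q ^ (2 * hrk I S)"
proof -
  have "rk I S \<le> 2 * hrk I S" by (simp add: hrk_def)
  then show ?thesis by (simp flip: power_add)
qed

text \<open>The character ignores the new row, so \<open>sum_bordered\<close> can be summed over all
  v. The image accounts for \<open>q ^ rk\<close> rows, which completes the factor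
  \<open>q ^ (2 * \<sigma> - rk)\<close> to \<open>q ^ (2 * \<sigma>)\<close>.\<close>

lemma esum_zero_coordinate:
  fixes g :: "nat \<Rightarrow> real"
  assumes D: "D = UNIV \<or> D = {0}" and p: "p \<notin> I" and fin: "finite I"
    and \<phi>: "\<And>S v a. S \<in> symm_mats D I \<Longrightarrow> v \<in> vecs I \<Longrightarrow> a \<in> D \<Longrightarrow> \<phi> (bordered p S v a) = \<phi>' S"
  shows "esum D (insert p I) \<phi> g =
    esum D I \<phi>' (\<lambda>\<sigma>. q ^ (2 * \<sigma>) * (g \<sigma> - g (\<sigma> + 1)) + q ^ card I * card D * g (\<sigma> + 1))"
  unfolding esum_def sum_symm_mats_insert[OF fin p]
proof (rule sum.cong[OF refl])
  fix S assume S: "S \<in> symm_mats D I"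
  let ?\<sigma> = "hrk I S"
  have "(\<Sum>v\<in>vecs I. \<Sum>a\<in>D. g (hrk (insert p I) (bordered p S v a)) * \<chi> (\<phi> (bordered p S v a)))
    = (\<Sum>v\<in>vecs I. \<Sum>a\<in>D. g (hrk (insert p I) (bordered p S v a)) * \<chi> (\<phi>' S))"
    by (intro sum.cong refl) (simp add: \<phi> S)
  also have "\<dots> = (\<Sum>v\<in>vecs I. \<Sum>a\<in>D. g (hrk (insert p I) (bordered p S v a))) * \<chi> (\<phi>' S)"
    by (simp add: sum_distrib_right)
  also have "(\<Sum>v\<in>vecs I. \<Sum>a\<in>D. g (hrk (insert p I) (bordered p S v a)))
    = (\<Sum>v\<in>vecs I. card D * g (?\<sigma> + 1) +
        (if v \<in> img I S then q ^ (2 * ?\<sigma> - rk I S) * (g ?\<sigma> - g (?\<sigma> + 1)) else 0))"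
    by (rule sum.cong[OF refl]) (rule sum_bordered[OF D p fin S])
  also have "\<dots> = q ^ card I * (card D * g (?\<sigma> + 1)) +
      card (img I S) * (q ^ (2 * ?\<sigma> - rk I S) * (g ?\<sigma> - g (?\<sigma> + 1)))"
    unfolding sum.distrib sum.inter_restrict[OF finite_vecs[OF fin], symmetric]
    using img_subset_vecs[OF S] by (simp add: card_vecs fin Int_absorb1)
  also have "\<dots> = q ^ (2 * ?\<sigma>) * (g ?\<sigma> - g (?\<sigma> + 1)) + q ^ card I * card D * g (?\<sigma> + 1)"
    unfolding card_img[OF fin S] using q_pow_hrk[of I S] by (simp add: mult.assoc[symmetric])
  finally show "(\<Sum>v\<in>vecs I. \<Sum>a\<in>D. g (hrk (insert p I) (bordered p S v a)) * \<chi> (\<phi> (bordered p S v a)))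
     = (q ^ (2 * ?\<sigma>) * (g ?\<sigma> - g (?\<sigma> + 1)) + q ^ card I * card D * g (?\<sigma> + 1)) * \<chi> (\<phi>' S)"
    by simp
qed

text \<open>The image is closed under addition and \<open>\<chi> (v i)\<close> is a character on it,
  trivial exactly when row i of S is zero. Otherwise a multiple of a unit vector has an image whose
  i-th entry z satisfies \<open>\<chi> z \<noteq> 1\<close>.\<close>

lemma sum_chi_img:
  assumes fin: "finite I" and S: "S \<in> symm_mats D I" and i: "i \<in> I"
  shows "(\<Sum>v\<in>img I S. \<chi> (v i)) = (if \<forall>j. S i j = 0 then real (q ^ rk I S) else 0)"
proof (cases "\<forall>j. S i j = 0")
  case True
  then have "(\<Sum>v\<in>img I S. \<chi> (v i)) = (\<Sum>v\<in>img I S. 1)"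
    by (intro sum.cong refl) (auto simp: img_def app_def chi_0)
  then show ?thesis using True card_img[OF fin S] by simp
next
  case False
  then obtain j where j: "S i j \<noteq> 0" by blast
  then have jI: "j \<in> I" using S by (auto simp: symm_mats_def)
  obtain z where z: "\<chi> z \<noteq> 1" using chi_nontrivial by blast
  define x where "x = (\<lambda>k. if k = j then z / S i j else 0)"
  have x: "x \<in> vecs I" using jI by (auto simp: x_def vecs_def)
  have xi: "app I S x i = z"
    using jI j fin by (simp add: app_def x_def if_distrib cong: if_cong)
  have add: "(\<lambda>k. v k + app I S x k) \<in> img I S" if "v \<in> img I S" for v
  proof -
    obtain y where "y \<in> vecs I" "v = app I S y" using \<open>v \<in> img I S\<close> by (auto simp: img_def)
    then show ?thesis unfolding img_def
      by (intro image_eqI[where x = "\<lambda>k. y k + x k"]) (auto simp: app_add vecs_add x)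
  qed
  have "(\<Sum>v\<in>img I S. \<chi> (v i)) = 0"
  proof (rule sum_char_zero[where h = "\<lambda>v k. v k + app I S x k" and c = "\<chi> z"])
    show "bij_betw (\<lambda>v k. v k + app I S x k) (img I S) (img I S)"
      by (rule bij_betwI[where g = "\<lambda>v k. v k + app I S x k"]) (use add in \<open>auto simp: add.assoc add_self\<close>)
  qed (auto simp: chi_add xi z)
  then show ?thesis using False by auto
qed

text \<open>The entry \<open>v p'\<close> of the outer row enters the argument of \<chi> additively.
  Summed over all v it cancels the constant term of \<open>sum_bordered\<close>; summed over the
  image of the inner matrix T it vanishes unless row p' of T is zero. This forces v' and a' to be
  zero, and then T has the rank of S.\<close>

lemma esum_hyperbolic_pair:
  fixes g :: "nat \<Rightarrow> real"
  assumes D: "D = UNIV \<or> D = {0}" and p: "p \<notin> I" "p' \<notin> I" "p \<noteq> p'" and fin: "finite I"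
    and \<phi>: "\<And>S v a v' a'. S \<in> symm_mats D I \<Longrightarrow> v' \<in> vecs I \<Longrightarrow> a' \<in> D \<Longrightarrow> v \<in> vecs (insert p' I) \<Longrightarrow> a \<in> D \<Longrightarrow>
      \<phi> (bordered p (bordered p' S v' a') v a) = v p' + \<phi>' S"
  shows "esum D (insert p (insert p' I)) \<phi> g = esum D I \<phi>' (\<lambda>\<sigma>. q ^ (2 * \<sigma>) * (g \<sigma> - g (\<sigma> + 1)))"
proof -
  let ?I = "insert p' I" and ?J = "insert p (insert p' I)"
  have finI: "finite ?I" and pI: "p \<notin> ?I" using p fin by auto
  have 0: "(0::'a) \<in> D" using D by auto
  have step: "(\<Sum>v\<in>vecs ?I. \<Sum>a\<in>D. g (hrk ?J (bordered p T v a)) * \<chi> (\<phi> (bordered p T v a)))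
    = (if \<forall>j. T p' j = 0 then q ^ (2 * hrk ?I T) * (g (hrk ?I T) - g (hrk ?I T + 1)) * \<chi> (\<phi>' S) else 0)"
    if S: "S \<in> symm_mats D I" and v': "v' \<in> vecs I" and a': "a' \<in> D" and T_def: "T = bordered p' S v' a'"
    for S v' a' T
  proof -
    have T: "T \<in> symm_mats D ?I" unfolding T_def by (rule bordered_in[OF p(2) S v' a'])
    let ?\<sigma> = "hrk ?I T" and ?h = "hrk ?I T"
    define W where "W = real q ^ (2 * ?\<sigma> - rk ?I T) * (g ?\<sigma> - g (?\<sigma> + 1))"
    have "(\<Sum>v\<in>vecs ?I. \<Sum>a\<in>D. g (hrk ?J (bordered p T v a)) * \<chi> (\<phi> (bordered p T v a)))
      = (\<Sum>v\<in>vecs ?I. \<Sum>a\<in>D. g (hrk ?J (bordered p T v a)) * (\<chi> (v p') * \<chi> (\<phi>' S)))"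
      by (intro sum.cong refl) (simp add: \<phi> S v' a' T_def chi_add)
    also have "\<dots> = (\<Sum>v\<in>vecs ?I. (\<Sum>a\<in>D. g (hrk ?J (bordered p T v a))) * \<chi> (v p')) * \<chi> (\<phi>' S)"
      by (simp add: sum_distrib_right mult.assoc)
    also have "(\<Sum>v\<in>vecs ?I. (\<Sum>a\<in>D. g (hrk ?J (bordered p T v a))) * \<chi> (v p'))
      = (\<Sum>v\<in>vecs ?I. (card D * g (?\<sigma> + 1) + (if v \<in> img ?I T then W else 0)) * \<chi> (v p'))"
      by (intro sum.cong refl) (simp add: sum_bordered[OF D pI finI T] W_def)
    also have "\<dots> = card D * g (?\<sigma> + 1) * (\<Sum>v\<in>vecs ?I. \<chi> (v p')) + (\<Sum>v\<in>vecs ?I. if v \<in> img ?I T then W * \<chi> (v p') else 0)"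
      unfolding sum_distrib_left sum.distrib[symmetric] by (intro sum.cong refl) (simp add: algebra_simps)
    also have "(\<Sum>v\<in>vecs ?I. \<chi> (v p')) = 0"
    proof -
      have "dot ?I v (\<lambda>i. if i = p' then 1 else 0) = v p'" for v
        using finI by (simp add: dot_def if_distrib cong: if_cong)
      then show ?thesis
        using sum_chi_vecs[OF finI, of "\<lambda>i. if i = p' then 1 else 0"] by simp
    qed
    also have "(\<Sum>v\<in>vecs ?I. if v \<in> img ?I T then W * \<chi> (v p') else 0) = W * (\<Sum>v\<in>img ?I T. \<chi> (v p'))"
      unfolding sum.inter_restrict[OF finite_vecs[OF finI], symmetric]
      using img_subset_vecs[OF T] by (simp add: Int_absorb1 sum_distrib_left)
    also have "(\<Sum>v\<in>img ?I T. \<chi> (v p')) = (if \<forall>j. T p' j = 0 then real (q ^ rk ?I T) else 0)"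
      by (rule sum_chi_img[OF finI T]) simp
    finally show ?thesis
      using q_pow_hrk[of ?I T] by (auto simp: W_def mult_ac)
  qed
  have "esum D ?J \<phi> g = (\<Sum>S\<in>symm_mats D I. \<Sum>v'\<in>vecs I. \<Sum>a'\<in>D.
      (if \<forall>j. bordered p' S v' a' p' j = 0 then
         q ^ (2 * hrk ?I (bordered p' S v' a')) * (g (hrk ?I (bordered p' S v' a')) - g (hrk ?I (bordered p' S v' a') + 1)) * \<chi> (\<phi>' S) else 0))"
    unfolding esum_def sum_symm_mats_insert[OF finI pI] sum_symm_mats_insert[OF fin p(2)]
    by (intro sum.cong refl) (rule step[OF _ _ _ refl])
  also have "\<dots> = (\<Sum>S\<in>symm_mats D I. q ^ (2 * hrk I S) * (g (hrk I S) - g (hrk I S + 1)) * \<chi> (\<phi>' S))"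
  proof (rule sum.cong[OF refl])
    fix S assume S: "S \<in> symm_mats D I"
    let ?c = "q ^ (2 * hrk I S) * (g (hrk I S) - g (hrk I S + 1)) * \<chi> (\<phi>' S)"
    have row: "(\<forall>j. bordered p' S v' a' p' j = 0) \<longleftrightarrow> v' = (\<lambda>_. 0) \<and> a' = 0" if "v' \<in> vecs I" for v' a'
    proof
      assume *: "\<forall>j. bordered p' S v' a' p' j = 0"
      have "v' j = 0" for j
        using *[rule_format, of j] that p(2) by (cases "j = p'") (auto simp: bordered_def vecs_def)
      then show "v' = (\<lambda>_. 0) \<and> a' = 0" using *[rule_format, of p'] by (auto simp: bordered_def)
    qed (auto simp: bordered_def)
    have "app I S (\<lambda>_. 0) = (\<lambda>_. 0)" by (simp add: app_def)
    then have rk0: "hrk ?I (bordered p' S (\<lambda>_. 0) 0) = hrk I S"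
      using rk_bordered_in[OF p(2) fin S vecs_zero _ 0, of "\<lambda>_. 0"] by (simp add: hrk_def dot_def)
    have "(\<Sum>v'\<in>vecs I. \<Sum>a'\<in>D.
      (if \<forall>j. bordered p' S v' a' p' j = 0 then
         q ^ (2 * hrk ?I (bordered p' S v' a')) * (g (hrk ?I (bordered p' S v' a')) - g (hrk ?I (bordered p' S v' a') + 1)) * \<chi> (\<phi>' S) else 0))
      = (\<Sum>v'\<in>vecs I. if v' = (\<lambda>_. 0) then \<Sum>a'\<in>D. if a' = 0 then ?c else 0 else 0)"
      by (intro sum.cong refl) (auto simp: row rk0 intro!: sum.cong)
    also have "\<dots> = ?c"
      using fin 0 finite[of D] by (simp add: sum.delta')
    finally show "(\<Sum>v'\<in>vecs I. \<Sum>a'\<in>D.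
      (if \<forall>j. bordered p' S v' a' p' j = 0 then
         q ^ (2 * hrk ?I (bordered p' S v' a')) * (g (hrk ?I (bordered p' S v' a')) - g (hrk ?I (bordered p' S v' a') + 1)) * \<chi> (\<phi>' S) else 0)) = ?c" .
  qed
  finally show ?thesis unfolding esum_def by simp
qed

end

section \<open>The weights and the key identity\<close>

definition qpoly :: "nat \<Rightarrow> nat \<Rightarrow> nat \<Rightarrow> nat \<Rightarrow> real" where
  "qpoly q n j \<sigma> = qbinom (real q ^ 2) (n - \<sigma>) (n - j)"

text \<open>The second Pascal rule makes the difference a single binomial times
  \<open>q ^ (2 * (j - \<sigma>))\<close>. The factor \<open>q ^ (2 * \<sigma>)\<close> produced by
  the matrix recursion removes \<sigma> from this power, so the result is again a weight, up to a
  constant.\<close>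

lemma qpoly_diff:
  assumes "\<sigma> < n" "j < n"
  shows "real q ^ (2 * \<sigma>) * (qpoly q n j \<sigma> - qpoly q n j (\<sigma> + 1)) = real q ^ (2 * j) * qpoly q (n - 1) j \<sigma>"
proof -
  define N K where "N = n - 1 - \<sigma>" and "K = n - 1 - j"
  have NK: "n - \<sigma> = Suc N" "n - (\<sigma> + 1) = N" "n - j = Suc K" "n - 1 - \<sigma> = N" "n - 1 - j = K"
    using assms by (auto simp: N_def K_def)
  show ?thesis
  proof (cases "K \<le> N")
    case True
    then have "\<sigma> + (N - K) = j" using assms by (auto simp: N_def K_def)
    then have "(real q ^ 2) ^ \<sigma> * (real q ^ 2) ^ (N - K) = (real q ^ 2) ^ j"
      by (simp flip: power_add)
    then show ?thesis
      unfolding qpoly_def NK qbinom_Suc_Suc'[OF True] by (simp add: power_mult)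
  next
    case False
    then show ?thesis unfolding qpoly_def NK by simp
  qed
qed

lemma qpoly_top [simp]: "qpoly q n n \<sigma> = 1"
  by (simp add: qpoly_def)

context char2_character
begin

text \<open>Symmetric matrices of order \<open>k\<close> have the parameters of alternating matrices of order
  \<open>k + 1\<close>.\<close>

definition ambient :: "'a set \<Rightarrow> nat \<Rightarrow> nat" where
  "ambient D k = (if D = {0} then k else k + 1)"

text \<open>The largest odd number up to M, except that \<open>cexp 0 = 0\<close> by truncation. The
  rule \<open>cexp (M + 2) = cexp M + 2\<close> fails there, which is why \<open>j = 0\<close> is
  split off in the exponent computations; M = 0 admits no other j.\<close>

definition cexp :: "nat \<Rightarrow> nat" where
  "cexp M = (if even M then M - 1 else M)"

text \<open>The bound on r is part of the statement so that \<open>n - r\<close> is a true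
  difference and grows together with n.\<close>

definition key_identity :: "'a set \<Rightarrow> 'i set \<Rightarrow> (('i \<Rightarrow> 'i \<Rightarrow> 'a) \<Rightarrow> 'a) \<Rightarrow> nat \<Rightarrow> bool" where
  "key_identity D I \<phi> r \<longleftrightarrow> r \<le> ambient D (card I) div 2 \<and>
     (\<forall>j \<le> ambient D (card I) div 2. esum D I \<phi> (qpoly q (ambient D (card I) div 2) j) =
        real q ^ (cexp (ambient D (card I)) * j) * qbinom (real q ^ 2) (ambient D (card I) div 2 - r) j)"

lemma UNIV_neq_0: "(UNIV :: 'a set) \<noteq> {0}"
  by (metis UNIV_I singletonD zero_neq_one)

lemma hrk_le:
  assumes D: "D = UNIV \<or> D = {0}" and fin: "finite I" and S: "S \<in> symm_mats D I"
  shows "hrk I S \<le> ambient D (card I) div 2"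
proof -
  have "even (rk I S)" if "D = {0}" using even_rk fin S that by blast
  then have "(rk I S + 1) div 2 = rk I S div 2" if "D = {0}" using that by auto
  then show ?thesis using rk_le[of I S] by (auto simp: hrk_def ambient_def intro: div_le_mono)
qed

lemma esum_cong:
  assumes D: "D = UNIV \<or> D = {0}" and fin: "finite I"
    and "\<And>\<sigma>. \<sigma> \<le> ambient D (card I) div 2 \<Longrightarrow> g \<sigma> = g' \<sigma>"
  shows "esum D I \<phi> g = esum D I \<phi> g'"
  unfolding esum_def by (intro sum.cong refl) (simp add: assms(3) hrk_le[OF D fin])

lemma esum_linear: "esum D I \<phi> (\<lambda>\<sigma>. a * g \<sigma> + b * h \<sigma>) = a * esum D I \<phi> g + b * esum D I \<phi> h"
  by (simp add: esum_def sum_distrib_left sum.distrib algebra_simps)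

lemma esum_scale: "esum D I \<phi> (\<lambda>\<sigma>. a * g \<sigma>) = a * esum D I \<phi> g"
  by (simp add: esum_def sum_distrib_left mult_ac)

lemma esum_0: "esum D I \<phi> (\<lambda>\<sigma>. 0) = 0"
  by (simp add: esum_def)

text \<open>Two more coordinates raise n and r by one each, so \<open>n - r\<close> is unchanged,
  and by \<open>qpoly_diff\<close> the weight for j returns with the factor
  \<open>q ^ (2 * j)\<close>. For \<open>j = Suc n\<close> the weight is constant, its difference is
  0, and so is the binomial on the right.\<close>

lemma key_identity_hyperbolic_pair:
  assumes D: "D = UNIV \<or> D = {0}" and p: "p \<notin> I" "p' \<notin> I" "p \<noteq> p'" and fin: "finite I"
    and \<phi>: "\<And>S v a v' a'. S \<in> symm_mats D I \<Longrightarrow> v' \<in> vecs I \<Longrightarrow> a' \<in> D \<Longrightarrow> v \<in> vecs (insert p' I) \<Longrightarrow> a \<in> D \<Longrightarrow>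
      \<phi> (bordered p (bordered p' S v' a') v a) = v p' + \<phi>' S"
    and key: "key_identity D I \<phi>' r"
  shows "key_identity D (insert p (insert p' I)) \<phi> (r + 1)"
proof -
  define M where "M = ambient D (card I)"
  define n where "n = M div 2"
  let ?J = "insert p (insert p' I)"
  have MJ: "ambient D (card ?J) = M + 2"
    using p fin by (simp add: M_def ambient_def)
  have nJ: "(M + 2) div 2 = Suc n" by (simp add: n_def)
  have r: "r \<le> n" and key: "\<And>j. j \<le> n \<Longrightarrow> esum D I \<phi>' (qpoly q n j) = real q ^ (cexp M * j) * qbinom (real q ^ 2) (n - r) j"
    using key by (auto simp: key_identity_def M_def n_def)
  have "esum D ?J \<phi> (qpoly q (Suc n) j) = real q ^ (cexp (M + 2) * j) * qbinom (real q ^ 2) (Suc n - (r + 1)) j"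
    if j: "j \<le> Suc n" for j
  proof -
    have "esum D ?J \<phi> (qpoly q (Suc n) j) =
      esum D I \<phi>' (\<lambda>\<sigma>. q ^ (2 * \<sigma>) * (qpoly q (Suc n) j \<sigma> - qpoly q (Suc n) j (\<sigma> + 1)))"
      by (rule esum_hyperbolic_pair[OF D p fin \<phi>])
    also have "\<dots> = real q ^ (cexp (M + 2) * j) * qbinom (real q ^ 2) (Suc n - (r + 1)) j"
    proof (cases "j = Suc n")
      case True
      then show ?thesis by (simp add: esum_0)
    next
      case False
      then have j': "j \<le> n" using j by simp
      have "esum D I \<phi>' (\<lambda>\<sigma>. q ^ (2 * \<sigma>) * (qpoly q (Suc n) j \<sigma> - qpoly q (Suc n) j (\<sigma> + 1)))
        = esum D I \<phi>' (\<lambda>\<sigma>. q ^ (2 * j) * qpoly q n j \<sigma>)"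
      proof (rule esum_cong[OF D fin])
        fix \<sigma> assume "\<sigma> \<le> ambient D (card I) div 2"
        then show "real (q ^ (2 * \<sigma>)) * (qpoly q (Suc n) j \<sigma> - qpoly q (Suc n) j (\<sigma> + 1)) = real (q ^ (2 * j)) * qpoly q n j \<sigma>"
          using qpoly_diff[of \<sigma> "Suc n" j q] j' by (simp add: n_def M_def)
      qed
      also have "\<dots> = real q ^ (2 * j) * (real q ^ (cexp M * j) * qbinom (real q ^ 2) (n - r) j)"
        by (simp add: esum_scale key j')
      also have "real q ^ (2 * j) * (real q ^ (cexp M * j) * qbinom (real q ^ 2) (n - r) j)
        = real q ^ (2 * j + cexp M * j) * qbinom (real q ^ 2) (n - r) j"
        by (simp add: power_add)
      also have "2 * j + cexp M * j = cexp (M + 2) * j"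
      proof (cases "j = 0")
        case False
        then have "M \<ge> 2" using j' by (auto simp: n_def)
        then have "cexp (M + 2) = cexp M + 2" by (simp add: cexp_def)
        then show ?thesis by (simp add: algebra_simps)
      qed simp
      finally show ?thesis by simp
    qed
    finally show ?thesis .
  qed
  then show ?thesis using r unfolding key_identity_def MJ nJ by simp
qed

text \<open>For even M, n stays the same. By
  \<open>q ^ M = q ^ (2 * j) * (q\<^sup>2) ^ (n - j)\<close> the two terms of the recursion are
  those of the defining Pascal rule, so the weight reproduces itself times
  \<open>q ^ (2 * j)\<close>. For odd M, n grows by one. The shifted weight is then the old weight
  for \<open>j - 1\<close>, and the Pascal rule is applied to the evaluated binomials
  instead.\<close>

lemma key_identity_zero_coordinate:
  assumes D: "D = UNIV \<or> D = {0}" and p: "p \<notin> I" and fin: "finite I"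
    and \<phi>: "\<And>S v a. S \<in> symm_mats D I \<Longrightarrow> v \<in> vecs I \<Longrightarrow> a \<in> D \<Longrightarrow> \<phi> (bordered p S v a) = \<phi>' S"
    and key: "key_identity D I \<phi>' r"
  shows "key_identity D (insert p I) \<phi> r"
proof -
  define M where "M = ambient D (card I)"
  define n where "n = M div 2"
  define n' where "n' = Suc M div 2"
  let ?J = "insert p I"
  have MJ: "ambient D (card ?J) = Suc M"
    using p fin by (simp add: M_def ambient_def)
  have r: "r \<le> n" and key: "\<And>j. j \<le> n \<Longrightarrow> esum D I \<phi>' (qpoly q n j) = real q ^ (cexp M * j) * qbinom (real q ^ 2) (n - r) j"
    using key by (auto simp: key_identity_def M_def n_def)
  have qM: "real (q ^ card I) * real (card D) = real q ^ M"
    using D UNIV_neq_0 by (auto simp: M_def ambient_def card_field)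
  have step: "esum D ?J \<phi> g = esum D I \<phi>' (\<lambda>\<sigma>. q ^ (2 * \<sigma>) * (g \<sigma> - g (\<sigma> + 1)) + real q ^ M * g (\<sigma> + 1))"
    for g :: "nat \<Rightarrow> real"
  proof -
    have "esum D ?J \<phi> g = esum D I \<phi>' (\<lambda>\<sigma>. q ^ (2 * \<sigma>) * (g \<sigma> - g (\<sigma> + 1)) + q ^ card I * card D * g (\<sigma> + 1))"
      by (rule esum_zero_coordinate[OF D p fin]) (rule \<phi>)
    then show ?thesis by (simp only: qM of_nat_mult)
  qed
  have "esum D ?J \<phi> (qpoly q n' j) = real q ^ (cexp (Suc M) * j) * qbinom (real q ^ 2) (n' - r) j"
    if j: "j \<le> n'" for j
  proof (cases "even M")
    case True
    then have M: "M = 2 * n" and n': "n' = n" by (auto simp: n_def n'_def)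
    have "esum D ?J \<phi> (qpoly q n j) = esum D I \<phi>' (\<lambda>\<sigma>. q ^ (2 * j) * qpoly q n j \<sigma>)"
      unfolding step
    proof (rule esum_cong[OF D fin])
      fix \<sigma> assume "\<sigma> \<le> ambient D (card I) div 2"
      then have \<sigma>: "\<sigma> \<le> n" by (simp add: n_def M_def)
      consider "j = n" | "\<sigma> = n" "j < n" | "\<sigma> < n" "j < n" using \<sigma> j n' by linarith
      then show "real (q ^ (2 * \<sigma>)) * (qpoly q n j \<sigma> - qpoly q n j (\<sigma> + 1)) + real q ^ M * qpoly q n j (\<sigma> + 1)
        = real (q ^ (2 * j)) * qpoly q n j \<sigma>"
      proof cases
        case 3
        define N K where "N = n - 1 - \<sigma>" and "K = n - 1 - j"
        have NK: "n - \<sigma> = Suc N" "n - (\<sigma> + 1) = N" "n - j = Suc K" "n - 1 - \<sigma> = N" "n - 1 - j = K"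
          using 3 by (auto simp: N_def K_def)
        have "2 * j + 2 * Suc K = M" using 3 by (simp add: K_def M)
        then have e: "real q ^ M = real q ^ (2 * j) * (real q ^ 2) ^ Suc K"
          by (simp only: power_mult[symmetric] power_add[symmetric])
        have "real (q ^ (2 * \<sigma>)) * (qpoly q n j \<sigma> - qpoly q n j (\<sigma> + 1)) = real q ^ (2 * j) * qbinom (real q ^ 2) N K"
          using qpoly_diff[of \<sigma> n j q] 3 unfolding qpoly_def NK by simp
        then show ?thesis
          unfolding e qpoly_def NK by (simp add: qbinom.simps(3) algebra_simps)
      qed (simp_all add: M qpoly_def)
    qed
    also have "\<dots> = real q ^ (2 * j) * (real q ^ (cexp M * j) * qbinom (real q ^ 2) (n - r) j)"
      using j n' by (simp add: esum_scale key)
    also have "\<dots> = real q ^ (2 * j + cexp M * j) * qbinom (real q ^ 2) (n - r) j"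
      by (simp add: power_add)
    also have "2 * j + cexp M * j = cexp (Suc M) * j"
    proof (cases "j = 0")
      case False
      then have "cexp (Suc M) = cexp M + 2" using j n' M by (simp add: cexp_def)
      then show ?thesis by (simp add: algebra_simps)
    qed simp
    finally show ?thesis by (simp add: n')
  next
    case False
    then have M: "M = 2 * n + 1" and n': "n' = Suc n" by (auto simp: n_def n'_def)
    have c: "cexp M = M" "cexp (Suc M) = M" using False by (auto simp: cexp_def)
    show ?thesis
    proof (cases j)
      case 0
      have "esum D ?J \<phi> (qpoly q n' 0) = esum D I \<phi>' (qpoly q n 0)"
        unfolding step
      proof (rule esum_cong[OF D fin])
        fix \<sigma> assume "\<sigma> \<le> ambient D (card I) div 2"
        then have \<sigma>: "\<sigma> \<le> n" by (simp add: n_def M_def)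
        have "real (q ^ (2 * \<sigma>)) * (qpoly q n' 0 \<sigma> - qpoly q n' 0 (\<sigma> + 1)) = qpoly q n 0 \<sigma>"
          using qpoly_diff[of \<sigma> n' 0 q] \<sigma> n' by simp
        moreover have "qpoly q n' 0 (\<sigma> + 1) = 0" by (simp add: qpoly_def n')
        ultimately show "real (q ^ (2 * \<sigma>)) * (qpoly q n' 0 \<sigma> - qpoly q n' 0 (\<sigma> + 1)) + real q ^ M * qpoly q n' 0 (\<sigma> + 1)
          = qpoly q n 0 \<sigma>" by simp
      qed
      then show ?thesis using key[of 0] 0 by simp
    next
      case (Suc i)
      have i: "i \<le> n" using j Suc n' by simp
      \<comment> \<open>For \<open>j = Suc n\<close> the weight is constant and its difference 0,
        whereas \<open>qpoly q n j\<close> is 1 by truncated subtraction; hence the coefficient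
        0.\<close>
      define B where "B = (if j \<le> n then real q ^ (2 * j) else 0)"
      have "esum D ?J \<phi> (qpoly q n' j) = esum D I \<phi>' (\<lambda>\<sigma>. B * qpoly q n j \<sigma> + real q ^ M * qpoly q n i \<sigma>)"
        unfolding step
      proof (rule esum_cong[OF D fin])
        fix \<sigma> assume "\<sigma> \<le> ambient D (card I) div 2"
        then have \<sigma>: "\<sigma> \<le> n" by (simp add: n_def M_def)
        have 1: "qpoly q n' j (\<sigma> + 1) = qpoly q n i \<sigma>" by (simp add: qpoly_def n' Suc)
        have "real (q ^ (2 * \<sigma>)) * (qpoly q n' j \<sigma> - qpoly q n' j (\<sigma> + 1)) = B * qpoly q n j \<sigma>"
        proof (cases "j \<le> n")
          case True
          then show ?thesis using qpoly_diff[of \<sigma> n' j q] \<sigma> n' by (simp add: B_def)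
        next
          case False
          then have "j = n'" using j n' by simp
          then show ?thesis using False by (simp add: B_def)
        qed
        then show "real (q ^ (2 * \<sigma>)) * (qpoly q n' j \<sigma> - qpoly q n' j (\<sigma> + 1)) + real q ^ M * qpoly q n' j (\<sigma> + 1)
          = B * qpoly q n j \<sigma> + real q ^ M * qpoly q n i \<sigma>" by (simp only: 1)
      qed
      also have "\<dots> = B * esum D I \<phi>' (qpoly q n j) + real q ^ M * esum D I \<phi>' (qpoly q n i)"
        by (rule esum_linear)
      also have "B * esum D I \<phi>' (qpoly q n j) = real q ^ (2 * j) * (real q ^ (M * j) * qbinom (real q ^ 2) (n - r) j)"
        using key[of j] c r by (auto simp: B_def)
      also have "esum D I \<phi>' (qpoly q n i) = real q ^ (M * i) * qbinom (real q ^ 2) (n - r) i"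
        using key[of i] i c by simp
      also have "real q ^ (2 * j) * (real q ^ (M * j) * qbinom (real q ^ 2) (n - r) j) +
          real q ^ M * (real q ^ (M * i) * qbinom (real q ^ 2) (n - r) i)
        = real q ^ (M * j) * (qbinom (real q ^ 2) (n - r) i + (real q ^ 2) ^ j * qbinom (real q ^ 2) (n - r) j)"
      proof -
        have "(real q ^ 2) ^ j = real q ^ (2 * j)" "M * j = M + M * i"
          by (simp only: power_mult) (simp add: Suc)
        then show ?thesis by (simp add: power_add algebra_simps)
      qed
      also have "\<dots> = real q ^ (M * j) * qbinom (real q ^ 2) (Suc (n - r)) j"
        by (simp add: Suc qbinom.simps(3))
      finally show ?thesis using r by (simp add: c n' Suc_diff_le)
    qed
  qed
  moreover have "r \<le> n'" using r by (simp add: n_def n'_def)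
  ultimately show ?thesis unfolding key_identity_def MJ n'_def by simp
qed

lemma key_identity_empty:
  assumes D: "D = UNIV \<or> D = {0}"
  shows "key_identity D {} (\<lambda>_. 0) 0"
  using D by (auto simp: key_identity_def ambient_def esum_def symm_mats_empty chi_0)

lemma hrk_eq_0_iff:
  assumes fin: "finite I" and S: "S \<in> symm_mats D I"
  shows "hrk I S = 0 \<longleftrightarrow> S = (\<lambda>_ _. 0)"
proof
  assume "hrk I S = 0"
  then have "rk I S = 0" by (simp add: hrk_def)
  then have "card (null I S) = card (vecs I)"
    using nullity_le[OF fin S] by (simp add: rk_def card_null[OF fin S] card_vecs[OF fin])
  then have N: "null I S = vecs I"
    by (intro card_subset_eq) (auto simp: fin null_def)
  have "S i j = 0" for i j
  proof (cases "j \<in> I")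
    case True
    have "(\<lambda>k. if k = j then 1 else 0) \<in> null I S"
      using True by (simp add: N) (simp add: vecs_def)
    then have "app I S (\<lambda>k. if k = j then 1 else 0) i = 0" by (simp add: null_def)
    then show ?thesis using True fin by (simp add: app_def if_distrib cong: if_cong)
  next
    case False
    then show ?thesis using S by (auto simp: symm_mats_def) 
  qed
  then show "S = (\<lambda>_ _. 0)" by blast
next
  assume "S = (\<lambda>_ _. 0)"
  then have "null I S = vecs I" by (auto simp: null_def app_def)
  then have "nullity I S = card I" by (intro nullityI) (simp add: card_vecs fin)
  then show "hrk I S = 0" by (simp add: hrk_def rk_def)
qed

lemma zero_in_symm_mats: "0 \<in> D \<Longrightarrow> (\<lambda>_ _. 0) \<in> symm_mats D I"
  by (simp add: symm_mats_def)

text \<open>For n = 1 two weights occur. The one for j = 0 is the indicator of the zero matrix and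
  sums to 1; the one for j = 1 is constant, and the sum of the nontrivial character is 0 by
  translation with T.\<close>

lemma key_identity_small:
  assumes D: "D = UNIV \<or> D = {0}" and fin: "finite I" and n: "ambient D (card I) div 2 = 1"
    and \<phi>: "\<And>S T. \<phi> (\<lambda>i j. S i j + T i j) = \<phi> S + \<phi> T" "\<phi> (\<lambda>_ _. 0) = 0"
    and T: "T \<in> symm_mats D I" "\<chi> (\<phi> T) \<noteq> 1"
  shows "key_identity D I \<phi> 1"
proof -
  have 0: "(\<lambda>_ _. 0) \<in> symm_mats D I" using D by (intro zero_in_symm_mats) auto
  have "esum D I \<phi> (qpoly q 1 0) = (\<Sum>S\<in>symm_mats D I. if S = (\<lambda>_ _. 0) then 1 else 0)"
    unfolding esum_def
  proof (rule sum.cong[OF refl])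
    fix S assume "S \<in> symm_mats D I"
    then show "qpoly q 1 0 (hrk I S) * \<chi> (\<phi> S) = (if S = (\<lambda>_ _. 0) then 1 else 0)"
      using hrk_eq_0_iff[OF fin, of S D] by (auto simp: qpoly_def \<phi> chi_0)
  qed
  also have "\<dots> = 1" using 0 fin by simp
  finally have 1: "esum D I \<phi> (qpoly q 1 0) = 1" .
  have tr: "(\<lambda>i j. S i j + T i j) \<in> symm_mats D I" if "S \<in> symm_mats D I" for S
    using that T(1) D by (auto simp: symm_mats_def)
  have "(\<Sum>S\<in>symm_mats D I. \<chi> (\<phi> S)) = 0"
  proof (rule sum_char_zero[where h = "\<lambda>S i j. S i j + T i j" and c = "\<chi> (\<phi> T)"])
    show "bij_betw (\<lambda>S i j. S i j + T i j) (symm_mats D I) (symm_mats D I)"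
      by (rule bij_betwI[where g = "\<lambda>S i j. S i j + T i j"]) (use tr in \<open>auto simp: add.assoc add_self\<close>)
  qed (use T in \<open>auto simp: \<phi> chi_add\<close>)
  then have 2: "esum D I \<phi> (qpoly q 1 1) = 0" by (simp add: esum_def)
  have "esum D I \<phi> (qpoly q 1 j) = real q ^ (cexp (ambient D (card I)) * j) * qbinom (real q ^ 2) (1 - 1) j"
    if "j \<le> 1" for j
  proof (cases "j = 0")
    case False
    then have "j = 1" using \<open>j \<le> 1\<close> by simp
    then show ?thesis using 2 by simp
  qed (use 1 in simp)
  then show ?thesis unfolding key_identity_def n by simp
qed

section \<open>The key identity for normal forms\<close>

definition normal_support :: "nat \<Rightarrow> nat \<Rightarrow> kernel_kind \<Rightarrow> nat set" where
  "normal_support i s K = {1..2 * i} \<union> {2 * s + 1..2 * s + kernel_dim K}"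

text \<open>Half the rank of the normal form, rounded down for \<open>D = {0}\<close> and up otherwise.\<close>

definition pair_count :: "'a set \<Rightarrow> nat \<Rightarrow> kernel_kind \<Rightarrow> nat" where
  "pair_count D s K = s + (if K = Elliptic \<or> K = Square \<and> D \<noteq> {0} then 1 else 0)"

text \<open>A zero diagonal turns a square into an ignored coordinate and the anisotropic plane into
  a hyperbolic pair, so the recursion steps apply when \<open>D = {0}\<close>. For
  \<open>D = UNIV\<close> one or two coordinates give n = 1, and the matrix with single diagonal
  entry z witnesses that the character is nontrivial.\<close>

lemma key_identity_kernel_part:
  assumes D: "D = UNIV \<or> D = {0}"
  shows "key_identity D (normal_support 0 s K) (kernel_part lam s K) (pair_count D 0 K)"
proof -
  let ?p = "2 * s + 1" and ?p' = "2 * s + 2"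
  obtain z where z: "\<chi> z \<noteq> 1" using chi_nontrivial by blast
  show ?thesis
  proof (cases K)
    case Trivial
    then have "kernel_part lam s K = (\<lambda>_. 0)" by (auto simp: kernel_part_def)
    then show ?thesis using key_identity_empty[OF D] Trivial by (simp add: normal_support_def pair_count_def)
  next
    case Square
    have supp: "normal_support 0 s K = {?p}" by (auto simp: normal_support_def Square)
    show ?thesis
    proof (cases "D = {0}")
      case True
      have "key_identity D (insert ?p {}) (kernel_part lam s K) 0"
        by (rule key_identity_zero_coordinate[OF D _ _ _ key_identity_empty[OF D]])
          (auto simp: True kernel_part_def Square bordered_def)
      then show ?thesis using True by (simp only: supp) (simp add: Square pair_count_def)
    next
      case False
      then have D': "D = UNIV" using D by simp
      have "key_identity D {?p} (kernel_part lam s K) 1"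
      proof (rule key_identity_small[OF D])
        show "(\<lambda>i j. if i = ?p \<and> j = ?p then z else 0) \<in> symm_mats D {?p}"
          by (auto simp: symm_mats_def D')
      qed (use z UNIV_neq_0 in \<open>auto simp: kernel_part_def Square ambient_def D'\<close>)
      then show ?thesis using False by (simp only: supp) (simp add: Square pair_count_def)
    qed
  next
    case Elliptic
    have supp: "normal_support 0 s K = {?p, ?p'}" by (auto simp: normal_support_def Elliptic)
    show ?thesis
    proof (cases "D = {0}")
      case True
      have "key_identity D (insert ?p (insert ?p' {})) (kernel_part lam s K) (0 + 1)"
        by (rule key_identity_hyperbolic_pair[OF D _ _ _ _ _ key_identity_empty[OF D]])
          (auto simp: True kernel_part_def Elliptic bordered_def)
      then show ?thesis using True by (simp only: supp) (simp add: Elliptic pair_count_def)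
    next
      case False
      then have D': "D = UNIV" using D by simp
      have "key_identity D {?p, ?p'} (kernel_part lam s K) 1"
      proof (rule key_identity_small[OF D])
        show "(\<lambda>i j. if i = ?p \<and> j = ?p then z else 0) \<in> symm_mats D {?p, ?p'}"
          by (auto simp: symm_mats_def D')
      qed (use z UNIV_neq_0 in \<open>auto simp: kernel_part_def Elliptic ambient_def D' algebra_simps\<close>)
      then show ?thesis using False by (simp only: supp) (simp add: Elliptic pair_count_def)
    qed
  qed
qed

lemma kernel_part_bordered:
  "p \<le> 2 * s \<or> p > 2 * s + kernel_dim K \<Longrightarrow> kernel_part lam s K (bordered p S v a) = kernel_part lam s K S"
  by (cases K) (auto simp: kernel_part_def bordered_def)

text \<open>The kernel part keeps its final positions beyond \<open>2 * s\<close> while the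
  hyperbolic pairs are added one by one below it. No renumbering occurs; the support just has a gap
  until \<open>i = s\<close>.\<close>

lemma key_identity_pairs:
  assumes D: "D = UNIV \<or> D = {0}" and "i \<le> s"
  shows "key_identity D (normal_support i s K) (\<lambda>S. (\<Sum>t=1..i. S (2*t-1) (2*t)) + kernel_part lam s K S) (pair_count D i K)"
  using assms(2)
proof (induction i)
  case 0
  then show ?case using key_identity_kernel_part[OF D] by simp
next
  case (Suc i)
  have IH: "key_identity D (normal_support i s K) (\<lambda>S. (\<Sum>t=1..i. S (2*t-1) (2*t)) + kernel_part lam s K S) (pair_count D i K)"
    using Suc by simp
  have supp: "normal_support (Suc i) s K = insert (2*i+1) (insert (2*i+2) (normal_support i s K))"
    by (auto simp: normal_support_def)
  have pc: "pair_count D (Suc i) K = pair_count D i K + 1" by (simp add: pair_count_def)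
  show ?case
    unfolding supp pc
  proof (rule key_identity_hyperbolic_pair[OF D _ _ _ _ _ IH])
    fix S v v' :: "nat \<Rightarrow> _" and a a'
    let ?S = "bordered (2*i+1) (bordered (2*i+2) S v' a') v a"
    have "(\<Sum>t=1..i. ?S (2*t-1) (2*t)) = (\<Sum>t=1..i. S (2*t-1) (2*t))"
      by (rule sum.cong[OF refl]) (auto simp: bordered_def)
    moreover have "?S (2 * Suc i - 1) (2 * Suc i) = v (2*i+2)" by (simp add: bordered_def)
    moreover have "kernel_part lam s K ?S = kernel_part lam s K S"
      using Suc.prems by (simp add: kernel_part_bordered)
    ultimately show "(\<Sum>t=1..Suc i. ?S (2*t-1) (2*t)) + kernel_part lam s K ?S
      = v (2*i+2) + ((\<Sum>t=1..i. S (2*t-1) (2*t)) + kernel_part lam s K S)"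
      by (simp add: algebra_simps)
  qed (use Suc.prems in \<open>auto simp: normal_support_def\<close>)
qed

theorem key_identity_normal_sum:
  assumes D: "D = UNIV \<or> D = {0}" and "2 * s + kernel_dim K \<le> m"
  shows "key_identity D {1..m} (normal_sum lam s K) (pair_count D s K)"
  using assms(2)
proof (induction m rule: dec_induct)
  case base
  have "normal_support s s K = {1..2 * s + kernel_dim K}" by (auto simp: normal_support_def)
  then show ?case using key_identity_pairs[OF D order_refl, of s K lam] by (simp add: normal_sum_def[abs_def])
next
  case (step m)
  have "{1..Suc m} = insert (Suc m) {1..m}" by auto
  moreover have "key_identity D (insert (Suc m) {1..m}) (normal_sum lam s K) (pair_count D s K)"
  proof (rule key_identity_zero_coordinate[OF D _ _ _ step.IH])
    fix S v :: "nat \<Rightarrow> _" and a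
    have "(\<Sum>t=1..s. bordered (Suc m) S v a (2*t-1) (2*t)) = (\<Sum>t=1..s. S (2*t-1) (2*t))"
      by (rule sum.cong[OF refl]) (use step(1) in \<open>auto simp: bordered_def\<close>)
    then show "normal_sum lam s K (bordered (Suc m) S v a) = normal_sum lam s K S"
      using step(1) by (simp add: normal_sum_def kernel_part_bordered)
  qed auto
  ultimately show ?case by simp
qed

end

section \<open>Zeros of normal forms\<close>

text \<open>Prepends an entry to a sequence indexed from 1. Slot 0 is set to 0 so that vectors
  supported on \<open>{1..k}\<close> become vectors supported on \<open>{1..Suc k}\<close>; bases
  are extended by the same function.\<close>

definition vcons :: "'c::zero \<Rightarrow> (nat \<Rightarrow> 'c) \<Rightarrow> nat \<Rightarrow> 'c" where
  "vcons c x = (\<lambda>i. if i = 1 then c else if i = 0 then 0 else x (i - 1))"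

definition vtl :: "(nat \<Rightarrow> 'c::zero) \<Rightarrow> nat \<Rightarrow> 'c" where
  "vtl x = (\<lambda>i. if i = 0 then 0 else x (Suc i))"

lemma vcons_1 [simp]: "vcons c x 1 = c" "vcons c x (Suc 0) = c"
  and vcons_Suc: "0 < i \<Longrightarrow> vcons c x (Suc i) = x i"
  by (auto simp: vcons_def)

lemma normal_sum_Suc:
  "normal_sum lam (Suc s) K M = M 1 2 + normal_sum lam s K (\<lambda>i j. M (i + 2) (j + 2))"
proof -
  have "(\<Sum>i=1..Suc s. M (2*i-1) (2*i)) = M 1 2 + (\<Sum>i=1..s. M (2 * Suc i - 1) (2 * Suc i))"
    by (subst sum.atLeast_Suc_atMost) (simp_all add: numeral_2_eq_2 sum.shift_bounds_cl_Suc_ivl del: sum.cl_ivl_Suc)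
  also have "(\<Sum>i=1..s. M (2 * Suc i - 1) (2 * Suc i)) = (\<Sum>i=1..s. M ((2*i-1) + 2) (2*i + 2))"
    by (rule sum.cong[OF refl]) (auto simp: numeral_2_eq_2 Suc_diff_le intro!: arg_cong2[where f = M])
  finally show ?thesis
    by (cases K) (simp_all add: normal_sum_def kernel_part_def)
qed

lemma kernel_part_cong:
  assumes "\<And>i j. 2 * s < i \<Longrightarrow> i \<le> 2 * s + kernel_dim K \<Longrightarrow> 2 * s < j \<Longrightarrow> j \<le> 2 * s + kernel_dim K \<Longrightarrow> M i j = M' i j"
  shows "kernel_part lam s K M = kernel_part lam s K M'"
  using assms by (cases K) (auto simp: kernel_part_def)

lemma normal_sum_cong:
  assumes "\<And>i j. 0 < i \<Longrightarrow> i \<le> 2 * s + kernel_dim K \<Longrightarrow> 0 < j \<Longrightarrow> j \<le> 2 * s + kernel_dim K \<Longrightarrow> M i j = M' i j"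
  shows "normal_sum lam s K M = normal_sum lam s K M'"
  unfolding normal_sum_def
  by (intro arg_cong2[where f = "(+)"] sum.cong refl kernel_part_cong assms) auto

lemma bij_betw_Collect_image:
  "bij_betw f A B \<Longrightarrow> bij_betw f {x \<in> A. P (f x)} {y \<in> B. P y}"
  unfolding bij_betw_def by (auto intro: inj_on_subset)

context char2_character
begin

section \<open>Squares and the Artin-Schreier map\<close>

lemma two_eq_0: "(2::'a) = 0"
  using add_self[of 1] by simp

lemma square_surj: "\<exists>t. t\<^sup>2 = (x::'a)"
proof -
  have "inj (\<lambda>t::'a. t\<^sup>2)"
  proof (rule injI)
    fix s t :: 'a assume "s\<^sup>2 = t\<^sup>2"
    have "(s + t)\<^sup>2 = s\<^sup>2 + t\<^sup>2 + (s * t + s * t)" by (simp add: power2_eq_square algebra_simps)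
    also have "\<dots> = 0" using \<open>s\<^sup>2 = t\<^sup>2\<close> by (simp add: add_self)
    finally show "s = t" by (simp add: add_eq_0_iff_eq)
  qed
  then have "surj (\<lambda>t::'a. t\<^sup>2)" by (simp add: finite_UNIV_inj_surj)
  then show ?thesis by (metis surjD)
qed

lemma square_add: "(x + y)\<^sup>2 = x\<^sup>2 + (y::'a)\<^sup>2"
proof -
  have "(x + y)\<^sup>2 = x\<^sup>2 + y\<^sup>2 + (x * y + x * y)" by (simp add: power2_eq_square algebra_simps)
  then show ?thesis by (simp add: add_self)
qed

text \<open>The Artin-Schreier map has kernel \<open>{0, 1}\<close>, so its image has index two.\<close>

lemma artin_schreier_coset:
  assumes l: "\<And>z::'a. z\<^sup>2 + z \<noteq> l" and r: "\<And>z::'a. z\<^sup>2 + z \<noteq> r"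
  obtains z where "z\<^sup>2 + z = l + r"
proof -
  let ?f = "\<lambda>z::'a. z\<^sup>2 + z"
  have f_add: "?f (x + y) = ?f x + ?f y" for x y by (simp add: square_add algebra_simps)
  have ker: "?f z = ?f y \<longleftrightarrow> z = y \<or> z = y + 1" for y z
  proof -
    have "?f z = ?f y \<longleftrightarrow> ?f (z + y) = 0" by (simp only: f_add add_eq_0_iff_eq)
    also have "?f (z + y) = (z + y) * (z + y + 1)" by (simp add: power2_eq_square algebra_simps)
    also have "\<dots> = 0 \<longleftrightarrow> z + y = 0 \<or> (z + y) + 1 = 0" by simp
    also have "\<dots> \<longleftrightarrow> z = y \<or> z = y + 1" by (simp only: add.assoc add_eq_0_iff_eq)
    finally show ?thesis .
  qed
  have "card (UNIV :: 'a set) = (\<Sum>w\<in>range ?f. card {x. ?f x = w})"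
    using sum.image_gen[of "UNIV :: 'a set" "\<lambda>_. 1::nat" ?f] by simp
  also have "\<dots> = (\<Sum>w\<in>range ?f. 2)"
  proof (rule sum.cong[OF refl])
    fix w assume "w \<in> range ?f"
    then obtain y where "w = ?f y" by blast
    then have "{x. ?f x = w} = {y, y + 1}" using ker by auto
    then show "card {x. ?f x = w} = 2" by simp
  qed
  finally have card: "CARD('a) = 2 * card (range ?f)" by simp
  let ?C = "(\<lambda>w. l + w) ` range ?f"
  have disj: "range ?f \<inter> ?C = {}"
  proof safe
    fix x y assume "x\<^sup>2 + x = l + (y\<^sup>2 + y)"
    then have "?f x + ?f y = l" by (simp add: add.assoc add_self)
    then have "?f (x + y) = l" by (simp only: f_add)
    then show "x\<^sup>2 + x \<in> {}" using l by blast
  qed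
  have "card ?C = card (range ?f)" by (rule card_image) (simp add: inj_on_def)
  then have "card (range ?f \<union> ?C) = CARD('a)"
    using disj card by (simp add: card_Un_disjoint)
  then have "range ?f \<union> ?C = UNIV" by (intro card_subset_eq) auto
  then have "r \<in> range ?f \<union> ?C" by simp
  moreover have "r \<notin> range ?f"
  proof
    assume "r \<in> range ?f"
    then obtain z where "r = ?f z" by (elim imageE)
    then show False using r[of z] by simp
  qed
  ultimately have "r \<in> ?C" by simp
  then obtain z where "r = l + ?f z" by blast
  then have "l + r = (l + l) + ?f z" by (simp only: add.assoc)
  then have "?f z = l + r" by (simp add: add_self)
  then show thesis by (rule that)
qed

section \<open>Numbers of zeros\<close>

lemma bij_vcons:
  "bij_betw (\<lambda>(c, x). vcons c x) (UNIV \<times> vecs {1..k}) (vecs {1..Suc k} :: (nat \<Rightarrow> 'a) set)"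
proof (rule bij_betwI[where g = "\<lambda>y. (y 1, vtl y)"])
  show "(\<lambda>(c, x). vcons c x) \<in> UNIV \<times> vecs {1..k} \<rightarrow> (vecs {1..Suc k} :: (nat \<Rightarrow> 'a) set)"
  proof safe
    fix c :: 'a and x :: "nat \<Rightarrow> 'a" assume x: "x \<in> vecs {1..k}"
    show "vcons c x \<in> vecs {1..Suc k}"
      unfolding vecs_def
    proof safe
      fix i assume "i \<notin> {1..Suc k}"
      then have "i \<noteq> 1" "i - 1 \<notin> {1..k}" by auto
      then show "vcons c x i = 0" using x by (simp add: vcons_def vecs_def)
    qed
  qed
  show "(\<lambda>y. (y 1, vtl y)) \<in> (vecs {1..Suc k} :: (nat \<Rightarrow> 'a) set) \<rightarrow> UNIV \<times> vecs {1..k}"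
    by (auto simp: vecs_def vtl_def)
next
  fix p :: "'a \<times> (nat \<Rightarrow> 'a)" assume p: "p \<in> UNIV \<times> vecs {1..k}"
  obtain c x where cx: "p = (c, x)" by (cases p)
  have "x 0 = 0" using p cx by (simp add: vecs_def)
  then show "(\<lambda>y. (y 1, vtl y)) (case p of (c, x) \<Rightarrow> vcons c x) = p"
    by (auto simp: cx vtl_def vcons_def fun_eq_iff)
next
  fix y :: "nat \<Rightarrow> 'a" assume "y \<in> vecs {1..Suc k}"
  then have "y 0 = 0" by (simp add: vecs_def)
  then show "(case (y 1, vtl y) of (c, x) \<Rightarrow> vcons c x) = y"
    by (auto simp: vtl_def vcons_def fun_eq_iff)
qed

text \<open>The invariant that separates the two types of even rank: equivalence preserves the
  number of zeros, which exceeds \<open>q ^ (k - 1)\<close> for type 1 and falls below it for type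
  -1.\<close>

definition zero_count :: "'a \<Rightarrow> nat \<Rightarrow> kernel_kind \<Rightarrow> nat \<Rightarrow> nat" where
  "zero_count lam s K k = card {x \<in> vecs {1..k}. normal_sum lam s K (\<lambda>i j. x i * x j) = 0}"

lemma card_product_fibre:
  "card {(c, d). c * d = (y::'a)} = (if y = 0 then 2 * q - 1 else q - 1)"
proof (cases "y = 0")
  case True
  have "{(c, d). c * d = y} = (\<lambda>d. (0, d)) ` UNIV \<union> (\<lambda>c. (c, 0)) ` (UNIV - {0})"
    using True by auto
  moreover have "card ((\<lambda>d. (0::'a, d)) ` (UNIV :: 'a set) \<union> (\<lambda>c. (c, 0)) ` (UNIV - {0})) = q + (q - 1)"
    by (subst card_Un_disjoint) (auto simp: card_image inj_on_def card_field)
  ultimately show ?thesis using True by simp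
next
  case False
  have "{(c, d). c * d = y} = (\<lambda>c. (c, y / c)) ` (UNIV - {0})"
    using False by (auto simp: image_iff field_simps)
  moreover have "card ((\<lambda>c. (c, y / c)) ` (UNIV - {0})) = q - 1"
    by (subst card_image) (auto simp: inj_on_def card_field)
  ultimately show ?thesis using False by simp
qed

text \<open>For each x the product \<open>c * d\<close> has to equal the value of the smaller form
  at x. There are \<open>q - 1\<close> such pairs (c, d), and q more when that value is 0.\<close>

lemma zero_count_Suc:
  "zero_count lam (Suc s) K (Suc (Suc k)) = q * zero_count lam s K k + (q - 1) * q ^ k"
proof -
  let ?V = "vecs {1..k} :: (nat \<Rightarrow> 'a) set"
  let ?f = "\<lambda>x. normal_sum lam s K (\<lambda>i j. x i * x j)"
  let ?h = "\<lambda>(c, d, x). vcons c (vcons d x)"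
  have bij: "bij_betw ?h (UNIV \<times> UNIV \<times> ?V) (vecs {1..Suc (Suc k)})"
  proof -
    have "bij_betw (map_prod id (\<lambda>(c, x). vcons c x)) (UNIV \<times> (UNIV \<times> ?V)) (UNIV \<times> (vecs {1..Suc k} :: (nat \<Rightarrow> 'a) set))"
      using bij_vcons by (intro bij_betw_map_prod) auto
    from bij_betw_trans[OF this bij_vcons] show ?thesis
      by (rule bij_betw_cong[THEN iffD1, rotated]) auto
  qed
  have val: "normal_sum lam (Suc s) K (\<lambda>i j. ?h (c, d, x) i * ?h (c, d, x) j) = c * d + ?f x" for c d x
  proof -
    have "normal_sum lam s K (\<lambda>i j. ?h (c, d, x) (i + 2) * ?h (c, d, x) (j + 2)) = ?f x"
      by (rule normal_sum_cong) (auto simp: vcons_def)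
    moreover have "?h (c, d, x) 2 = d" by (simp add: vcons_def)
    ultimately show ?thesis unfolding normal_sum_Suc by simp
  qed
  have "bij_betw ?h {p \<in> UNIV \<times> UNIV \<times> ?V. normal_sum lam (Suc s) K (\<lambda>i j. ?h p i * ?h p j) = 0}
      {x \<in> vecs {1..Suc (Suc k)}. normal_sum lam (Suc s) K (\<lambda>i j. x i * x j) = 0}"
    by (rule bij_betw_Collect_image[OF bij])
  then have "zero_count lam (Suc s) K (Suc (Suc k)) =
      card {p \<in> UNIV \<times> UNIV \<times> ?V. normal_sum lam (Suc s) K (\<lambda>i j. ?h p i * ?h p j) = 0}"
    unfolding zero_count_def by (rule bij_betw_same_card[symmetric])
  also have "{p \<in> UNIV \<times> UNIV \<times> ?V. normal_sum lam (Suc s) K (\<lambda>i j. ?h p i * ?h p j) = 0}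
    = {(c, d, x). x \<in> ?V \<and> c * d = ?f x}"
    by (auto simp: val[simplified] add_eq_0_iff_eq two_eq_0)
  also have "card \<dots> = card (\<Union>x\<in>?V. (\<lambda>(c, d). (c, d, x)) ` {(c, d). c * d = ?f x})"
    by (rule arg_cong[where f = card]) auto
  also have "\<dots> = (\<Sum>x\<in>?V. card ((\<lambda>(c, d). (c, d, x)) ` {(c, d). c * d = ?f x}))"
    by (rule card_UN_disjoint) auto
  also have "\<dots> = (\<Sum>x\<in>?V. (if ?f x = 0 then q else 0) + (q - 1))"
  proof (rule sum.cong[OF refl])
    fix x
    have "card ((\<lambda>(c, d). (c, d, x)) ` {(c, d). c * d = ?f x}) = card {(c, d). c * d = ?f x}"
      by (rule card_image) (auto simp: inj_on_def)
    then show "card ((\<lambda>(c, d). (c, d, x)) ` {(c, d). c * d = ?f x}) = (if ?f x = 0 then q else 0) + (q - 1)"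
      using q_ge_2 by (simp add: card_product_fibre mult_2)
  qed
  also have "\<dots> = q * zero_count lam s K k + (q - 1) * q ^ k"
    by (simp add: sum.distrib zero_count_def card_vecs sum.If_cases Int_def mult.commute)
  finally show ?thesis .
qed

text \<open>By \<open>zero_count_Suc\<close> the excess \<open>q * zero_count - q ^ k\<close> is
  multiplied by q with every hyperbolic pair, so its sign is decided by the form without pairs, here
  the zero form.\<close>

lemma zero_count_Trivial:
  "2 * s \<le> k \<Longrightarrow> q ^ k < q * zero_count lam s Trivial k"
proof (induction s arbitrary: k)
  case 0
  then show ?case using q_ge_2 by (simp add: zero_count_def normal_sum_def kernel_part_def card_vecs)
next
  case (Suc s)
  define k' where "k' = k - 2"
  have k: "k = Suc (Suc k')" "2 * s \<le> k'" using Suc.prems by (simp_all add: k'_def)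
  have "q * (q ^ k') < q * (q * zero_count lam s Trivial k')"
    using Suc.IH[OF k(2)] q_ge_2 by simp
  then have "real q * (real q ^ k') < real q * (real q * real (zero_count lam s Trivial k'))"
    by (simp only: of_nat_less_iff flip: of_nat_mult of_nat_power)
  moreover have "real (q * zero_count lam (Suc s) Trivial k) =
      real q * (real q * real (zero_count lam s Trivial k') + (real q - 1) * real q ^ k')"
    unfolding k(1) zero_count_Suc using q_ge_2 by (simp add: of_nat_diff)
  moreover have "real (q ^ k) = real q * (real q * real q ^ k')" by (simp add: k(1))
  ultimately have "real (q ^ k) < real (q * zero_count lam (Suc s) Trivial k)"
    by (simp only:) (simp add: algebra_simps)
  then show ?case by (simp only: of_nat_less_iff)
qed

lemma elliptic_anisotropic:
  assumes lam: "\<And>z::'a. z\<^sup>2 + z \<noteq> lam"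
  shows "x * x + x * y + lam * (y * y) = 0 \<longleftrightarrow> x = 0 \<and> y = 0"
proof
  assume *: "x * x + x * y + lam * (y * y) = 0"
  have "y = 0"
  proof (rule ccontr)
    assume "y \<noteq> 0"
    have "x * x + x * y = lam * (y * y)" using * by (simp only: add_eq_0_iff_eq)
    then have "(x / y)\<^sup>2 + x / y = lam"
      using \<open>y \<noteq> 0\<close> by (simp add: field_simps power2_eq_square)
    then show False using lam by blast
  qed
  then show "x = 0 \<and> y = 0" using * by simp
qed simp

text \<open>The same recursion, started from an anisotropic plane: its zeros are the vectors with
  the first two coordinates 0, and these are too few.\<close>

lemma zero_count_Elliptic:
  assumes lam: "\<And>z::'a. z\<^sup>2 + z \<noteq> lam"
  shows "2 * s + 2 \<le> k \<Longrightarrow> q * zero_count lam s Elliptic k < q ^ k"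
proof (induction s arbitrary: k)
  case 0
  have "{x \<in> vecs {1..k}. normal_sum lam 0 Elliptic (\<lambda>i j. x i * x j) = 0} = vecs {3..k}"
  proof -
    have "x \<in> vecs {1..k} \<and> x (Suc 0) = 0 \<and> x 2 = 0 \<longleftrightarrow> x \<in> vecs {3..k}" for x
    proof -
      have "{1..k} - {Suc 0, 2} = {3..k}" by auto
      moreover have "x \<in> vecs {1..k} \<and> x (Suc 0) = 0 \<and> x 2 = 0 \<longleftrightarrow> x \<in> vecs ({1..k} - {Suc 0, 2})"
        by (auto simp: vecs_def)
      ultimately show ?thesis by simp
    qed
    moreover have "normal_sum lam 0 Elliptic (\<lambda>i j. x i * x j) = 0 \<longleftrightarrow> x (Suc 0) = 0 \<and> x 2 = 0" for x
      using elliptic_anisotropic[OF lam, of "x (Suc 0)" "x 2"]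
      by (simp add: normal_sum_def kernel_part_def numeral_2_eq_2)
    ultimately show ?thesis by auto
  qed
  then have "zero_count lam 0 Elliptic k = q ^ (k - 2)" by (simp add: zero_count_def card_vecs)
  moreover have "q * q ^ (k - 2) = q ^ (k - 1)" using 0
    by (simp flip: power_Suc add: Suc_diff_Suc numeral_2_eq_2)
  ultimately show ?case using 0 q_ge_2 by simp
next
  case (Suc s)
  define k' where "k' = k - 2"
  have k: "k = Suc (Suc k')" "2 * s + 2 \<le> k'" using Suc.prems by (simp_all add: k'_def)
  have "q * (q ^ k') > q * (q * zero_count lam s Elliptic k')"
    using Suc.IH[OF k(2)] q_ge_2 by simp
  then have "real q * (real q ^ k') > real q * (real q * real (zero_count lam s Elliptic k'))"
    by (simp only: of_nat_less_iff flip: of_nat_mult of_nat_power)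
  moreover have "real (q * zero_count lam (Suc s) Elliptic k) =
      real q * (real q * real (zero_count lam s Elliptic k') + (real q - 1) * real q ^ k')"
    unfolding k(1) zero_count_Suc using q_ge_2 by (simp add: of_nat_diff)
  moreover have "real (q ^ k) = real q * (real q * real q ^ k')" by (simp add: k(1))
  ultimately have "real (q ^ k) > real (q * zero_count lam (Suc s) Elliptic k)"
    by (simp only:) (simp add: algebra_simps)
  then show ?case by (simp only: of_nat_less_iff)
qed

end

section \<open>Classification of forms\<close>

text \<open>The trace condition on \<open>lam\<close> enters as the absence of solutions of
  \<open>z\<^sup>2 + z = lam\<close>, which says that
  \<open>x\<^sup>2 + x * y + lam * y\<^sup>2\<close> is anisotropic.\<close>

locale even_form_space = form_space scale + char2_character \<chi> q
  for scale :: "'a::{field,finite} \<Rightarrow> 'v::ab_group_add \<Rightarrow> 'v" and \<chi> :: "'a \<Rightarrow> real" and q :: nat +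
  fixes lam :: 'a and m :: nat and u :: "nat \<Rightarrow> 'v"
  assumes lam: "z\<^sup>2 + z \<noteq> lam"
    and dim_m: "dim UNIV = m"
    and basis_u: "indexed_basis u"
begin

section \<open>Coordinate systems of subspaces\<close>

definition lc :: "nat \<Rightarrow> (nat \<Rightarrow> 'v) \<Rightarrow> (nat \<Rightarrow> 'a) \<Rightarrow> 'v" where
  "lc k b x = (\<Sum>i=1..k. scale (x i) (b i))"

lemma lincomb_eq: "lincomb b x = lc m b x"
  by (simp add: lincomb_def lc_def dim_m)

text \<open>A basis of W, encoded as bijectivity of the coordinate map. Cardinalities follow at
  once, and dimensions are then compared through powers of q.\<close>

definition coords :: "'v set \<Rightarrow> nat \<Rightarrow> (nat \<Rightarrow> 'v) \<Rightarrow> bool" where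
  "coords W k b \<longleftrightarrow> bij_betw (lc k b) (vecs {1..k}) W"

definition clip :: "nat \<Rightarrow> (nat \<Rightarrow> 'a) \<Rightarrow> nat \<Rightarrow> 'a" where
  "clip k x = (\<lambda>i. if i \<in> {1..k} then x i else 0)"

lemma clip_in [simp]: "clip k x \<in> vecs {1..k}" "clip k x \<in> vecs {Suc 0..k}"
  by (simp_all add: clip_def vecs_def)

lemma lc_cong: "(\<And>i. i \<in> {1..k} \<Longrightarrow> x i = y i) \<Longrightarrow> (\<And>i. i \<in> {1..k} \<Longrightarrow> b i = c i) \<Longrightarrow> lc k b x = lc k c y"
  by (simp add: lc_def)

lemma lc_clip [simp]: "lc k b (clip k x) = lc k b x"
  by (rule lc_cong) (auto simp: clip_def)

lemma lc_add: "lc k b (\<lambda>i. x i + y i) = lc k b x + lc k b y"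
  by (simp add: lc_def scale_left_distrib sum.distrib)

lemma lc_scale: "lc k b (\<lambda>i. c * x i) = scale c (lc k b x)"
  by (simp add: lc_def scale_sum_right)

lemma coords_surj: "coords W k b \<Longrightarrow> w \<in> W \<Longrightarrow> \<exists>x\<in>vecs {1..k}. w = lc k b x"
  by (auto simp: coords_def bij_betw_def)

lemma coords_inj: "coords W k b \<Longrightarrow> lc k b x = lc k b y \<Longrightarrow> i \<in> {1..k} \<Longrightarrow> x i = y i"
proof -
  assume c: "coords W k b" and eq: "lc k b x = lc k b y" and i: "i \<in> {1..k}"
  have "clip k x = clip k y"
    by (rule inj_onD[of "lc k b" "vecs {1..k}"]) (use c eq in \<open>auto simp: coords_def bij_betw_def\<close>)
  from fun_cong[OF this, of i] show "x i = y i" using i by (simp add: clip_def)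
qed

lemma lc_in: "coords W k b \<Longrightarrow> lc k b x \<in> W"
  using bij_betw_apply[of "lc k b" "vecs {1..k}" W "clip k x"] by (simp add: coords_def)

lemma coords_card: "coords W k b \<Longrightarrow> card W = q ^ k"
  using bij_betw_same_card[of "lc k b" "vecs {1..k}" W] by (simp add: coords_def card_vecs)

lemma coords_finite: "coords W k b \<Longrightarrow> finite W"
  using bij_betw_finite[of "lc k b" "vecs {1..k}" W] by (simp add: coords_def)

lemma indexed_basis_coords:
  assumes "indexed_basis b"
  shows "coords UNIV m b"
  unfolding coords_def bij_betw_def
proof
  let ?B = "b ` {1..m}"
  have inj: "inj_on b {1..m}" and ind: "independent ?B" and span: "span ?B = UNIV"
    using assms by (auto simp: indexed_basis_def dim_m)
  show "inj_on (lc m b) (vecs {1..m})"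
  proof (rule inj_onI)
    fix x y assume xy: "x \<in> vecs {1..m}" "y \<in> vecs {1..m}" "lc m b x = lc m b y"
    define c where "c = (\<lambda>v. x (the_inv_into {1..m} b v) - y (the_inv_into {1..m} b v))"
    have "(\<Sum>v\<in>?B. scale (c v) v) = (\<Sum>i=1..m. scale (c (b i)) (b i))"
      by (rule sum.reindex[OF inj, unfolded comp_def])
    also have "\<dots> = (\<Sum>i=1..m. scale (x i) (b i) - scale (y i) (b i))"
    proof (rule sum.cong[OF refl])
      fix i assume "i \<in> {1..m}"
      then have "c (b i) = x i - y i" using the_inv_into_f_f[OF inj] by (simp only: c_def)
      then show "scale (c (b i)) (b i) = scale (x i) (b i) - scale (y i) (b i)"
        by (simp add: scale_left_diff_distrib)
    qed
    also have "\<dots> = 0" using xy(3) by (simp add: lc_def sum_subtractf)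
    finally have "c v = 0" if "v \<in> ?B" for v
      using independentD[OF ind _ _ _ that, of c] by simp
    then have "x i = y i" if "i \<in> {1..m}" for i
      using that the_inv_into_f_f[OF inj that] by (force simp: c_def)
    moreover have "x i = y i" if "i \<notin> {1..m}" for i using xy(1,2) that by (simp add: vecs_def)
    ultimately show "x = y" by blast
  qed
  show "lc m b ` vecs {1..m} = UNIV"
  proof -
    have "v \<in> lc m b ` vecs {1..m}" for v
    proof -
      have "v \<in> span ?B" using span by simp
      then obtain c where c: "v = (\<Sum>w\<in>?B. scale (c w) w)" by (auto simp: span_finite)
      have "v = lc m b (\<lambda>i. c (b i))"
        unfolding c lc_def by (rule sum.reindex[OF inj, unfolded comp_def])
      then have "v = lc m b (clip m (\<lambda>i. c (b i)))" by simp
      then show ?thesis by (rule image_eqI[where f = "lc m b"]) simp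
    qed
    then show ?thesis by blast
  qed
qed

lemma coords_u: "coords UNIV m u"
  by (rule indexed_basis_coords[OF basis_u])

lemma finite_V [simp]: "finite (A :: 'v set)"
  using coords_finite[OF coords_u] by (rule rev_finite_subset) simp

lemma card_V: "card (UNIV :: 'v set) = q ^ m"
  by (rule coords_card[OF coords_u])

lemma coords_span: "coords W k b \<Longrightarrow> subspace W \<Longrightarrow> span (b ` {1..k}) = W"
proof
  assume c: "coords W k b" and W: "subspace W"
  have "b i \<in> W" if "i \<in> {1..k}" for i
  proof -
    have "lc k b (\<lambda>j. if j = i then 1 else 0) = b i"
      using that by (simp add: lc_def if_distrib[of "\<lambda>c. scale c _"] cong: if_cong)
    then show ?thesis using lc_in[OF c, of "\<lambda>j. if j = i then 1 else 0"] by simp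
  qed
  then show "span (b ` {1..k}) \<subseteq> W" using W by (intro span_minimal) auto
  show "W \<subseteq> span (b ` {1..k})"
  proof
    fix w assume "w \<in> W"
    then obtain x where "w = lc k b x" using coords_surj[OF c] by blast
    show "w \<in> span (b ` {1..k})"
      unfolding \<open>w = lc k b x\<close> lc_def by (intro span_sum span_scale span_base imageI)
  qed
qed

text \<open>One inequality holds because the k vectors span W. For the other, a basis with
  \<open>dim W\<close> elements has at most \<open>q ^ dim W\<close> linear combinations, while W
  has \<open>q ^ k\<close> elements.\<close>

lemma coords_dim:
  assumes c: "coords W k b" and W: "subspace W"
  shows "dim W = k"
proof (rule antisym)
  have "dim W \<le> card (b ` {1..k})" using coords_span[OF c W] by (intro dim_le_card) auto
  also have "\<dots> \<le> k" using card_image_le[of "{1..k}" b] by simp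
  finally show "dim W \<le> k" .
  obtain B where B: "B \<subseteq> W" "independent B" "W \<subseteq> span B" "card B = dim W"
    using basis_exists by blast
  have "W \<subseteq> (\<lambda>c. \<Sum>v\<in>B. scale (c v) v) ` vecs B"
  proof
    fix w assume "w \<in> W"
    then obtain c where "w = (\<Sum>v\<in>B. scale (c v) v)" using B(3) by (auto simp: span_finite)
    then have "w = (\<Sum>v\<in>B. scale ((\<lambda>v. if v \<in> B then c v else 0) v) v)" by simp
    then show "w \<in> (\<lambda>c. \<Sum>v\<in>B. scale (c v) v) ` vecs B"
      by (rule image_eqI[where x = "\<lambda>v. if v \<in> B then c v else 0"]) (simp add: vecs_def)
  qed
  then have "card W \<le> card ((\<lambda>c. \<Sum>v\<in>B. scale (c v) v) ` vecs B)" by (intro card_mono) auto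
  also have "\<dots> \<le> card (vecs B :: ('v \<Rightarrow> 'a) set)" by (rule card_image_le) simp
  finally have "q ^ k \<le> q ^ dim W" by (simp add: coords_card[OF c] card_vecs B(4))
  then show "k \<le> dim W" using q_ge_2 by simp
qed

lemma coords_indexed_basis:
  assumes "coords UNIV m b"
  shows "indexed_basis b"
proof -
  have span: "span (b ` {1..m}) = UNIV" using coords_span[OF assms] by simp
  have inj: "inj_on b {1..m}"
  proof (rule inj_onI, rule ccontr)
    fix i j assume ij: "i \<in> {1..m}" "j \<in> {1..m}" "b i = b j" "i \<noteq> j"
    have "lc m b (\<lambda>l. if l = i then 1 else 0) = b i" "lc m b (\<lambda>l. if l = j then 1 else 0) = b j"
      using ij by (simp_all add: lc_def if_distrib[of "\<lambda>c. scale c _"] cong: if_cong)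
    then have "lc m b (\<lambda>l. if l = i then 1 else 0) = lc m b (\<lambda>l. if l = j then 1 else 0)"
      using ij(3) by simp
    from coords_inj[OF assms this ij(1)] show False using ij(4) by simp
  qed
  have "\<not> dependent (b ` {1..m})"
  proof
    assume "dependent (b ` {1..m})"
    then obtain a where a: "a \<in> b ` {1..m}" "a \<in> span (b ` {1..m} - {a})" by (auto simp: dependent_def)
    then have "span (b ` {1..m} - {a}) = span (b ` {1..m})"
      using span_redundant[OF a(2)] by (simp add: insert_absorb)
    then have "dim (UNIV :: 'v set) \<le> card (b ` {1..m} - {a})"
      using span by (intro dim_le_card) auto
    also have "\<dots> < card (b ` {1..m})" using a(1) by (intro psubset_card_mono) auto
    also have "\<dots> \<le> m" using card_image_le[of "{1..m}" b] by simp
    finally show False by (simp add: dim_m)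
  qed
  then show ?thesis using inj span by (simp add: indexed_basis_def dim_m)
qed

lemma lc_vcons: "lc (Suc k) (vcons e b) x = scale (x 1) e + lc k b (\<lambda>i. x (Suc i))"
proof -
  have "lc (Suc k) (vcons e b) x = scale (x 1) (vcons e b 1) + (\<Sum>i=1..k. scale (x (Suc i)) (vcons e b (Suc i)))"
    unfolding lc_def by (subst sum.atLeast_Suc_atMost) (simp_all add: sum.shift_bounds_cl_Suc_ivl del: sum.cl_ivl_Suc)
  then show ?thesis by (simp add: vcons_Suc lc_def)
qed

definition adjoin :: "'v \<Rightarrow> 'v set \<Rightarrow> 'v set" where
  "adjoin e W = {scale c e + w |c w. w \<in> W}"

lemma adjoinI: "w \<in> W \<Longrightarrow> scale c e + w \<in> adjoin e W"
  by (auto simp: adjoin_def)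

lemma subspace_adjoin: "subspace W \<Longrightarrow> subspace (adjoin e W)"
proof (rule subspaceI)
  assume W: "subspace W"
  show "0 \<in> adjoin e W" using adjoinI[OF subspace_0[OF W], of 0 e] by simp
  fix x y assume "x \<in> adjoin e W" "y \<in> adjoin e W"
  then obtain c w d v where "x = scale c e + w" "w \<in> W" "y = scale d e + v" "v \<in> W"
    by (auto simp: adjoin_def)
  then show "x + y \<in> adjoin e W"
    using adjoinI[OF subspace_add[OF W], of w v "c + d" e] by (simp add: scale_left_distrib algebra_simps)
next
  fix c x assume W: "subspace W" and "x \<in> adjoin e W"
  then obtain d w where "x = scale d e + w" "w \<in> W" by (auto simp: adjoin_def)
  then show "scale c x \<in> adjoin e W"
    using adjoinI[OF subspace_scale[OF W], of w "c * d" e c] by (simp add: scale_right_distrib)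
qed

lemma coords_adjoin:
  assumes c: "coords W k b" and W: "subspace W" and e: "e \<notin> W"
  shows "coords (adjoin e W) (Suc k) (vcons e b)"
proof -
  let ?f = "\<lambda>(d, x). scale d e + lc k b x"
  have "bij_betw ?f (UNIV \<times> vecs {1..k}) (adjoin e W)"
    unfolding bij_betw_def
  proof
    show "inj_on ?f (UNIV \<times> vecs {1..k})"
    proof (rule inj_onI, clarify)
      fix d x d' x' assume xx: "x \<in> vecs {1..k}" "x' \<in> vecs {1..k}"
        and eq: "scale d e + lc k b x = scale d' e + lc k b x'"
      have 1: "scale (d - d') e = lc k b x' - lc k b x"
        using eq by (simp add: scale_left_diff_distrib algebra_simps)
      have 2: "lc k b x' - lc k b x \<in> W" by (intro subspace_diff[OF W] lc_in[OF c])
      have "d = d'"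
      proof (rule ccontr)
        assume "d \<noteq> d'"
        then have "e = scale (1 / (d - d')) (scale (d - d') e)" by simp
        also have "\<dots> \<in> W" unfolding 1 by (rule subspace_scale[OF W 2])
        finally show False using e by simp
      qed
      then have "lc k b x = lc k b x'" using eq by simp
      then show "d = d' \<and> x = x'"
        using \<open>d = d'\<close> xx c by (auto simp: coords_def bij_betw_def dest: inj_onD)
    qed
    show "?f ` (UNIV \<times> vecs {1..k}) = adjoin e W"
      using coords_surj[OF c] lc_in[OF c] by (fastforce simp: adjoin_def image_iff)
  qed
  moreover have "lc (Suc k) (vcons e b) (vcons d x) = scale d e + lc k b x" for d x
    unfolding lc_vcons by (auto intro!: lc_cong simp: vcons_Suc)
  then have "bij_betw (lc (Suc k) (vcons e b) \<circ> (\<lambda>(c, x). vcons c x)) (UNIV \<times> vecs {1..k}) (adjoin e W)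
    \<longleftrightarrow> bij_betw ?f (UNIV \<times> vecs {1..k}) (adjoin e W)"
    by (intro bij_betw_cong) auto
  ultimately show ?thesis
    unfolding coords_def using bij_betw_comp_iff[OF bij_vcons] by blast
qed

lemma adjoin_iff: "x \<in> adjoin e W \<longleftrightarrow> (\<exists>c. x - scale c e \<in> W)"
proof
  assume "x \<in> adjoin e W"
  then obtain c w where "w \<in> W" "x = scale c e + w" by (auto simp: adjoin_def)
  then show "\<exists>c. x - scale c e \<in> W" by (intro exI[of _ c]) simp
next
  assume "\<exists>c. x - scale c e \<in> W"
  then obtain c where "x - scale c e \<in> W" by blast
  from adjoinI[OF this, of c e] show "x \<in> adjoin e W" by simp
qed

lemma adjoin_subset: "subspace U \<Longrightarrow> W \<subseteq> U \<Longrightarrow> e \<in> U \<Longrightarrow> adjoin e W \<subseteq> U"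
  by (auto simp: adjoin_def intro!: subspace_add subspace_scale)

lemma coords_zero: "coords {0} 0 b"
  by (simp add: coords_def lc_def bij_betw_def)

text \<open>Starting from the zero space, vectors of W outside the current subspace are adjoined;
  finiteness of W ends the process.\<close>

lemma coords_exists:
  assumes "subspace W"
  obtains k b where "coords W k b"
proof -
  have "\<exists>k b. coords W k b" if "coords U j c" "subspace U" "U \<subseteq> W" for U j c
    using that
  proof (induction "card (W - U)" arbitrary: U j c rule: less_induct)
    case less
    show ?case
    proof (cases "U = W")
      case False
      then obtain e where e: "e \<in> W" "e \<notin> U" using less.prems by blast
      have "e \<in> adjoin e U" using adjoinI[OF subspace_0[OF less.prems(2)], of 1 e] by simp
      moreover have "U \<subseteq> adjoin e U" using adjoinI[of _ U 0 e] by auto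
      ultimately have "card (W - adjoin e U) < card (W - U)"
        using e by (intro psubset_card_mono) auto
      then show ?thesis
        using less.hyps[OF _ coords_adjoin[OF less.prems(1,2) e(2)] subspace_adjoin[OF less.prems(2)]
            adjoin_subset[OF assms less.prems(3) e(1)]] by blast
    qed (use less.prems in blast)
  qed
  then show thesis using that coords_zero assms by (meson subspace_0 empty_subsetI insert_subset subspace_single_0)
qed

lemma card_subspace: "subspace W \<Longrightarrow> card W = q ^ dim W"
  by (metis coords_card coords_dim coords_exists)

section \<open>Bilinear forms and hyperbolic planes\<close>

lemma linear_scale_iff:
  "Vector_Spaces.linear scale (*) f \<longleftrightarrow> (\<forall>x y. f (x + y) = f x + f y) \<and> (\<forall>c x. f (scale c x) = c * f x)"
proof -
  have "vector_space ((*) :: 'a \<Rightarrow> 'a \<Rightarrow> 'a)" by unfold_locales (auto simp: algebra_simps)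
  then show ?thesis using vector_space_axioms by (auto simp: Vector_Spaces.linear_iff)
qed

lemma linear_endo_iff:
  "Vector_Spaces.linear scale scale f \<longleftrightarrow> (\<forall>x y. f (x + y) = f x + f y) \<and> (\<forall>c x. f (scale c x) = scale c (f x))"
  using vector_space_axioms by (auto simp: Vector_Spaces.linear_iff)

lemma bilinear_iff:
  "bilinear_form B \<longleftrightarrow> (\<forall>x y z. B x (y + z) = B x y + B x z) \<and> (\<forall>x y z. B (x + y) z = B x z + B y z)
    \<and> (\<forall>c x y. B x (scale c y) = c * B x y) \<and> (\<forall>c x y. B (scale c x) y = c * B x y)"
  unfolding bilinear_form_def linear_scale_iff by blast

lemma bilinear_add_right: "bilinear_form B \<Longrightarrow> B x (y + z) = B x y + B x z"
  and bilinear_add_left: "bilinear_form B \<Longrightarrow> B (x + y) z = B x z + B y z"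
  and bilinear_scale_right: "bilinear_form B \<Longrightarrow> B x (scale c y) = c * B x y"
  and bilinear_scale_left: "bilinear_form B \<Longrightarrow> B (scale c x) y = c * B x y"
  by (simp_all add: bilinear_iff)

lemmas bilinear_simps = bilinear_add_right bilinear_add_left bilinear_scale_right bilinear_scale_left

lemma bilinear_zero: "bilinear_form B \<Longrightarrow> B 0 x = 0" "bilinear_form B \<Longrightarrow> B x 0 = 0"
  using bilinear_scale_left[of B 0 0 x] bilinear_scale_right[of B x 0 0] by simp_all

lemma bilinear_diff: "bilinear_form B \<Longrightarrow> B (x - y) z = B x z - B y z" "bilinear_form B \<Longrightarrow> B x (y - z) = B x y - B x z"
  using bilinear_add_left[of B x "scale (-1) y" z] bilinear_add_right[of B x y "scale (-1) z"]
    bilinear_scale_left[of B "-1" y z] bilinear_scale_right[of B x "-1" z]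
  by simp_all

text \<open>Subtracting \<open>B f w\<close> times e and \<open>B e w\<close> times f projects w to
  the orthogonal complement W' of the plane in W. Both classifications use this as their induction
  step, with the order of W decreasing.\<close>

lemma coords_hyperbolic:
  assumes B: "bilinear_form B" and W: "subspace W"
    and ef: "e \<in> W" "f \<in> W" "B e f = 1" "B f e = 1" "B e e = 0" "B f f = 0"
  defines "W' \<equiv> {w \<in> W. B e w = 0 \<and> B f w = 0}"
  shows "subspace W'" and "card W' < card W"
    and "coords W' k b \<Longrightarrow> coords W (Suc (Suc k)) (vcons e (vcons f b))"
proof -
  show W': "subspace W'"
    unfolding W'_def by (rule subspaceI)
      (use W in \<open>auto simp: bilinear_simps[OF B] bilinear_zero[OF B] subspace_0 subspace_add subspace_scale\<close>)
  have "f \<notin> W'" using ef by (simp add: W'_def)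
  then have "W' \<noteq> W" using ef(2) by blast
  then show "card W' < card W" by (intro psubset_card_mono psubsetI) (auto simp: W'_def)
  assume c: "coords W' k b"
  have e: "e \<notin> adjoin f W'"
  proof
    assume "e \<in> adjoin f W'"
    then obtain c where "e - scale c f \<in> W'" by (auto simp: adjoin_iff)
    then have "B f (e - scale c f) = 0" by (simp add: W'_def)
    then show False using ef by (simp add: bilinear_diff[OF B] bilinear_simps[OF B])
  qed
  have "W = adjoin e (adjoin f W')"
  proof
    show "adjoin e (adjoin f W') \<subseteq> W"
      by (intro adjoin_subset W ef) (auto simp: W'_def)
    show "W \<subseteq> adjoin e (adjoin f W')"
    proof
      fix w assume w: "w \<in> W"
      have "w - scale (B f w) e - scale (B e w) f \<in> W'"
        using w W ef by (auto simp: W'_def bilinear_diff[OF B] bilinear_simps[OF B] intro!: subspace_diff subspace_scale)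
      then show "w \<in> adjoin e (adjoin f W')" by (auto simp: adjoin_iff)
    qed
  qed
  then show "coords W (Suc (Suc k)) (vcons e (vcons f b))"
    using coords_adjoin[OF coords_adjoin[OF c W' \<open>f \<notin> W'\<close>] subspace_adjoin[OF W'] e] by simp
qed

lemma lc_vcons2: "lc (Suc (Suc k)) (vcons e (vcons f b)) x = scale (x 1) e + (scale (x 2) f + lc k b (\<lambda>i. x (i + 2)))"
  unfolding lc_vcons by (simp add: numeral_2_eq_2)

end

section \<open>Normal forms of quadratic and symmetric bilinear forms\<close>

definition pair_sum :: "nat \<Rightarrow> (nat \<Rightarrow> 'a::field) \<Rightarrow> (nat \<Rightarrow> 'a) \<Rightarrow> 'a" where
  "pair_sum s x y = (\<Sum>i=1..s. x (2*i-1) * y (2*i) + x (2*i) * y (2*i-1))"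

text \<open>Not the polarization of \<open>kernel_part\<close>, which is alternating: the square and
  elliptic cases carry a diagonal term, as they describe symmetric forms that are not
  alternating.\<close>

definition sym_kernel_part :: "nat \<Rightarrow> kernel_kind \<Rightarrow> (nat \<Rightarrow> 'a::field) \<Rightarrow> (nat \<Rightarrow> 'a) \<Rightarrow> 'a" where
  "sym_kernel_part s K x y = (case K of
      Trivial \<Rightarrow> 0
    | Square \<Rightarrow> x (2*s+1) * y (2*s+1)
    | Elliptic \<Rightarrow> x (2*s+1) * y (2*s+2) + x (2*s+2) * y (2*s+1) + x (2*s+2) * y (2*s+2))"

lemma pair_sum_Suc:
  "pair_sum (Suc s) x y = x 1 * y 2 + x 2 * y 1 + pair_sum s (\<lambda>i. x (i + 2)) (\<lambda>i. y (i + 2))"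
proof -
  let ?f = "\<lambda>i. x (2*i-1) * y (2*i) + x (2*i) * y (2*i-1)"
  have "pair_sum (Suc s) x y = ?f 1 + (\<Sum>i=1..s. ?f (Suc i))"
    unfolding pair_sum_def
    by (subst sum.atLeast_Suc_atMost) (simp_all add: sum.shift_bounds_cl_Suc_ivl del: sum.cl_ivl_Suc)
  also have "(\<Sum>i=1..s. ?f (Suc i)) = pair_sum s (\<lambda>i. x (i + 2)) (\<lambda>i. y (i + 2))"
    unfolding pair_sum_def
  proof (rule sum.cong[OF refl])
    fix i assume "i \<in> {1..s}"
    then have "2 * Suc i - 1 = 2 * i - 1 + 2" "2 * Suc i = 2 * i + 2" by auto
    then show "?f (Suc i) = x (2 * i - 1 + 2) * y (2 * i + 2) + x (2 * i + 2) * y (2 * i - 1 + 2)"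
      by simp
  qed
  finally show ?thesis by simp
qed

lemma pair_sum_unit_even:
  assumes "t \<in> {1..s}"
  shows "pair_sum s x (\<lambda>j. if j = 2 * t then 1 else 0) = x (2 * t - 1)"
proof -
  have "pair_sum s x (\<lambda>j. if j = 2 * t then 1 else 0) = (\<Sum>i=1..s. if i = t then x (2 * t - 1) else 0)"
    unfolding pair_sum_def
  proof (rule sum.cong[OF refl])
    fix i assume "i \<in> {1..s}"
    then have "2 * i - 1 \<noteq> 2 * t" by (simp, presburger)
    then show "x (2*i-1) * (if 2*i = 2*t then 1 else 0) + x (2*i) * (if 2*i-1 = 2*t then 1 else 0)
      = (if i = t then x (2 * t - 1) else 0)" by simp
  qed
  then show ?thesis using assms by simp
qed

lemma pair_sum_unit_odd:
  assumes "t \<in> {1..s}"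
  shows "pair_sum s x (\<lambda>j. if j = 2 * t - 1 then 1 else 0) = x (2 * t)"
proof -
  have "pair_sum s x (\<lambda>j. if j = 2 * t - 1 then 1 else 0) = (\<Sum>i=1..s. if i = t then x (2 * t) else 0)"
    unfolding pair_sum_def
  proof (rule sum.cong[OF refl])
    fix i assume i: "i \<in> {1..s}"
    then have "2 * i \<noteq> 2 * t - 1" "2 * i - 1 = 2 * t - 1 \<longleftrightarrow> i = t" using assms by (simp_all, presburger+)
    then show "x (2*i-1) * (if 2*i = 2*t-1 then 1 else 0) + x (2*i) * (if 2*i-1 = 2*t-1 then 1 else 0)
      = (if i = t then x (2 * t) else 0)" by simp
  qed
  then show ?thesis using assms by simp
qed

lemma pair_sum_unit_beyond:
  assumes "2 * s < j"
  shows "pair_sum s x (\<lambda>i. if i = j then 1 else 0) = 0"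
  unfolding pair_sum_def by (rule sum.neutral) (use assms in auto)

lemma pair_sum_nondegenerate:
  assumes "\<And>j. j \<in> {1..2 * s} \<Longrightarrow> pair_sum s x (\<lambda>i. if i = j then 1 else 0) = 0" and i: "i \<in> {1..2 * s}"
  shows "x i = 0"
proof (cases "even i")
  case True
  then obtain t where t: "i = 2 * t" by (elim evenE)
  then have "t \<in> {1..s}" "2 * t - 1 \<in> {1..2 * s}" using i by auto
  then show ?thesis using pair_sum_unit_odd[of t s x] assms(1)[of "2 * t - 1"] t by simp
next
  case False
  then obtain t where t: "i = 2 * t + 1" by (elim oddE)
  then have "Suc t \<in> {1..s}" using i by auto
  then show ?thesis using pair_sum_unit_even[of "Suc t" s x] assms(1)[of "2 * Suc t"] t by simp
qed

lemma pair_sum_zero: "(\<And>i. i \<in> {1..2 * s} \<Longrightarrow> x i = 0) \<Longrightarrow> pair_sum s x y = 0"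
  unfolding pair_sum_def
proof (rule sum.neutral, safe)
  fix i assume *: "\<And>i. i \<in> {1..2 * s} \<Longrightarrow> x i = 0" and i: "i \<in> {1..s}"
  have "x (2*i-1) = 0" "x (2*i) = 0" by (rule *; use i in auto)+
  then show "x (2*i-1) * y (2*i) + x (2*i) * y (2*i-1) = 0" by simp
qed

context even_form_space
begin

lemma polar_commute: "polar Q x y = polar Q y x"
  by (simp add: polar_def add.commute algebra_simps)

lemma quad_scale: "quadratic_form Q \<Longrightarrow> Q (scale a x) = a\<^sup>2 * Q x"
  and quad_polar: "quadratic_form Q \<Longrightarrow> bilinear_form (polar Q)"
  by (simp_all add: quadratic_form_def)

lemma quad_add: "Q (x + y) = Q x + Q y + polar Q x y"
  by (simp add: polar_def)

lemma quad_zero: "quadratic_form Q \<Longrightarrow> Q 0 = 0"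
  using quad_scale[of Q 0 0] by simp

lemma add_self_V: "x + x = (0 :: 'v)"
  using scale_left_distrib[of 1 1 x] by (simp add: add_self two_eq_0)

lemma polar_self: "quadratic_form Q \<Longrightarrow> polar Q x x = 0"
  by (simp add: polar_def add_self_V quad_zero minus_eq add_self)

text \<open>A singular vector that is not orthogonal to all of W spans a hyperbolic plane with a
  second vector, and the plane is split off. If there is none, the singular vectors form a subspace
  R orthogonal to W and the form is anisotropic modulo R. As every element is a square and the
  Artin-Schreier image has index two, W has dimension at most 2 over R, with one possible form in
  each dimension.\<close>

lemma quad_normal_form:
  assumes Q: "quadratic_form Q" and "subspace W"
  shows "\<exists>k b s K. coords W k b \<and> 2 * s + kernel_dim K \<le> k \<and>
    (\<forall>x. Q (lc k b x) = normal_sum lam s K (\<lambda>i j. x i * x j))"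
  using assms(2)
proof (induction "card W" arbitrary: W rule: less_induct)
  case less
  note W = less.prems
  note bil = quad_polar[OF Q]
  show ?case
  proof (cases "\<exists>e\<in>W. \<exists>f\<in>W. Q e = 0 \<and> polar Q e f \<noteq> 0")
    case True
    then obtain e f0 where e: "e \<in> W" "Q e = 0" and f0: "f0 \<in> W" "polar Q e f0 \<noteq> 0" by blast
    define f1 where "f1 = scale (1 / polar Q e f0) f0"
    \<comment> \<open>Adding \<open>c\<close> times e changes the value of Q at f1 by c, because
      \<open>polar Q e f1 = 1\<close>. The choice \<open>c = Q f1\<close> makes f singular.\<close>
    define f where "f = f1 + scale (Q f1) e"
    have f1: "f1 \<in> W" "polar Q e f1 = 1"
      using f0 W by (auto simp: f1_def bilinear_simps[OF bil] intro: subspace_scale)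
    have ef: "polar Q e f = 1" "polar Q f e = 1"
      using f1 polar_commute[of Q f e] by (simp_all add: f_def bilinear_simps[OF bil] polar_self[OF Q])
    have f: "f \<in> W" using f1 e W by (auto simp: f_def intro: subspace_add subspace_scale)
    have "Q f = Q f1 + Q f1"
      using f1(2) polar_commute[of Q f1 e]
      by (simp add: f_def quad_add[of Q] quad_scale[OF Q] e bilinear_simps[OF bil])
    then have Qf: "Q f = 0" by (simp add: add_self)
    define W' where "W' = {w \<in> W. polar Q e w = 0 \<and> polar Q f w = 0}"
    note split = coords_hyperbolic[OF bil W e(1) f ef polar_self[OF Q] polar_self[OF Q], folded W'_def]
    obtain k b s K where IH: "coords W' k b" "2 * s + kernel_dim K \<le> k"
        "\<And>x. Q (lc k b x) = normal_sum lam s K (\<lambda>i j. x i * x j)"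
      using less.hyps[OF split(2,1)] by blast
    have "Q (lc (Suc (Suc k)) (vcons e (vcons f b)) x) = normal_sum lam (Suc s) K (\<lambda>i j. x i * x j)" for x
    proof -
      let ?w = "lc k b (\<lambda>i. x (i + 2))"
      have "?w \<in> W'" by (rule lc_in[OF IH(1)])
      then have w: "polar Q e ?w = 0" "polar Q f ?w = 0" by (auto simp: W'_def)
      have "Q (scale (x 1) e + (scale (x 2) f + ?w)) = x 1 * x 2 + Q ?w"
        by (simp add: quad_add[of Q] quad_scale[OF Q] bilinear_simps[OF bil] w[simplified] ef e Qf)
      then show ?thesis unfolding lc_vcons2 normal_sum_Suc IH(3) by simp
    qed
    then show ?thesis
      using split(3)[OF IH(1)] IH(2) by (intro exI[of _ "Suc (Suc k)"] exI[of _ "vcons e (vcons f b)"] exI[of _ "Suc s"] exI[of _ K]) simp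
  next
    case False
    define R where "R = {e \<in> W. Q e = 0}"
    have rad: "polar Q e f = 0" "polar Q f e = 0" if "e \<in> R" "f \<in> W" for e f
      using False that polar_commute[of Q e f] by (auto simp: R_def)
    have R: "subspace R"
      unfolding R_def
    proof (rule subspaceI)
      fix x y assume "x \<in> {e \<in> W. Q e = 0}" "y \<in> {e \<in> W. Q e = 0}"
      then show "x + y \<in> {e \<in> W. Q e = 0}" using rad[of x y] by (simp add: R_def quad_add[of Q] subspace_add[OF W])
    qed (auto simp: subspace_0[OF W] subspace_scale[OF W] quad_zero[OF Q] quad_scale[OF Q])
    have RW: "R \<subseteq> W" by (auto simp: R_def)
    obtain k b where b: "coords R k b" using coords_exists[OF R] .
    have Qr: "Q r = 0" if "r \<in> R" for r using that by (simp add: R_def)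
    show ?thesis
    proof (cases "R = W")
      case True
      have "Q (lc k b x) = normal_sum lam 0 Trivial (\<lambda>i j. x i * x j)" for x
        using Qr[OF lc_in[OF b]] by (simp add: normal_sum_def kernel_part_def)
      then show ?thesis using b True by (intro exI[of _ k] exI[of _ b] exI[of _ 0] exI[of _ Trivial]) simp
    next
      case False
      then obtain u0 where u0: "u0 \<in> W" "u0 \<notin> R" using RW by blast
      obtain t where t: "t\<^sup>2 = 1 / Q u0" using square_surj by blast
      define u1 where "u1 = scale t u0"
      have "Q u0 \<noteq> 0" using u0 by (simp add: R_def)
      then have Qu1: "Q u1 = 1" by (simp add: u1_def quad_scale[OF Q] t)
      have u1: "u1 \<in> W" "u1 \<notin> R" using u0 Qu1 W by (auto simp: u1_def R_def intro: subspace_scale)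
      define W1 where "W1 = adjoin u1 R"
      note c1 = coords_adjoin[OF b R u1(2), folded W1_def]
      have W1: "subspace W1" unfolding W1_def by (rule subspace_adjoin[OF R])
      have W1W: "W1 \<subseteq> W" unfolding W1_def by (rule adjoin_subset[OF W RW u1(1)])
      show ?thesis
      proof (cases "W1 = W")
        case True
        have "Q (lc (Suc k) (vcons u1 b) x) = normal_sum lam 0 Square (\<lambda>i j. x i * x j)" for x
        proof -
          let ?r = "lc k b (\<lambda>i. x (Suc i))"
          have r: "?r \<in> R" by (rule lc_in[OF b])
          show ?thesis
            unfolding lc_vcons using Qr[OF r] rad(2)[OF r u1(1)]
            by (simp add: quad_add[of Q] quad_scale[OF Q] Qu1 bilinear_simps[OF bil] normal_sum_def kernel_part_def power2_eq_square)
        qed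
        then show ?thesis using c1 True by (intro exI[of _ "Suc k"] exI[of _ "vcons u1 b"] exI[of _ 0] exI[of _ Square]) simp
      next
        case False
        then obtain v0 where v0: "v0 \<in> W" "v0 \<notin> W1" using W1W by blast
        \<comment> \<open>Bounds the dimension modulo R: for v orthogonal to u1, a multiple of u1
          with the same value as v cancels \<open>Q v\<close>, so v lies in the span of u1 and
          R.\<close>
        have sing: "\<exists>t. scale t u1 + v \<in> R" if v: "v \<in> W" "polar Q u1 v = 0" for v
        proof -
          obtain t where t: "t\<^sup>2 = Q v" using square_surj by blast
          have "Q (scale t u1 + v) = Q v + Q v"
            by (simp add: quad_add[of Q] quad_scale[OF Q] Qu1 t bilinear_simps[OF bil] v)
          then have "scale t u1 + v \<in> R"
            using v u1 W by (auto simp: R_def add_self intro: subspace_add subspace_scale)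
          then show ?thesis ..
        qed
        have p: "polar Q u1 v0 \<noteq> 0"
        proof
          assume "polar Q u1 v0 = 0"
          then obtain t where "scale t u1 + v0 \<in> R" using sing v0 by blast
          then have "v0 - scale (- t) u1 \<in> R" by (simp add: add.commute)
          then have "v0 \<in> W1" unfolding W1_def adjoin_iff by (rule exI)
          then show False using v0 by simp
        qed
        define v1 where "v1 = scale (1 / polar Q u1 v0) v0"
        have v1: "v1 \<in> W" "polar Q u1 v1 = 1"
          using v0 W p by (auto simp: v1_def bilinear_simps[OF bil] intro: subspace_scale)
        have v1W1: "v1 \<notin> W1"
        proof
          assume "v1 \<in> W1"
          then have "scale (polar Q u1 v0) v1 \<in> W1" by (rule subspace_scale[OF W1])
          then show False using v0 p by (simp add: v1_def)
        qed
        \<comment> \<open>Moving v1 along u1 lets \<open>Q\<close> run through a coset of the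
          Artin-Schreier image. It is not the image itself, since otherwise some shift of v1 would
          be singular and lie in R. By index two the coset contains \<open>lam\<close>.\<close>
        have shift: "Q (v1 + scale z u1) = Q v1 + (z\<^sup>2 + z)" for z
          using v1 polar_commute[of Q v1 u1]
          by (simp add: quad_add[of Q] quad_scale[OF Q] Qu1 bilinear_simps[OF bil])
        have notin: "v1 + scale z u1 \<notin> W1" for z
        proof
          assume *: "v1 + scale z u1 \<in> W1"
          have "u1 \<in> W1" using adjoinI[OF subspace_0[OF R], of 1 u1] by (simp add: W1_def)
          then have "(v1 + scale z u1) - scale z u1 \<in> W1"
            using * by (intro subspace_diff[OF W1] subspace_scale[OF W1])
          then show False using v1W1 by simp
        qed
        have "z\<^sup>2 + z \<noteq> Q v1" for z
        proof
          assume "z\<^sup>2 + z = Q v1"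
          then have "Q (v1 + scale z u1) = 0" using shift[of z] by (simp add: add_self)
          then have "v1 + scale z u1 \<in> R" using v1 u1 W by (auto simp: R_def intro: subspace_add subspace_scale)
          then have "v1 + scale z u1 \<in> W1" using adjoinI[of _ R 0 u1] by (simp add: W1_def)
          then show False using notin by blast
        qed
        then obtain z where z: "z\<^sup>2 + z = Q v1 + lam" by (rule artin_schreier_coset[OF _ lam])
        define u2 where "u2 = v1 + scale z u1"
        have Qu2: "Q u2 = lam" using shift[of z] by (simp add: u2_def z add.assoc[symmetric] add_self)
        have u2: "u2 \<in> W" "u2 \<notin> W1" "polar Q u1 u2 = 1" "polar Q u2 u1 = 1"
          using v1 u1 W notin polar_commute[of Q u2 u1]
          by (auto simp: u2_def bilinear_simps[OF bil] polar_self[OF Q] intro: subspace_add subspace_scale)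
        have nu2: "u2 \<notin> R" using u2(2) adjoinI[of u2 R 0 u1] by (auto simp: W1_def)
        \<comment> \<open>The normal form lists u1 before u2, so W is rebuilt as
          \<open>adjoin u1 (adjoin u2 R)\<close> instead of being extended from W1.\<close>
        define W2 where "W2 = adjoin u2 R"
        have W2: "subspace W2" unfolding W2_def by (rule subspace_adjoin[OF R])
        have u1W2: "u1 \<notin> W2"
        proof
          assume "u1 \<in> W2"
          then obtain c where c: "u1 - scale c u2 \<in> R" by (auto simp: W2_def adjoin_iff)
          have "polar Q (u1 - scale c u2) u1 = 0" by (rule rad(1)[OF c u1(1)])
          then have "c = 0" using u2 by (simp add: bilinear_diff[OF bil] bilinear_simps[OF bil] polar_self[OF Q])
          then show False using c u1 by simp
        qed
        have W2W: "W2 \<subseteq> W" unfolding W2_def by (rule adjoin_subset[OF W RW u2(1)])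
        note c2 = coords_adjoin[OF coords_adjoin[OF b R nu2, folded W2_def] W2 u1W2]
        have "adjoin u1 W2 = W"
        proof (rule ccontr)
          assume "adjoin u1 W2 \<noteq> W"
          then obtain w where w: "w \<in> W" "w \<notin> adjoin u1 W2" using adjoin_subset[OF W W2W u1(1)] by blast
          define w' where "w' = w + (scale (polar Q u2 w) u1 + scale (polar Q u1 w) u2)"
          have w': "w' \<in> W" using w u1 u2 W by (auto simp: w'_def intro!: subspace_add subspace_scale)
          have "polar Q u1 w' = 0"
            using u2 by (simp add: w'_def bilinear_simps[OF bil] polar_self[OF Q] add_self)
          then obtain t where t: "scale t u1 + w' \<in> R" using sing w' by blast
          have "w - scale (- (t + polar Q u2 w)) u1 - scale (- polar Q u1 w) u2 \<in> R"
            using t by (simp add: w'_def scale_left_distrib algebra_simps)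
          then have "w - scale (- (t + polar Q u2 w)) u1 \<in> W2" unfolding W2_def adjoin_iff by (rule exI)
          then have "w \<in> adjoin u1 W2" unfolding adjoin_iff by (rule exI)
          then show False using w by simp
        qed
        moreover have "Q (lc (Suc (Suc k)) (vcons u1 (vcons u2 b)) x) = normal_sum lam 0 Elliptic (\<lambda>i j. x i * x j)" for x
        proof -
          let ?r = "lc k b (\<lambda>i. x (i + 2))"
          have r: "?r \<in> R" by (rule lc_in[OF b])
          show ?thesis
            unfolding lc_vcons2 using Qr[OF r] rad(2)[OF r u1(1)] rad(2)[OF r u2(1)] u2
            by (simp add: quad_add[of Q] quad_scale[OF Q] Qu1 Qu2 bilinear_simps[OF bil] normal_sum_def kernel_part_def
                power2_eq_square numeral_2_eq_2 mult.commute add_ac)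
        qed
        ultimately show ?thesis using c2
          by (intro exI[of _ "Suc (Suc k)"] exI[of _ "vcons u1 (vcons u2 b)"] exI[of _ 0] exI[of _ Elliptic]) simp
      qed
    qed
  qed
qed

lemma symmetric_bilinear: "symmetric_form S \<Longrightarrow> bilinear_form S"
  and symmetric_commute: "symmetric_form S \<Longrightarrow> S x y = S y x"
  by (auto simp: symmetric_form_def)

lemma symmetric_diag_add: "symmetric_form S \<Longrightarrow> S (x + y) (x + y) = S x x + S y y"
  using symmetric_commute[of S y x]
  by (simp add: bilinear_simps[OF symmetric_bilinear] algebra_simps two_eq_0)

text \<open>When no two isotropic vectors are left that pair nontrivially, the isotropic vectors
  form a totally isotropic subspace R, because \<open>S x x\<close> is additive in x. Every element
  being a square, R and a single vector u1 span W. If u1 is not orthogonal to R, the part R' of R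
  orthogonal to u1 is orthogonal to everything, and u1 with one vector e of R gives the elliptic
  part.\<close>

lemma sym_normal_form:
  assumes S: "symmetric_form S" and "subspace W"
  shows "\<exists>k b s K. coords W k b \<and> 2 * s + kernel_dim K \<le> k \<and>
    (\<forall>x y. S (lc k b x) (lc k b y) = pair_sum s x y + sym_kernel_part s K x y)"
  using assms(2)
proof (induction "card W" arbitrary: W rule: less_induct)
  case less
  note W = less.prems
  note bil = symmetric_bilinear[OF S] and comm = symmetric_commute[OF S]
  show ?case
  proof (cases "\<exists>e\<in>W. \<exists>f\<in>W. S e e = 0 \<and> S f f = 0 \<and> S e f \<noteq> 0")
    case True
    then obtain e f0 where e: "e \<in> W" "S e e = 0" and f0: "f0 \<in> W" "S f0 f0 = 0" "S e f0 \<noteq> 0" by blast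
    define f where "f = scale (1 / S e f0) f0"
    have f: "f \<in> W" "S f f = 0" and ef: "S e f = 1" "S f e = 1"
      using f0 W comm[of f e] by (auto simp: f_def bilinear_simps[OF bil] intro: subspace_scale)
    define W' where "W' = {w \<in> W. S e w = 0 \<and> S f w = 0}"
    note split = coords_hyperbolic[OF bil W e(1) f(1) ef e(2) f(2), folded W'_def]
    obtain k b s K where IH: "coords W' k b" "2 * s + kernel_dim K \<le> k"
        "\<And>x y. S (lc k b x) (lc k b y) = pair_sum s x y + sym_kernel_part s K x y"
      using less.hyps[OF split(2,1)] by blast
    have "S (lc (Suc (Suc k)) (vcons e (vcons f b)) x) (lc (Suc (Suc k)) (vcons e (vcons f b)) y)
      = pair_sum (Suc s) x y + sym_kernel_part (Suc s) K x y" for x y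
    proof -
      have w: "S e (lc k b z) = 0" "S f (lc k b z) = 0" "S (lc k b z) e = 0" "S (lc k b z) f = 0" for z
        using lc_in[OF IH(1), of z] comm by (auto simp: W'_def)
      have "sym_kernel_part (Suc s) K x y = sym_kernel_part s K (\<lambda>i. x (i + 2)) (\<lambda>i. y (i + 2))"
        by (cases K) (simp_all add: sym_kernel_part_def)
      then show ?thesis
        unfolding lc_vcons2 pair_sum_Suc
        by (simp add: bilinear_simps[OF bil] w ef e f IH(3) add_ac)
    qed
    then show ?thesis
      using split(3)[OF IH(1)] IH(2) by (intro exI[of _ "Suc (Suc k)"] exI[of _ "vcons e (vcons f b)"] exI[of _ "Suc s"] exI[of _ K]) simp
  next
    case False
    define R where "R = {e \<in> W. S e e = 0}"
    have iso: "S e f = 0" if "e \<in> R" "f \<in> R" for e f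
      using False that by (auto simp: R_def)
    have R: "subspace R"
      unfolding R_def
    proof (rule subspaceI)
      fix x y assume "x \<in> {e \<in> W. S e e = 0}" "y \<in> {e \<in> W. S e e = 0}"
      then show "x + y \<in> {e \<in> W. S e e = 0}"
        by (simp add: subspace_add[OF W] symmetric_diag_add[OF S])
    qed (auto simp: subspace_0[OF W] subspace_scale[OF W] bilinear_simps[OF bil] bilinear_zero[OF bil])
    have RW: "R \<subseteq> W" by (auto simp: R_def)
    obtain k b where b: "coords R k b" using coords_exists[OF R] .
    have r: "lc k b x \<in> R" for x by (rule lc_in[OF b])
    show ?thesis
    proof (cases "R = W")
      case True
      have "S (lc k b x) (lc k b y) = pair_sum 0 x y + sym_kernel_part 0 Trivial x y" for x y
        using iso[OF r r] by (simp add: pair_sum_def sym_kernel_part_def)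
      then show ?thesis using b True by (intro exI[of _ k] exI[of _ b] exI[of _ 0] exI[of _ Trivial]) simp
    next
      case False
      then obtain u0 where u0: "u0 \<in> W" "u0 \<notin> R" using RW by blast
      obtain t where t: "t\<^sup>2 = 1 / S u0 u0" using square_surj by blast
      define u1 where "u1 = scale t u0"
      have "S u0 u0 \<noteq> 0" using u0 by (simp add: R_def)
      moreover have "S u1 u1 = t\<^sup>2 * S u0 u0" by (simp add: u1_def bilinear_simps[OF bil] power2_eq_square)
      ultimately have S1: "S u1 u1 = 1" by (simp add: t)
      have u1: "u1 \<in> W" "u1 \<notin> R" using u0 S1 W by (auto simp: u1_def R_def intro: subspace_scale)
      have WR: "W = adjoin u1 R"
      proof
        show "adjoin u1 R \<subseteq> W" by (rule adjoin_subset[OF W RW u1(1)])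
        show "W \<subseteq> adjoin u1 R"
        proof
          fix w assume w: "w \<in> W"
          obtain t where t: "t\<^sup>2 = S w w" using square_surj by blast
          have "S (w + scale t u1) (w + scale t u1) = S w w + t\<^sup>2"
            by (simp only: symmetric_diag_add[OF S]) (simp add: bilinear_simps[OF bil] S1 power2_eq_square)
          then have "w + scale t u1 \<in> R"
            using w u1 W by (auto simp: R_def t add_self intro: subspace_add subspace_scale)
          then have "w - scale (- t) u1 \<in> R" by simp
          then show "w \<in> adjoin u1 R" unfolding adjoin_iff by (rule exI)
        qed
      qed
      show ?thesis
      proof (cases "\<forall>e\<in>R. S u1 e = 0")
        case True
        then have z: "S u1 (lc k b x) = 0" "S (lc k b x) u1 = 0" for x using r comm by auto
        have "S (lc (Suc k) (vcons u1 b) x) (lc (Suc k) (vcons u1 b) y) = pair_sum 0 x y + sym_kernel_part 0 Square x y" for x y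
          unfolding lc_vcons by (simp add: bilinear_simps[OF bil] z S1 iso[OF r r] pair_sum_def sym_kernel_part_def)
        then show ?thesis using coords_adjoin[OF b R u1(2)] WR
          by (intro exI[of _ "Suc k"] exI[of _ "vcons u1 b"] exI[of _ 0] exI[of _ Square]) simp
      next
        case False
        then obtain e0 where e0: "e0 \<in> R" "S u1 e0 \<noteq> 0" by blast
        define e where "e = scale (1 / S u1 e0) e0"
        have e: "e \<in> R" "S u1 e = 1" "S e u1 = 1" "S e e = 0"
          using e0 R comm[of e u1] iso by (auto simp: e_def bilinear_simps[OF bil] intro: subspace_scale)
        define R' where "R' = {x \<in> R. S u1 x = 0}"
        have R': "subspace R'"
          unfolding R'_def by (rule subspaceI)
            (auto simp: subspace_0[OF R] subspace_add[OF R] subspace_scale[OF R] bilinear_simps[OF bil] bilinear_zero[OF bil])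
        obtain k' b' where b': "coords R' k' b'" using coords_exists[OF R'] .
        have r': "lc k' b' x \<in> R" "S u1 (lc k' b' x) = 0" "S (lc k' b' x) u1 = 0" for x
          using lc_in[OF b', of x] comm by (auto simp: R'_def)
        have u1R': "u1 \<notin> R'" using u1 by (simp add: R'_def)
        have Req: "R = adjoin e R'"
        proof
          show "adjoin e R' \<subseteq> R" by (rule adjoin_subset[OF R _ e(1)]) (auto simp: R'_def)
          show "R \<subseteq> adjoin e R'"
          proof
            fix w assume w: "w \<in> R"
            then have "w - scale (S u1 w) e \<in> R'"
              using e R by (auto simp: R'_def bilinear_diff[OF bil] bilinear_simps[OF bil] intro!: subspace_diff subspace_scale)
            then show "w \<in> adjoin e R'" by (auto simp: adjoin_iff)
          qed
        qed
        define W1 where "W1 = adjoin u1 R'"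
        have W1: "subspace W1" unfolding W1_def by (rule subspace_adjoin[OF R'])
        have eW1: "e \<notin> W1"
        proof
          assume "e \<in> W1"
          then obtain c where c: "e - scale c u1 \<in> R'" by (auto simp: W1_def adjoin_iff)
          then have "S u1 (e - scale c u1) = 0" "S e (e - scale c u1) = 0"
            using iso[OF e(1)] by (auto simp: R'_def)
          then show False using e S1 by (simp add: bilinear_diff[OF bil] bilinear_simps[OF bil])
        qed
        have "adjoin e W1 = W"
        proof
          show "adjoin e W1 \<subseteq> W"
            unfolding W1_def using RW e u1 by (intro adjoin_subset W) (auto simp: R'_def)
          show "W \<subseteq> adjoin e W1"
          proof
            fix w assume "w \<in> W"
            then obtain c where "w - scale c u1 \<in> R" by (auto simp: WR adjoin_iff)
            then obtain d where "w - scale c u1 - scale d e \<in> R'" by (auto simp: Req adjoin_iff)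
            then have "w - scale d e - scale c u1 \<in> R'" by (simp add: algebra_simps)
            then show "w \<in> adjoin e W1" by (auto simp: W1_def adjoin_iff)
          qed
        qed
        moreover have "S (lc (Suc (Suc k')) (vcons e (vcons u1 b')) x) (lc (Suc (Suc k')) (vcons e (vcons u1 b')) y)
          = pair_sum 0 x y + sym_kernel_part 0 Elliptic x y" for x y
          unfolding lc_vcons2
          by (simp add: bilinear_simps[OF bil] r' e S1 iso[OF e(1) r'(1)] iso[OF r'(1) e(1)] iso[OF r'(1) r'(1)]
              pair_sum_def sym_kernel_part_def numeral_2_eq_2 algebra_simps)
        ultimately show ?thesis
          using coords_adjoin[OF coords_adjoin[OF b' R' u1R', folded W1_def] W1 eW1]
          by (intro exI[of _ "Suc (Suc k')"] exI[of _ "vcons e (vcons u1 b')"] exI[of _ 0] exI[of _ Elliptic]) simp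
      qed
    qed
  qed
qed

section \<open>Ranks of normal forms\<close>

lemma codim_coords:
  assumes b: "coords UNIV m b" and N: "N \<le> m" and R: "subspace R"
    and mem: "\<And>x. lc m b x \<in> R \<longleftrightarrow> (\<forall>i\<in>{1..N}. x i = 0)"
  shows "codim R = N"
proof -
  have sub: "vecs {N + 1..m} \<subseteq> (vecs {1..m} :: (nat \<Rightarrow> 'a) set)" by (auto simp: vecs_def)
  have "R = lc m b ` vecs {N + 1..m}"
  proof
    show "R \<subseteq> lc m b ` vecs {N + 1..m}"
    proof
      fix v assume v: "v \<in> R"
      obtain x where x: "x \<in> vecs {1..m}" "v = lc m b x" using coords_surj[OF b, of v] by auto
      then have "\<forall>i\<in>{1..N}. x i = 0" using mem v by simp
      then have "x \<in> vecs {N + 1..m}" using x(1) by (force simp: vecs_def)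
      then show "v \<in> lc m b ` vecs {N + 1..m}" using x by simp
    qed
    show "lc m b ` vecs {N + 1..m} \<subseteq> R" using mem by (auto simp: vecs_def)
  qed
  moreover have "inj_on (lc m b) (vecs {N + 1..m})"
    using b sub by (auto simp: coords_def bij_betw_def intro: inj_on_subset)
  ultimately have "card R = q ^ (m - N)" by (simp add: card_image card_vecs)
  then have "dim R = m - N" by (simp add: card_subspace[OF R])
  then show ?thesis using N by (simp add: codim_def dim_m)
qed

lemma subspace_quad_radical:
  assumes Q: "quadratic_form Q"
  shows "subspace {x. (\<forall>y. polar Q x y = 0) \<and> Q x = 0}"
proof (rule subspaceI)
  note bil = quad_polar[OF Q]
  fix x y assume "x \<in> {x. (\<forall>y. polar Q x y = 0) \<and> Q x = 0}" "y \<in> {x. (\<forall>y. polar Q x y = 0) \<and> Q x = 0}"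
  then show "x + y \<in> {x. (\<forall>y. polar Q x y = 0) \<and> Q x = 0}"
    by (simp add: bilinear_simps[OF bil] quad_add[of Q])
qed (simp_all add: bilinear_simps[OF quad_polar[OF Q]] bilinear_zero[OF quad_polar[OF Q]] quad_zero[OF Q] quad_scale[OF Q])

lemma subspace_sym_radical:
  assumes "symmetric_form S"
  shows "subspace {x. \<forall>y. S x y = 0}"
  by (rule subspaceI) (simp_all add: bilinear_simps[OF symmetric_bilinear[OF assms]] bilinear_zero[OF symmetric_bilinear[OF assms]])

lemma normal_sum_polarize:
  "normal_sum lam s K (\<lambda>i j. (x i + y i) * (x j + y j)) =
    normal_sum lam s K (\<lambda>i j. x i * x j) + normal_sum lam s K (\<lambda>i j. y i * y j) +
    (pair_sum s x y + (if K = Elliptic then x (2*s+1) * y (2*s+2) + x (2*s+2) * y (2*s+1) else 0))"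
proof -
  have "(\<Sum>i=1..s. (x (2*i-1) + y (2*i-1)) * (x (2*i) + y (2*i))) =
      (\<Sum>i=1..s. x (2*i-1) * x (2*i)) + (\<Sum>i=1..s. y (2*i-1) * y (2*i)) + pair_sum s x y"
    unfolding pair_sum_def sum.distrib[symmetric] by (rule sum.cong) (auto simp: algebra_simps)
  moreover have "kernel_part lam s K (\<lambda>i j. (x i + y i) * (x j + y j)) =
      kernel_part lam s K (\<lambda>i j. x i * x j) + kernel_part lam s K (\<lambda>i j. y i * y j) +
      (if K = Elliptic then x (2*s+1) * y (2*s+2) + x (2*s+2) * y (2*s+1) else 0)"
    by (cases K) (simp_all add: kernel_part_def algebra_simps two_eq_0)
  ultimately show ?thesis unfolding normal_sum_def by (simp only: add_ac)
qed

definition normal_at :: "('v \<Rightarrow> 'a) \<Rightarrow> (nat \<Rightarrow> 'v) \<Rightarrow> nat \<Rightarrow> kernel_kind \<Rightarrow> bool" where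
  "normal_at Q b s K \<longleftrightarrow> coords UNIV m b \<and> 2 * s + kernel_dim K \<le> m \<and>
    (\<forall>x. Q (lc m b x) = normal_sum lam s K (\<lambda>i j. x i * x j))"

lemma normal_at_exists:
  assumes "quadratic_form Q"
  obtains b s K where "normal_at Q b s K"
proof -
  obtain k b s K where c: "coords UNIV k b" "2 * s + kernel_dim K \<le> k"
    "\<forall>x. Q (lc k b x) = normal_sum lam s K (\<lambda>i j. x i * x j)"
    using quad_normal_form[OF assms subspace_UNIV] by blast
  moreover have "k = m" using coords_dim[OF c(1)] dim_m by simp
  ultimately show thesis using that by (simp add: normal_at_def)
qed

lemma polar_normal_at:
  assumes "normal_at Q b s K"
  shows "polar Q (lc m b x) (lc m b y) =
    pair_sum s x y + (if K = Elliptic then x (2*s+1) * y (2*s+2) + x (2*s+2) * y (2*s+1) else 0)"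
proof -
  have Q: "Q (lc m b x) = normal_sum lam s K (\<lambda>i j. x i * x j)" for x
    using assms by (simp add: normal_at_def)
  show ?thesis
    unfolding polar_def lc_add[symmetric] Q normal_sum_polarize by simp
qed

text \<open>Testing the polar form on unit vectors clears all coordinates but that of a square term,
  which the polar form does not see. There the condition \<open>Q x = 0\<close> in the radical does
  the work.\<close>

lemma quad_rank_normal_at:
  assumes Q: "quadratic_form Q" and n: "normal_at Q b s K"
  shows "quad_rank Q = 2 * s + kernel_dim K"
  unfolding quad_rank_def
proof (rule codim_coords[OF _ _ subspace_quad_radical[OF Q]])
  show b: "coords UNIV m b" and le: "2 * s + kernel_dim K \<le> m" using n by (auto simp: normal_at_def)
  have Qx: "Q (lc m b x) = normal_sum lam s K (\<lambda>i j. x i * x j)" for x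
    using n by (simp add: normal_at_def)
  fix x
  show "lc m b x \<in> {x. (\<forall>y. polar Q x y = 0) \<and> Q x = 0} \<longleftrightarrow> (\<forall>i\<in>{1..2 * s + kernel_dim K}. x i = 0)"
  proof
    assume "lc m b x \<in> {x. (\<forall>y. polar Q x y = 0) \<and> Q x = 0}"
    then have pol: "pair_sum s x y + (if K = Elliptic then x (2*s+1) * y (2*s+2) + x (2*s+2) * y (2*s+1) else 0) = 0"
      and Q0: "normal_sum lam s K (\<lambda>i j. x i * x j) = 0" for y
      unfolding polar_normal_at[OF n, symmetric] Qx[symmetric] by auto
    have low: "x i = 0" if "i \<in> {1..2 * s}" for i
    proof (rule pair_sum_nondegenerate[OF _ that])
      fix j assume "j \<in> {1..2 * s}"
      then show "pair_sum s x (\<lambda>i. if i = j then 1 else 0) = 0"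
        using pol[of "\<lambda>i. if i = j then 1 else 0"] by (simp split: if_splits)
    qed
    show "\<forall>i\<in>{1..2 * s + kernel_dim K}. x i = 0"
    proof
      fix i assume i: "i \<in> {1..2 * s + kernel_dim K}"
      show "x i = 0"
      proof (cases "i \<le> 2 * s")
        case True
        then show ?thesis using low i by simp
      next
        case False
        show ?thesis
        proof (cases K)
          case Trivial
          then show ?thesis using i False by simp
        next
          case Square
          have "(\<Sum>i=1..s. x (2*i-1) * x (2*i)) = 0"
            by (rule sum.neutral) (auto intro!: low)
          then have "x (2*s+1) = 0" using Q0 Square by (simp add: normal_sum_def kernel_part_def)
          moreover have "i = 2*s+1" using i False Square by simp
          ultimately show ?thesis by simp
        next
          case Elliptic
          have "x (2*s+2) = 0"
            using pol[of "\<lambda>i. if i = 2*s+1 then 1 else 0"] Elliptic by (simp only: pair_sum_unit_beyond) simp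
          moreover have "x (2*s+1) = 0"
            using pol[of "\<lambda>i. if i = 2*s+2 then 1 else 0"] Elliptic by (simp only: pair_sum_unit_beyond) simp
          moreover have "i = 2*s+1 \<or> i = 2*s+2" using i False Elliptic by auto
          ultimately show ?thesis by auto
        qed
      qed
    qed
  next
    assume *: "\<forall>i\<in>{1..2 * s + kernel_dim K}. x i = 0"
    have "polar Q (lc m b x) v = 0" for v
    proof -
      obtain y where "v = lc m b y" using coords_surj[OF b, of v] by auto
      moreover have "pair_sum s x y = 0" using * by (intro pair_sum_zero) auto
      ultimately show ?thesis using * polar_normal_at[OF n, of x y] by simp
    qed
    moreover have "(\<Sum>i=1..s. x (2*i-1) * x (2*i)) = 0"
      by (rule sum.neutral) (use * in auto)
    moreover have "kernel_part lam s K (\<lambda>i j. x i * x j) = 0"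
      using * by (cases K) (simp_all add: kernel_part_def)
    ultimately show "lc m b x \<in> {x. (\<forall>y. polar Q x y = 0) \<and> Q x = 0}"
      by (simp add: Qx normal_sum_def)
  qed
qed

lemma sym_rank_normal:
  assumes S: "symmetric_form S" and b: "coords UNIV m b" and le: "2 * s + kernel_dim K \<le> m"
    and form: "\<And>x y. S (lc m b x) (lc m b y) = pair_sum s x y + sym_kernel_part s K x y"
  shows "sym_rank S = 2 * s + kernel_dim K"
  unfolding sym_rank_def
proof (rule codim_coords[OF b le subspace_sym_radical[OF S]])
  fix x
  show "lc m b x \<in> {x. \<forall>y. S x y = 0} \<longleftrightarrow> (\<forall>i\<in>{1..2 * s + kernel_dim K}. x i = 0)"
  proof
    assume "lc m b x \<in> {x. \<forall>y. S x y = 0}"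
    then have pol: "pair_sum s x y + sym_kernel_part s K x y = 0" for y
      unfolding form[symmetric] by simp
    have low: "x i = 0" if "i \<in> {1..2 * s}" for i
    proof (rule pair_sum_nondegenerate[OF _ that])
      fix j assume "j \<in> {1..2 * s}"
      then have "sym_kernel_part s K x (\<lambda>i. if i = j then 1 else 0) = 0"
        by (cases K) (auto simp: sym_kernel_part_def)
      then show "pair_sum s x (\<lambda>i. if i = j then 1 else 0) = 0"
        using pol[of "\<lambda>i. if i = j then 1 else 0"] by simp
    qed
    have high: "sym_kernel_part s K x (\<lambda>i. if i = j then 1 else 0) = 0" if "2 * s < j" for j
      using pol[of "\<lambda>i. if i = j then 1 else 0"] pair_sum_unit_beyond[OF that, of x] by simp
    show "\<forall>i\<in>{1..2 * s + kernel_dim K}. x i = 0"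
    proof
      fix i assume i: "i \<in> {1..2 * s + kernel_dim K}"
      show "x i = 0"
      proof (cases "i \<le> 2 * s")
        case True
        then show ?thesis using low i by simp
      next
        case False
        then show ?thesis
          using i high[of "2*s+1"] high[of "2*s+2"]
          by (cases K) (auto simp: sym_kernel_part_def le_Suc_eq)
      qed
    qed
  next
    assume *: "\<forall>i\<in>{1..2 * s + kernel_dim K}. x i = 0"
    have "S (lc m b x) v = 0" for v
    proof -
      obtain y where "v = lc m b y" using coords_surj[OF b, of v] by auto
      moreover have "pair_sum s x y = 0" using * by (intro pair_sum_zero) auto
      moreover have "sym_kernel_part s K x y = 0"
        using * by (cases K) (simp_all add: sym_kernel_part_def)
      ultimately show ?thesis using form by simp
    qed
    then show "lc m b x \<in> {x. \<forall>y. S x y = 0}" by simp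
  qed
qed

section \<open>Equivalence, types and classes\<close>

lemma general_linear_id: "general_linear (\<lambda>x. x)"
  by (simp add: general_linear_def linear_endo_iff bij_id[unfolded id_def])

lemma general_linear_compose: "general_linear L \<Longrightarrow> general_linear L' \<Longrightarrow> general_linear (\<lambda>x. L (L' x))"
  unfolding general_linear_def linear_endo_iff using bij_comp[of L' L] by (simp add: comp_def)

lemma sym_equiv_refl: "sym_equiv S S"
  unfolding sym_equiv_def by (intro exI[of _ 1] exI[of _ "\<lambda>x. x"]) (simp add: general_linear_id)

lemma quad_equiv_refl: "quad_equiv Q Q"
  unfolding quad_equiv_def by (intro exI[of _ 1] exI[of _ "\<lambda>x. x"]) (simp add: general_linear_id)

text \<open>Ensures that every symmetric form of even rank belongs to some \<open>sym_class\<close>,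
  so that the design conditions reach all forms of the ranks concerned. Parity excludes the square
  kernel.\<close>

lemma sym_even_rank_has_type:
  assumes S: "symmetric_form S" and rank: "sym_rank S = 2 * s"
  shows "\<exists>\<tau>. sym_has_type S \<tau>"
proof (cases "s = 0")
  case True
  then show ?thesis using rank by (auto simp: sym_has_type_def)
next
  case False
  obtain k b s' K where c: "coords UNIV k b" "2 * s' + kernel_dim K \<le> k"
    "\<forall>x y. S (lc k b x) (lc k b y) = pair_sum s' x y + sym_kernel_part s' K x y"
    using sym_normal_form[OF S subspace_UNIV] by blast
  moreover have k: "k = m" using coords_dim[OF c(1)] dim_m by simp
  ultimately have r: "2 * s = 2 * s' + kernel_dim K"
    using sym_rank_normal[OF S] rank by auto
  have basis: "indexed_basis b" using coords_indexed_basis c(1) k by simp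
  have form: "S (lincomb b x) (lincomb b y) = pair_sum s' x y + sym_kernel_part s' K x y" for x y
    using c(3) by (simp add: lincomb_eq k)
  show ?thesis
  proof (cases K)
    case Trivial
    then have "S (lincomb b x) (lincomb b y) = sym_normal s Pos x y" for x y
      using r by (simp add: form sym_normal_def pair_sum_def sym_kernel_part_def)
    then have "sym_has_type S Pos"
      using rank False basis sym_equiv_refl[of S] unfolding sym_has_type_def
      by (intro exI[of _ s]) (simp, blast)
    then show ?thesis ..
  next
    case Square
    then have "2 * s = 2 * s' + 1" using r by simp
    then have False by presburger
    then show ?thesis ..
  next
    case Elliptic
    then have s': "s' = s - 1" "2 * s' + 1 = 2 * s - 1" "2 * s' + 2 = 2 * s" using r by simp_all
    have "S (lincomb b x) (lincomb b y) = sym_normal s Neg x y" for x y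
      using Elliptic unfolding form sym_normal_def pair_sum_def sym_kernel_part_def s'(2,3)
      by (simp only: s'(1) kernel_kind.case form_type.case add.assoc)
    then have "sym_has_type S Neg"
      using rank False basis sym_equiv_refl[of S] unfolding sym_has_type_def
      by (intro exI[of _ s]) (simp, blast)
    then show ?thesis ..
  qed
qed

text \<open>An elliptic form with s hyperbolic pairs has rank \<open>2 * s + 2\<close>, hence the
  shift by one. The zero form receives \<open>Pos\<close>, as the definition of types
  demands.\<close>

fun normal_index :: "nat \<Rightarrow> kernel_kind \<Rightarrow> form_index" where
  "normal_index s Trivial = EvenRank (int s) Pos"
| "normal_index s Square = OddRank (int s)"
| "normal_index s Elliptic = EvenRank (int s + 1) Neg"

lemma quad_normal_Pos: "quad_normal lam s Pos x = normal_sum lam s Trivial (\<lambda>i j. x i * x j)"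
  by (simp add: quad_normal_def normal_sum_def kernel_part_def)

lemma quad_normal_Neg: "quad_normal lam (Suc s) Neg x = normal_sum lam s Elliptic (\<lambda>i j. x i * x j)"
  by (simp add: quad_normal_def normal_sum_def kernel_part_def power2_eq_square add.assoc)

lemma codim_le: "codim U \<le> m"
  by (simp add: codim_def dim_m)

text \<open>For positive even rank the definition of type already contains the normal form. For odd
  rank and for the zero form it comes from the classification, and the rank determines the
  kernel.\<close>

lemma quad_class_normal_form:
  assumes "Q \<in> quad_class lam i"
  obtains Q' b s K where "normal_at Q' b s K" "quad_equiv Q' Q" "i = normal_index s K"
proof (cases i)
  case (OddRank s)
  then have Q: "quadratic_form Q" and r: "int (quad_rank Q) = 2 * s + 1" using assms by (auto simp: quad_class_def)
  obtain b s' K where n: "normal_at Q b s' K" using normal_at_exists[OF Q] .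
  have "quad_rank Q = 2 * s' + kernel_dim K" by (rule quad_rank_normal_at[OF Q n])
  then have *: "2 * int s' + int (kernel_dim K) = 2 * s + 1" using r by simp
  have "K = Square"
  proof (cases K)
    case Trivial
    then have "2 * int s' = 2 * s + 1" using * by simp
    then have False by presburger
    then show ?thesis ..
  next
    case Elliptic
    then have "2 * int s' + 2 = 2 * s + 1" using * by simp
    then have False by presburger
    then show ?thesis ..
  qed
  then show thesis using that[OF n quad_equiv_refl] OddRank * by simp
next
  case (EvenRank s \<tau>)
  then have Q: "quadratic_form Q" and r: "int (quad_rank Q) = 2 * s" and t: "quad_has_type lam Q \<tau>"
    using assms by (auto simp: quad_class_def)
  obtain s' where s': "quad_rank Q = 2 * s'" and
    ty: "if s' = 0 then \<tau> = Pos else \<exists>b Q0. indexed_basis b \<and>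
                (\<forall>x. Q0 (lincomb b x) = quad_normal lam s' \<tau> x) \<and> quad_equiv Q0 Q"
    using t by (auto simp: quad_has_type_def)
  have s: "s = int s'" using r s' by simp
  show thesis
  proof (cases "s' = 0")
    case True
    obtain b s'' K where n: "normal_at Q b s'' K" using normal_at_exists[OF Q] .
    have "2 * s'' + kernel_dim K = 0" using quad_rank_normal_at[OF Q n] s' True by simp
    then have "s'' = 0" "K = Trivial" by (auto, cases K) auto
    then show thesis using that[OF n quad_equiv_refl] EvenRank s True ty by simp
  next
    case False
    then obtain b Q0 where b: "indexed_basis b" "\<And>x. Q0 (lincomb b x) = quad_normal lam s' \<tau> x" "quad_equiv Q0 Q"
      using ty by auto
    have le: "2 * s' \<le> m" using s' codim_le[of "{x. (\<forall>y. polar Q x y = 0) \<and> Q x = 0}"] by (simp add: quad_rank_def)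
    obtain s0 where s0: "s' = Suc s0" using False not0_implies_Suc by blast
    show thesis
    proof (cases \<tau>)
      case Pos
      have "normal_at Q0 b s' Trivial"
        using b(2) le indexed_basis_coords[OF b(1)] by (simp add: normal_at_def Pos quad_normal_Pos lincomb_eq)
      then show thesis using that b(3) EvenRank Pos s by simp
    next
      case Neg
      have "normal_at Q0 b s0 Elliptic"
        using b(2) le indexed_basis_coords[OF b(1)] by (simp add: normal_at_def Neg s0 quad_normal_Neg lincomb_eq)
      then show thesis using that b(3) EvenRank Neg s s0 by simp
    qed
  qed
qed

lemma quad_class_exists:
  assumes Q: "quadratic_form Q"
  shows "\<exists>i. Q \<in> quad_class lam i"
proof -
  obtain b s K where n: "normal_at Q b s K" using normal_at_exists[OF Q] .
  have basis: "indexed_basis b" using n coords_indexed_basis by (simp add: normal_at_def)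
  have form: "Q (lincomb b x) = normal_sum lam s K (\<lambda>i j. x i * x j)" for x
    using n by (simp add: normal_at_def lincomb_eq)
  have r: "quad_rank Q = 2 * s + kernel_dim K" by (rule quad_rank_normal_at[OF Q n])
  have "Q \<in> quad_class lam (normal_index s K)"
  proof (cases K)
    case Trivial
    have "quad_has_type lam Q Pos"
      unfolding quad_has_type_def
      by (intro exI[of _ s]) (use r Trivial basis form quad_equiv_refl[of Q] in \<open>auto simp: quad_normal_Pos\<close>)
    then show ?thesis using Q r Trivial by (simp add: quad_class_def)
  next
    case Square
    then show ?thesis using Q r by (simp add: quad_class_def)
  next
    case Elliptic
    have "quad_has_type lam Q Neg"
      unfolding quad_has_type_def
      by (intro exI[of _ "Suc s"]) (use r Elliptic basis form quad_equiv_refl[of Q] in \<open>auto simp: quad_normal_Neg\<close>)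
    then show ?thesis using Q r Elliptic by (simp add: quad_class_def)
  qed
  then show ?thesis ..
qed

lemma card_zeros_equiv:
  assumes "quad_equiv Q' Q"
  shows "card {x. Q x = 0} = card {x. Q' x = 0}"
proof -
  obtain a L where a: "a \<noteq> 0" and L: "general_linear L" and eq: "\<And>x. Q x = a * Q' (L x)"
    using assms by (auto simp: quad_equiv_def)
  have "bij_betw L {x \<in> UNIV. Q' (L x) = 0} {y \<in> UNIV. Q' y = 0}"
    by (rule bij_betw_Collect_image) (use L in \<open>simp add: general_linear_def\<close>)
  from bij_betw_same_card[OF this] show ?thesis using a by (simp add: eq)
qed

lemma card_zeros_normal_at:
  assumes "normal_at Q b s K"
  shows "card {x. Q x = 0} = zero_count lam s K m"
proof -
  have "bij_betw (lc m b) {x \<in> vecs {1..m}. Q (lc m b x) = 0} {y \<in> UNIV. Q y = 0}"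
    by (rule bij_betw_Collect_image) (use assms in \<open>simp add: normal_at_def coords_def\<close>)
  from bij_betw_same_card[OF this] show ?thesis
    using assms by (simp add: zero_count_def normal_at_def)
qed

text \<open>Equivalent forms have equally many zeros, and the two counts lie strictly on opposite
  sides of \<open>q ^ m\<close> after multiplication by q.\<close>

lemma quad_class_type_unique:
  assumes "Q \<in> quad_class lam (EvenRank s Pos)" "Q \<in> quad_class lam (EvenRank s' Neg)"
  shows False
proof -
  obtain Q' b t K where 1: "normal_at Q' b t K" "quad_equiv Q' Q" "EvenRank s Pos = normal_index t K"
    using quad_class_normal_form[OF assms(1)] .
  have K: "K = Trivial" using 1(3) by (cases K) auto
  obtain Q'' b' t' K' where 2: "normal_at Q'' b' t' K'" "quad_equiv Q'' Q" "EvenRank s' Neg = normal_index t' K'"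
    using quad_class_normal_form[OF assms(2)] .
  have K': "K' = Elliptic" using 2(3) by (cases K') auto
  have "q ^ m < q * card {x. Q x = 0}"
    using 1(1) K card_zeros_equiv[OF 1(2)] card_zeros_normal_at[OF 1(1)] zero_count_Trivial[of t m]
    by (simp add: normal_at_def)
  moreover have "q * card {x. Q x = 0} < q ^ m"
    using 2(1) K' card_zeros_equiv[OF 2(2)] card_zeros_normal_at[OF 2(1)] zero_count_Elliptic[OF lam, of t' m]
    by (simp add: normal_at_def)
  ultimately show False by simp
qed

lemma quad_class_unique:
  assumes "Q \<in> quad_class lam i" "Q \<in> quad_class lam i'"
  shows "i = i'"
proof (cases i; cases i')
  fix s s' assume "i = OddRank s" "i' = OddRank s'"
  then show ?thesis using assms by (auto simp: quad_class_def)
next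
  fix s s' \<tau> assume *: "i = OddRank s" "i' = EvenRank s' \<tau>"
  then have "2 * s + 1 = 2 * s'" using assms by (auto simp: quad_class_def)
  then have False by presburger
    then show ?thesis ..
next
  fix s s' \<tau> assume *: "i = EvenRank s \<tau>" "i' = OddRank s'"
  then have "2 * s' + 1 = 2 * s" using assms by (auto simp: quad_class_def)
  then have False by presburger
    then show ?thesis ..
next
  fix s s' \<tau> \<tau>' assume *: "i = EvenRank s \<tau>" "i' = EvenRank s' \<tau>'"
  then have "s = s'" using assms by (auto simp: quad_class_def)
  moreover have "\<tau> = \<tau>'"
    using quad_class_type_unique[of Q] assms * by (cases \<tau>; cases \<tau>') auto
  ultimately show ?thesis using * by simp
qed

end

section \<open>The pairing\<close>

lemma sum_sum_unit:
  fixes f :: "nat \<Rightarrow> nat \<Rightarrow> 'a::field"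
  assumes "finite I" "a \<in> I" "b \<in> I"
  shows "(\<Sum>i\<in>I. \<Sum>j\<in>I. (if i = a \<and> j = b then c else 0) * f i j) = c * f a b"
proof -
  have "(\<Sum>j\<in>I. (if i = a \<and> j = b then c else 0) * f i j) = (if i = a then c * f a b else 0)" for i
    using assms by (auto simp: if_distrib[of "\<lambda>c. c * _"] cong: if_cong)
  then show ?thesis using assms by simp
qed

lemma sum_swap4:
  "(\<Sum>j\<in>J. \<Sum>l\<in>J. \<Sum>i\<in>J. \<Sum>k\<in>J. f i k j l) =
    (\<Sum>i\<in>J. \<Sum>k\<in>J. \<Sum>j\<in>J. \<Sum>l\<in>J. f i k j (l :: nat) :: 'a::comm_monoid_add)"
proof -
  have "(\<Sum>j\<in>J. \<Sum>l\<in>J. \<Sum>i\<in>J. \<Sum>k\<in>J. f i k j l) = (\<Sum>j\<in>J. \<Sum>i\<in>J. \<Sum>k\<in>J. \<Sum>l\<in>J. f i k j l)"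
  proof (rule sum.cong[OF refl])
    fix j
    have "(\<Sum>l\<in>J. \<Sum>i\<in>J. \<Sum>k\<in>J. f i k j l) = (\<Sum>i\<in>J. \<Sum>l\<in>J. \<Sum>k\<in>J. f i k j l)" by (rule sum.swap)
    also have "\<dots> = (\<Sum>i\<in>J. \<Sum>k\<in>J. \<Sum>l\<in>J. f i k j l)"
      by (rule sum.cong[OF refl]) (rule sum.swap)
    finally show "(\<Sum>l\<in>J. \<Sum>i\<in>J. \<Sum>k\<in>J. f i k j l) = (\<Sum>i\<in>J. \<Sum>k\<in>J. \<Sum>l\<in>J. f i k j l)" .
  qed
  also have "\<dots> = (\<Sum>i\<in>J. \<Sum>j\<in>J. \<Sum>k\<in>J. \<Sum>l\<in>J. f i k j l)" by (rule sum.swap)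
  also have "\<dots> = (\<Sum>i\<in>J. \<Sum>k\<in>J. \<Sum>j\<in>J. \<Sum>l\<in>J. f i k j l)"
    by (rule sum.cong[OF refl]) (rule sum.swap)
  finally show ?thesis .
qed

context even_form_space
begin

section \<open>Coefficient matrices and the pairing\<close>

definition represents :: "(nat \<Rightarrow> nat \<Rightarrow> 'a) \<Rightarrow> ('v \<Rightarrow> 'a) \<Rightarrow> bool" where
  "represents A Q \<longleftrightarrow> (\<forall>x. Q (lc m u x) = (\<Sum>i=1..m. \<Sum>j=1..m. A i j * x i * x j))"

lemma lc_Suc: "lc (Suc k) b x = lc k b x + scale (x (Suc k)) (b (Suc k))"
  by (simp add: lc_def)

lemma bilinear_sum_right:
  assumes "bilinear_form B"
  shows "B v (lc k b y) = (\<Sum>j=1..k. y j * B v (b j))"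
proof (induction k)
  case 0
  then show ?case by (simp add: lc_def bilinear_zero[OF assms])
next
  case (Suc k)
  then show ?case by (simp add: lc_Suc bilinear_simps[OF assms])
qed

lemma bilinear_sum_left:
  assumes "bilinear_form B"
  shows "B (lc k b x) v = (\<Sum>i=1..k. x i * B (b i) v)"
proof (induction k)
  case 0
  then show ?case by (simp add: lc_def bilinear_zero[OF assms])
next
  case (Suc k)
  then show ?case by (simp add: lc_Suc bilinear_simps[OF assms])
qed

lemma represents_exists:
  assumes Q: "quadratic_form Q"
  obtains A where "represents A Q"
proof -
  \<comment> \<open>Triangular, since in characteristic two a cross term cannot be divided into two
    equal halves.\<close>
  define A where "A = (\<lambda>i j. if i = j then Q (u i) else if j < i then polar Q (u i) (u j) else 0)"
  have "Q (lc k u x) = (\<Sum>i=1..k. \<Sum>j=1..k. A i j * x i * x j)" for k x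
  proof (induction k)
    case 0
    then show ?case by (simp add: lc_def quad_zero[OF Q])
  next
    case (Suc k)
    have 1: "(\<Sum>i=1..k. A i (Suc k) * x i * x (Suc k)) = 0"
      by (rule sum.neutral) (auto simp: A_def)
    have "polar Q (lc k u x) (scale (x (Suc k)) (u (Suc k))) = x (Suc k) * polar Q (u (Suc k)) (lc k u x)"
      by (simp add: bilinear_simps[OF quad_polar[OF Q]] polar_commute[of Q "lc k u x"])
    also have "\<dots> = (\<Sum>j=1..k. A (Suc k) j * x (Suc k) * x j)"
      unfolding bilinear_sum_right[OF quad_polar[OF Q]] sum_distrib_left
      by (rule sum.cong[OF refl]) (auto simp: A_def)
    finally have 2: "polar Q (lc k u x) (scale (x (Suc k)) (u (Suc k))) = (\<Sum>j=1..k. A (Suc k) j * x (Suc k) * x j)" .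
    have 3: "Q (scale (x (Suc k)) (u (Suc k))) = A (Suc k) (Suc k) * x (Suc k) * x (Suc k)"
      by (simp add: quad_scale[OF Q] A_def power2_eq_square mult_ac)
    have "(\<Sum>i=1..Suc k. \<Sum>j=1..Suc k. A i j * x i * x j) =
      (\<Sum>i=1..k. \<Sum>j=1..k. A i j * x i * x j) + (\<Sum>i=1..k. A i (Suc k) * x i * x (Suc k)) +
      ((\<Sum>j=1..k. A (Suc k) j * x (Suc k) * x j) + A (Suc k) (Suc k) * x (Suc k) * x (Suc k))"
      by (simp add: sum.distrib)
    then show ?case unfolding lc_Suc quad_add[of Q] Suc 1 2 3 by simp
  qed
  then have "represents A Q" by (simp add: represents_def)
  then show thesis by (rule that)
qed

definition trace_pair :: "(nat \<Rightarrow> nat \<Rightarrow> 'a) \<Rightarrow> (nat \<Rightarrow> 'v) \<Rightarrow> ('v \<Rightarrow> 'v \<Rightarrow> 'a) \<Rightarrow> 'a" where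
  "trace_pair A w S = (\<Sum>i=1..m. \<Sum>j=1..m. A i j * S (w j) (w i))"

text \<open>The difference D of two coefficient matrices represents the zero form. Evaluation at 0/1
  vectors supported on one or two indices shows that D is symmetric with zero diagonal. So is its
  entrywise product with the Gram matrix of S, whose entries therefore sum to 0.\<close>

lemma represents_unique:
  assumes "represents A Q" "represents A' Q" and S: "symmetric_form S"
  shows "trace_pair A w S = trace_pair A' w S"
proof -
  define D where "D = (\<lambda>i j. A i j - A' i j)"
  have D0: "(\<Sum>i=1..m. \<Sum>j=1..m. D i j * x i * x j) = 0" for x
    using assms(1,2) by (simp add: represents_def D_def algebra_simps sum_subtractf)
  have DJ: "(\<Sum>i\<in>J. \<Sum>j\<in>J. D i j) = 0" if J: "J \<subseteq> {1..m}" for J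
  proof -
    have "(\<Sum>i=1..m. \<Sum>j=1..m. D i j * (if i \<in> J then 1 else 0) * (if j \<in> J then 1 else 0)) =
      (\<Sum>i=1..m. if i \<in> J then \<Sum>j=1..m. if j \<in> J then D i j else 0 else 0)"
      by (intro sum.cong refl) (auto intro!: sum.cong)
    also have "\<dots> = (\<Sum>i\<in>J. \<Sum>j\<in>J. D i j)"
      using J by (simp add: sum.inter_restrict[symmetric] Int_absorb1 flip: sum.inter_restrict)
    finally show ?thesis using D0[of "\<lambda>i. if i \<in> J then 1 else 0"] by simp
  qed
  have diag: "D i i = 0" if "i \<in> {1..m}" for i using DJ[of "{i}"] that by simp
  have sym: "D i j = D j i" if "i \<in> {1..m}" "j \<in> {1..m}" for i j
  proof (cases "i = j")
    case False
    then have "D i j + D j i = 0" using DJ[of "{i, j}"] diag that by simp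
    then show ?thesis by (simp add: add_eq_0_iff_eq)
  qed simp
  have "(\<Sum>i=1..m. \<Sum>j=1..m. (D i j * S (w j) (w i)) * (1 * 1)) = 0"
    by (rule alternating_sum_eq_0) (use diag sym symmetric_commute[OF S] in auto)
  then have "trace_pair A w S - trace_pair A' w S = 0"
    by (simp add: trace_pair_def D_def algebra_simps sum_subtractf)
  then show ?thesis by simp
qed

definition rpair :: "(nat \<Rightarrow> 'v) \<Rightarrow> ('v \<Rightarrow> 'a) \<Rightarrow> ('v \<Rightarrow> 'v \<Rightarrow> 'a) \<Rightarrow> real" where
  "rpair w Q S = \<chi> (trace_pair (coeff_matrix u Q) w S)"

lemma pairing_eq: "pairing (\<lambda>x. complex_of_real (\<chi> x)) u w Q S = complex_of_real (rpair w Q S)"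
  by (simp add: pairing_def rpair_def trace_pair_def gram_matrix_def dim_m)

lemma rpair_eq:
  assumes "represents A Q" "symmetric_form S"
  shows "rpair w Q S = \<chi> (trace_pair A w S)"
proof -
  have "\<exists>A. \<forall>x. Q (lc m u x) = (\<Sum>i=1..m. \<Sum>j=1..m. A i j * x i * x j)"
    using assms(1) unfolding represents_def by blast
  from someI_ex[OF this] have "represents (coeff_matrix u Q) Q"
    unfolding coeff_matrix_def lincomb_eq dim_m represents_def .
  then show ?thesis unfolding rpair_def using represents_unique[OF _ assms] by simp
qed

lemma chi_diff: "\<chi> (x - y) = \<chi> x * \<chi> y"
  by (simp add: minus_eq chi_add)

lemma rpair_diff:
  assumes Q: "quadratic_form Q" "quadratic_form Q'" and S: "symmetric_form S"
  shows "rpair w (\<lambda>x. Q x - Q' x) S = rpair w Q S * rpair w Q' S"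
proof -
  obtain A where A: "represents A Q" using represents_exists[OF Q(1)] .
  obtain A' where A': "represents A' Q'" using represents_exists[OF Q(2)] .
  have "represents (\<lambda>i j. A i j - A' i j) (\<lambda>x. Q x - Q' x)"
    using A A' by (simp add: represents_def algebra_simps sum_subtractf)
  moreover have "trace_pair (\<lambda>i j. A i j - A' i j) w S = trace_pair A w S - trace_pair A' w S"
    by (simp add: trace_pair_def algebra_simps sum_subtractf)
  ultimately show ?thesis using S A A' by (simp add: rpair_eq chi_diff)
qed

section \<open>Change of basis and the adjoint for the pairing\<close>

definition coord :: "(nat \<Rightarrow> 'v) \<Rightarrow> 'v \<Rightarrow> nat \<Rightarrow> 'a" where
  "coord b v = inv_into (vecs {1..m}) (lc m b) v"

lemma coord_in: "coords UNIV m b \<Longrightarrow> coord b v \<in> vecs {1..m}"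
  and lc_coord: "coords UNIV m b \<Longrightarrow> lc m b (coord b v) = v"
  unfolding coord_def coords_def bij_betw_def
  using inv_into_into[of v "lc m b" "vecs {1..m}"] f_inv_into_f[of v "lc m b" "vecs {1..m}"] by auto

lemma coord_lc: "coords UNIV m b \<Longrightarrow> i \<in> {1..m} \<Longrightarrow> coord b (lc m b x) i = x i"
  using coords_inj[of UNIV m b "coord b (lc m b x)" x i] lc_coord by blast

lemma coord_lc_eq: "coords UNIV m b \<Longrightarrow> x \<in> vecs {1..m} \<Longrightarrow> coord b (lc m b x) = x"
  unfolding coord_def coords_def bij_betw_def by auto

lemma coord_add:
  assumes b: "coords UNIV m b"
  shows "coord b (v + v') = (\<lambda>i. coord b v i + coord b v' i)"
  using coord_lc_eq[OF b vecs_add[OF coord_in[OF b, of v] coord_in[OF b, of v']]]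
  by (simp add: lc_add lc_coord[OF b])

lemma coord_scale:
  assumes b: "coords UNIV m b"
  shows "coord b (scale c v) = (\<lambda>i. c * coord b v i)"
  using coord_lc_eq[OF b vecs_scale[OF coord_in[OF b, of v], of c]]
  by (simp add: lc_scale lc_coord[OF b])

lemma general_linear_change_basis:
  assumes b: "coords UNIV m b" and c: "coords UNIV m c"
  shows "general_linear (\<lambda>v. lc m c (coord b v))"
  unfolding general_linear_def linear_endo_iff
proof (intro conjI allI)
  have "bij_betw (coord b) UNIV (vecs {1..m})"
    using b unfolding coord_def[abs_def] coords_def by (rule bij_betw_inv_into)
  from bij_betw_trans[OF this] c show "bij (\<lambda>v. lc m c (coord b v))"
    by (simp add: coords_def comp_def)
qed (simp_all add: coord_add[OF b] coord_scale[OF b] lc_add lc_scale)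

lemma general_linear_lc: "general_linear L \<Longrightarrow> L (lc k b x) = lc k (\<lambda>i. L (b i)) x"
proof (induction k)
  case 0
  then have "L 0 = L 0 + L 0" unfolding general_linear_def linear_endo_iff by (metis add_0)
  then show ?case by (simp add: lc_def)
next
  case (Suc k)
  then show ?case unfolding lc_Suc by (simp add: general_linear_def linear_endo_iff)
qed

lemma lc_sum: "lc k b (\<lambda>i. \<Sum>j\<in>J. f j i) = (\<Sum>j\<in>J. lc k b (f j))"
  unfolding lc_def scale_sum_left by (rule sum.swap)

text \<open>The adjoint of \<open>L\<close> for the pairing has, with respect to \<open>w\<close>, the transpose of the matrix
  of \<open>L\<close> with respect to \<open>u\<close>.\<close>

lemma adjoint_exists:
  assumes w: "coords UNIV m w" and L: "general_linear L" and a: "a \<noteq> 0"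
  obtains L' where "general_linear L'"
    "\<forall>Q S. quadratic_form Q \<longrightarrow> symmetric_form S \<longrightarrow> symmetric_form (\<lambda>x y. a * S (L' x) (L' y)) \<longrightarrow>
      rpair w (\<lambda>x. a * Q (L x)) S = rpair w Q (\<lambda>x y. a * S (L' x) (L' y))"
proof -
  define P where "P = (\<lambda>i j. coord u (L (u j)) i)"
  have Lu: "L (lc m u x) = lc m u (\<lambda>i. \<Sum>j=1..m. P i j * x j)" for x
  proof -
    have "L (lc m u x) = (\<Sum>j=1..m. scale (x j) (L (u j)))"
      using general_linear_lc[OF L, of m u x] by (simp only: lc_def)
    also have "\<dots> = (\<Sum>j=1..m. lc m u (\<lambda>i. P i j * x j))"
    proof (rule sum.cong[OF refl])
      fix j
      have "scale (x j) (L (u j)) = scale (x j) (lc m u (coord u (L (u j))))"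
        by (simp add: lc_coord[OF coords_u])
      then show "scale (x j) (L (u j)) = lc m u (\<lambda>i. P i j * x j)"
        by (simp add: P_def mult.commute flip: lc_scale)
    qed
    finally show ?thesis by (simp add: lc_sum)
  qed
  define L' where "L' = (\<lambda>v. lc m (\<lambda>k. lc m w (\<lambda>l. P k l)) (coord w v))"
  have L'w: "L' (lc m w c) = lc m w (\<lambda>l. \<Sum>k=1..m. c k * P k l)" for c
  proof -
    have "L' (lc m w c) = (\<Sum>k=1..m. scale (c k) (lc m w (\<lambda>l. P k l)))"
      unfolding L'_def lc_def[of m "\<lambda>k. lc m w (\<lambda>l. P k l)"]
      by (rule sum.cong[OF refl]) (simp only: coord_lc[OF w])
    then show ?thesis by (simp add: lc_sum flip: lc_scale)
  qed
  have unit: "lc m b (\<lambda>j. if j = k then 1 else 0) = b k" if "k \<in> {1..m}" for b k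
    using that by (simp add: lc_def if_distrib[of "\<lambda>c. scale c _"] cong: if_cong)
  have L'wk: "L' (w k) = lc m w (\<lambda>l. P k l)" if "k \<in> {1..m}" for k
  proof -
    have "L' (w k) = lc m w (\<lambda>l. \<Sum>k'=1..m. (if k' = k then 1 else 0) * P k' l)"
      using L'w[of "\<lambda>j. if j = k then 1 else 0"] unit[OF that, of w] by simp
    also have "(\<lambda>l. \<Sum>k'=1..m. (if k' = k then 1 else 0) * P k' l) = (\<lambda>l. P k l)"
      using that by (simp add: if_distrib[of "\<lambda>c. c * _"] cong: if_cong)
    finally show ?thesis .
  qed
  have lin: "L' (x + y) = L' x + L' y" "L' (scale c x) = scale c (L' x)" for x y c
    by (simp_all add: L'_def coord_add[OF w] coord_scale[OF w] lc_add lc_scale)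
  have "inj L'"
  proof (rule injI)
    fix v v' assume "L' v = L' v'"
    define c where "c = (\<lambda>i. coord w v i + coord w v' i)"
    have "L' (v + v') = L' v + L' v" using \<open>L' v = L' v'\<close> by (simp add: lin)
    then have "L' (lc m w c) = 0" by (simp add: c_def lc_add lc_coord[OF w] add_self_V)
    then have "lc m w (\<lambda>l. \<Sum>k=1..m. c k * P k l) = lc m w (\<lambda>_. 0)"
      unfolding L'w by (simp add: lc_def)
    from coords_inj[OF w this] have cP: "(\<Sum>k=1..m. c k * P k l) = 0" if "l \<in> {1..m}" for l
      using that by simp
    have "c i = 0" if i: "i \<in> {1..m}" for i
    proof -
      \<comment> \<open>L being onto, some z has \<open>P z\<close> equal to the i-th unit vector.
        Then \<open>c i\<close> is \<open>(c P) z\<close>, which is 0 because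
        \<open>c P = 0\<close>; so the transpose is injective.\<close>
      obtain y where y: "L y = u i" using L unfolding general_linear_def by (metis bij_pointE)
      define z where "z = coord u y"
      have "lc m u (\<lambda>k. \<Sum>l=1..m. P k l * z l) = lc m u (\<lambda>k. if k = i then 1 else 0)"
        using Lu[of z] y by (simp add: z_def lc_coord[OF coords_u] unit[OF i])
      from coords_inj[OF coords_u this]
      have Pz: "(\<Sum>l=1..m. P k l * z l) = (if k = i then 1 else 0)" if "k \<in> {1..m}" for k
        using that by simp
      have "c i = (\<Sum>k=1..m. c k * (if k = i then 1 else 0))"
        using i by (simp add: if_distrib[of "\<lambda>c. _ * c"] cong: if_cong)
      also have "\<dots> = (\<Sum>k=1..m. c k * (\<Sum>l=1..m. P k l * z l))"
        by (rule sum.cong[OF refl]) (simp only: Pz)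
      also have "\<dots> = (\<Sum>k=1..m. \<Sum>l=1..m. c k * P k l * z l)"
        by (simp add: sum_distrib_left mult.assoc)
      also have "\<dots> = (\<Sum>l=1..m. \<Sum>k=1..m. c k * P k l * z l)" by (rule sum.swap)
      also have "\<dots> = (\<Sum>l=1..m. (\<Sum>k=1..m. c k * P k l) * z l)" by (simp add: sum_distrib_right)
      also have "\<dots> = 0" by (intro sum.neutral ballI) (simp only: cP mult_zero_left)
      finally show ?thesis .
    qed
    then have "coord w v i = coord w v' i" if "i \<in> {1..m}" for i
      using that by (simp add: c_def add_eq_0_iff_eq)
    then have "lc m w (coord w v) = lc m w (coord w v')" by (intro lc_cong) auto
    then show "v = v'" by (simp add: lc_coord[OF w])
  qed
  then have "general_linear L'"
    using lin by (simp add: general_linear_def linear_endo_iff bij_def finite_UNIV_inj_surj[OF finite_V])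
  moreover have "rpair w (\<lambda>x. a * Q (L x)) S = rpair w Q (\<lambda>x y. a * S (L' x) (L' y))"
    if Q: "quadratic_form Q" and S: "symmetric_form S" and S': "symmetric_form (\<lambda>x y. a * S (L' x) (L' y))" for Q S
  proof -
    obtain A where A: "represents A Q" using represents_exists[OF Q] .
    \<comment> \<open>This is a times the product of P transposed, A and P, the coefficient matrix
      of \<open>a * Q (L x)\<close>.\<close>
    define A' where "A' = (\<lambda>j l. a * (\<Sum>i=1..m. \<Sum>k=1..m. A i k * P i j * P k l))"
    have 4: "(\<Sum>j=1..m. \<Sum>l=1..m. A' j l * f j l) =
        (\<Sum>i=1..m. \<Sum>k=1..m. A i k * (a * (\<Sum>j=1..m. \<Sum>l=1..m. P i j * P k l * f j l)))" for f
    proof -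
      have "(\<Sum>j=1..m. \<Sum>l=1..m. A' j l * f j l) =
        (\<Sum>j=1..m. \<Sum>l=1..m. \<Sum>i=1..m. \<Sum>k=1..m. A i k * (a * (P i j * P k l * f j l)))"
        by (simp add: A'_def sum_distrib_left sum_distrib_right mult_ac)
      also have "\<dots> = (\<Sum>i=1..m. \<Sum>k=1..m. \<Sum>j=1..m. \<Sum>l=1..m. A i k * (a * (P i j * P k l * f j l)))"
        by (rule sum_swap4)
      also have "\<dots> = (\<Sum>i=1..m. \<Sum>k=1..m. A i k * (a * (\<Sum>j=1..m. \<Sum>l=1..m. P i j * P k l * f j l)))"
        by (simp add: sum_distrib_left)
      finally show ?thesis .
    qed
    have "represents A' (\<lambda>x. a * Q (L x))"
      unfolding represents_def
    proof
      fix x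
      have "a * Q (L (lc m u x)) = a * (\<Sum>i=1..m. \<Sum>k=1..m. A i k * (\<Sum>j=1..m. P i j * x j) * (\<Sum>l=1..m. P k l * x l))"
        using A by (simp add: Lu represents_def)
      also have "\<dots> = (\<Sum>i=1..m. \<Sum>k=1..m. A i k * (a * (\<Sum>j=1..m. \<Sum>l=1..m. P i j * P k l * (x j * x l))))"
        unfolding sum_distrib_left[of a]
        by (intro sum.cong refl) (simp add: sum_product mult_ac sum_distrib_left)
      also have "\<dots> = (\<Sum>j=1..m. \<Sum>l=1..m. A' j l * x j * x l)"
        unfolding 4[symmetric] by (simp add: mult.assoc)
      finally show "a * Q (L (lc m u x)) = (\<Sum>j=1..m. \<Sum>l=1..m. A' j l * x j * x l)" .
    qed
    then have "rpair w (\<lambda>x. a * Q (L x)) S = \<chi> (trace_pair A' w S)"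
      by (rule rpair_eq[OF _ S])
    also have "trace_pair A' w S = (\<Sum>i=1..m. \<Sum>k=1..m. A i k * (a * (\<Sum>j=1..m. \<Sum>l=1..m. P i j * P k l * S (w l) (w j))))"
      unfolding trace_pair_def 4 ..
    also have "\<dots> = trace_pair A w (\<lambda>x y. a * S (L' x) (L' y))"
      unfolding trace_pair_def
    proof (intro sum.cong refl arg_cong2[where f = "(*)"])
      fix i k assume ik: "i \<in> {1..m}" "k \<in> {1..m}"
      note bil = symmetric_bilinear[OF S]
      have "S (L' (w k)) (L' (w i)) = (\<Sum>j=1..m. P i j * (\<Sum>l=1..m. P k l * S (w l) (w j)))"
        unfolding L'wk[OF ik(1)] L'wk[OF ik(2)] bilinear_sum_right[OF bil] bilinear_sum_left[OF bil] ..
      also have "\<dots> = (\<Sum>j=1..m. \<Sum>l=1..m. P i j * P k l * S (w l) (w j))"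
        by (simp add: sum_distrib_left mult.assoc)
      finally show "(\<Sum>j=1..m. \<Sum>l=1..m. P i j * P k l * S (w l) (w j)) = S (L' (w k)) (L' (w i))" by simp
    qed
    finally show ?thesis by (simp add: rpair_eq[OF A S'])
  qed
  ultimately show thesis using that by blast
qed

lemma finite_quads [simp]: "finite (A :: ('v \<Rightarrow> 'a) set)"
proof -
  have "finite (PiE (UNIV :: 'v set) (\<lambda>_. UNIV :: 'a set))" by (rule finite_PiE) auto
  then show ?thesis by (auto intro: rev_finite_subset)
qed

lemma finite_syms [simp]: "finite (A :: ('v \<Rightarrow> 'v \<Rightarrow> 'a) set)"
proof -
  have "finite (PiE (UNIV :: 'v set) (\<lambda>_. UNIV :: ('v \<Rightarrow> 'a) set))" by (rule finite_PiE) auto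
  then show ?thesis by (auto intro: rev_finite_subset)
qed

section \<open>Sums over sets of forms closed under equivalence\<close>

definition invariant_class :: "('v \<Rightarrow> 'v \<Rightarrow> 'a) set \<Rightarrow> bool" where
  "invariant_class C \<longleftrightarrow> (\<forall>S\<in>C. symmetric_form S \<and>
     (\<forall>a L. a \<noteq> 0 \<longrightarrow> general_linear L \<longrightarrow> (\<lambda>x y. a * S (L x) (L y)) \<in> C))"

text \<open>The adjoint moves the substitution from Q to S, where it permutes C, being injective on
  a finite set. For \<open>sym_class\<close> this gives independence of the representative in
  \<open>Q_number\<close>; for \<open>sym_forms\<close> it allows Q to be put in normal
  form.\<close>

lemma sum_rpair_equiv:
  assumes w: "coords UNIV m w" and C: "invariant_class C"
    and h: "\<And>S a L. S \<in> C \<Longrightarrow> a \<noteq> 0 \<Longrightarrow> general_linear L \<Longrightarrow> h (\<lambda>x y. a * S (L x) (L y)) = h S"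
    and Q: "quadratic_form Q" and eq: "quad_equiv Q Q'"
  shows "(\<Sum>S\<in>C. h S * rpair w Q' S) = (\<Sum>S\<in>C. (h S :: real) * rpair w Q S)"
proof -
  obtain a L where a: "a \<noteq> 0" and L: "general_linear L" and Q': "Q' = (\<lambda>x. a * Q (L x))"
    using eq by (auto simp: quad_equiv_def)
  obtain L' where L': "general_linear L'" and
    adj: "\<forall>Q S. quadratic_form Q \<longrightarrow> symmetric_form S \<longrightarrow> symmetric_form (\<lambda>x y. a * S (L' x) (L' y)) \<longrightarrow>
      rpair w (\<lambda>x. a * Q (L x)) S = rpair w Q (\<lambda>x y. a * S (L' x) (L' y))"
    using adjoint_exists[OF w L a] .
  let ?t = "\<lambda>S x y. a * S (L' x) (L' y)"
  have mem: "?t S \<in> C" if "S \<in> C" for S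
    using C that a L' by (simp add: invariant_class_def)
  have sf: "symmetric_form S" if "S \<in> C" for S using C that by (simp add: invariant_class_def)
  have "inj_on ?t C"
  proof (rule inj_onI)
    fix S T assume eq: "?t S = ?t T"
    have "S x y = T x y" for x y
    proof -
      obtain x' y' where "x = L' x'" "y = L' y'"
        using L' unfolding general_linear_def by (metis bij_pointE)
      moreover have "a * S (L' x') (L' y') = a * T (L' x') (L' y')"
        using fun_cong[OF fun_cong[OF eq], of x' y'] .
      ultimately show ?thesis using a by simp
    qed
    then show "S = T" by blast
  qed
  then have bij: "bij_betw ?t C C"
    unfolding bij_betw_def using mem by (intro conjI endo_inj_surj) auto
  have "(\<Sum>S\<in>C. h S * rpair w Q' S) = (\<Sum>S\<in>C. h (?t S) * rpair w Q (?t S))"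
  proof (rule sum.cong[OF refl])
    fix S assume S: "S \<in> C"
    have "rpair w Q' S = rpair w Q (?t S)" unfolding Q' using adj Q sf[OF S] sf[OF mem[OF S]] by blast
    then show "h S * rpair w Q' S = h (?t S) * rpair w Q (?t S)" using h[OF S a L'] by simp
  qed
  also have "\<dots> = (\<Sum>S\<in>C. h S * rpair w Q S)" by (rule sum.reindex_bij_betw[OF bij])
  finally show ?thesis .
qed

lemma symmetric_transform:
  assumes S: "symmetric_form S" and L: "general_linear L"
  shows "symmetric_form (\<lambda>x y. a * S (L x) (L y))"
  using S L unfolding symmetric_form_def bilinear_iff general_linear_def linear_endo_iff
  by (simp add: algebra_simps) 

lemma sym_rank_transform:
  assumes S: "symmetric_form S" and L: "general_linear L" and a: "a \<noteq> 0"
  shows "sym_rank (\<lambda>x y. a * S (L x) (L y)) = sym_rank S"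
proof -
  let ?R = "{x. \<forall>y. S x y = 0}" and ?R' = "{x. \<forall>y. a * S (L x) (L y) = 0}"
  have bij: "bij L" using L by (simp add: general_linear_def)
  have "?R' = {x \<in> UNIV. L x \<in> ?R}" using a bij by (auto, metis bij_pointE)
  moreover have "bij_betw L {x \<in> UNIV. L x \<in> ?R} {y \<in> UNIV. y \<in> ?R}"
    by (rule bij_betw_Collect_image) (use bij in simp)
  ultimately have "card ?R' = card ?R" using bij_betw_same_card by fastforce
  then have "dim ?R' = dim ?R"
    using card_subspace[OF subspace_sym_radical[OF S]] card_subspace[OF subspace_sym_radical[OF symmetric_transform[OF S L, of a]]]
    by simp
  then show ?thesis by (simp add: sym_rank_def codim_def)
qed

lemma sym_has_type_transform:
  assumes S: "symmetric_form S" and L: "general_linear L" and a: "a \<noteq> 0" and t: "sym_has_type S \<tau>"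
  shows "sym_has_type (\<lambda>x y. a * S (L x) (L y)) \<tau>"
proof -
  have "sym_equiv S0 (\<lambda>x y. a * S (L x) (L y))" if "sym_equiv S0 S" for S0
  proof -
    obtain c M where "c \<noteq> 0" "general_linear M" "\<And>x y. S x y = c * S0 (M x) (M y)"
      using \<open>sym_equiv S0 S\<close> by (auto simp: sym_equiv_def)
    then show ?thesis
      unfolding sym_equiv_def using a general_linear_compose[of M L] L
      by (intro exI[of _ "a * c"] exI[of _ "\<lambda>x. M (L x)"]) (simp add: mult.assoc)
  qed
  then show ?thesis
    using t unfolding sym_has_type_def sym_rank_transform[OF S L a] by (metis (no_types, lifting))
qed

lemma invariant_sym_class: "invariant_class (sym_class k)"
  unfolding invariant_class_def sym_class_def
  by (auto split: form_index.split simp: symmetric_transform sym_rank_transform sym_has_type_transform)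

definition sym_forms :: "'a set \<Rightarrow> ('v \<Rightarrow> 'v \<Rightarrow> 'a) set" where
  "sym_forms D = {S. symmetric_form S \<and> (\<forall>x. S x x \<in> D)}"

lemma invariant_sym_forms: "D = UNIV \<or> D = {0} \<Longrightarrow> invariant_class (sym_forms D)"
  unfolding invariant_class_def sym_forms_def by (auto simp: symmetric_transform)

section \<open>Gram matrices\<close>

definition gram :: "(nat \<Rightarrow> 'v) \<Rightarrow> ('v \<Rightarrow> 'v \<Rightarrow> 'a) \<Rightarrow> nat \<Rightarrow> nat \<Rightarrow> 'a" where
  "gram w S = (\<lambda>i j. if i \<in> {1..m} \<and> j \<in> {1..m} then S (w i) (w j) else 0)"

lemma form_eq_gram:
  assumes S: "symmetric_form S"
  shows "S (lc m w x) (lc m w y) = dot {1..m} x (app {1..m} (gram w S) y)"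
proof -
  note bil = symmetric_bilinear[OF S]
  show ?thesis
    unfolding bilinear_sum_left[OF bil] dot_def app_def
  proof (intro sum.cong refl arg_cong2[where f = "(*)"])
    fix i assume i: "i \<in> {1..m}"
    show "S (w i) (lc m w y) = (\<Sum>j=1..m. gram w S i j * y j)"
      unfolding bilinear_sum_right[OF bil]
      by (intro sum.cong refl) (use i in \<open>simp add: gram_def mult.commute\<close>)
  qed
qed

text \<open>The condition on the diagonal may be imposed on basis vectors alone: a symmetric form
  with zero Gram diagonal is alternating everywhere by \<open>alternating_dot_app\<close>.\<close>

lemma bij_gram:
  assumes D: "D = UNIV \<or> D = {0}" and w: "coords UNIV m w"
  shows "bij_betw (gram w) (sym_forms D) (symm_mats D {1..m})"
proof (rule bij_betwI[where g = "\<lambda>T x y. dot {1..m} (coord w x) (app {1..m} T (coord w y))"])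
  show "gram w \<in> sym_forms D \<rightarrow> symm_mats D {1..m}"
    using symmetric_commute by (auto simp: sym_forms_def symm_mats_def gram_def)
  show "(\<lambda>T x y. dot {1..m} (coord w x) (app {1..m} T (coord w y))) \<in> symm_mats D {1..m} \<rightarrow> sym_forms D"
  proof
    fix T assume T: "T \<in> symm_mats D {1..m}"
    have "symmetric_form (\<lambda>x y. dot {1..m} (coord w x) (app {1..m} T (coord w y)))"
      unfolding symmetric_form_def bilinear_iff
    proof (intro conjI allI)
      fix x y
      show "dot {1..m} (coord w x) (app {1..m} T (coord w y)) = dot {1..m} (coord w y) (app {1..m} T (coord w x))"
        using dot_app[OF T, of "coord w x" "coord w y"] by (simp only: dot_commute)
    qed (simp_all only: coord_add[OF w] coord_scale[OF w] app_add app_scale dot_add_left dot_add_right dot_scale_left dot_scale_right)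
    moreover have "dot {1..m} (coord w x) (app {1..m} T (coord w x)) \<in> D" for x
      using D alternating_dot_app[of "{1..m}" T] T by auto
    ultimately show "(\<lambda>x y. dot {1..m} (coord w x) (app {1..m} T (coord w y))) \<in> sym_forms D"
      by (simp add: sym_forms_def)
  qed
next
  fix S assume "S \<in> sym_forms D"
  then have S: "symmetric_form S" by (simp add: sym_forms_def)
  show "(\<lambda>x y. dot {1..m} (coord w x) (app {1..m} (gram w S) (coord w y))) = S"
    unfolding form_eq_gram[OF S, symmetric] by (simp add: lc_coord[OF w])
next
  fix T assume T: "T \<in> symm_mats D {1..m}"
  show "gram w (\<lambda>x y. dot {1..m} (coord w x) (app {1..m} T (coord w y))) = T"
  proof (intro ext)
    fix i j
    have unit: "coord w (w k) = (\<lambda>l. if l = k then 1 else 0)" if "k \<in> {1..m}" for k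
    proof -
      have "lc m w (\<lambda>l. if l = k then 1 else 0) = w k"
        using that by (simp add: lc_def if_distrib[of "\<lambda>c. scale c _"] cong: if_cong)
      moreover have "(\<lambda>l. if l = k then 1 else 0) \<in> vecs {1..m}" using that by (auto simp: vecs_def)
      ultimately show ?thesis using coord_lc_eq[OF w] by metis
    qed
    show "gram w (\<lambda>x y. dot {1..m} (coord w x) (app {1..m} T (coord w y))) i j = T i j"
    proof (cases "i \<in> {1..m} \<and> j \<in> {1..m}")
      case True
      then show ?thesis
        using unit[of i] unit[of j]
        by (simp add: gram_def dot_def app_def if_distrib[of "\<lambda>c. _ * c"] if_distrib[of "\<lambda>c. c * _"] cong: if_cong)
    next
      case False
      have "T j i = T i j" using T by (simp add: symm_mats_def)
      then show ?thesis using T False by (auto simp: gram_def symm_mats_def)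
    qed
  qed
qed

lemma sym_rank_gram:
  assumes S: "symmetric_form S" and w: "coords UNIV m w"
  shows "sym_rank S = rk {1..m} (gram w S)"
proof -
  have G: "gram w S \<in> symm_mats UNIV {1..m}"
    using bij_betw_apply[OF bij_gram[of UNIV w]] S w by (simp add: sym_forms_def)
  let ?R = "{x. \<forall>y. S x y = 0}"
  have "lc m w x \<in> ?R \<longleftrightarrow> app {1..m} (gram w S) x = (\<lambda>_. 0)" for x
  proof
    assume x: "lc m w x \<in> ?R"
    have "app {1..m} (gram w S) x i = 0" for i
    proof (cases "i \<in> {1..m}")
      case True
      have "dot {1..m} x (app {1..m} (gram w S) (\<lambda>j. if j = i then 1 else 0)) = 0"
        using x form_eq_gram[OF S, of w x] by simp
      then have "dot {1..m} (app {1..m} (gram w S) x) (\<lambda>j. if j = i then 1 else 0) = 0"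
        by (simp only: dot_app[OF G])
      then show ?thesis using True by (simp add: dot_def if_distrib[of "\<lambda>c. _ * c"] cong: if_cong)
    next
      case False
      then show ?thesis using app_vecs[OF G, of x] by (simp add: vecs_def)
    qed
    then show "app {1..m} (gram w S) x = (\<lambda>_. 0)" by blast
  next
    assume x: "app {1..m} (gram w S) x = (\<lambda>_. 0)"
    have "S (lc m w x) v = 0" for v
    proof -
      have "S (lc m w x) v = dot {1..m} (app {1..m} (gram w S) x) (coord w v)"
        using form_eq_gram[OF S, of w x "coord w v"] dot_app[OF G, of x "coord w v"] by (simp add: lc_coord[OF w])
      then show ?thesis unfolding x by (simp add: dot_def)
    qed
    then show "lc m w x \<in> ?R" by simp
  qed
  then have "null {1..m} (gram w S) = {x \<in> vecs {1..m}. lc m w x \<in> ?R}" by (auto simp: null_def)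
  moreover have "bij_betw (lc m w) {x \<in> vecs {1..m}. lc m w x \<in> ?R} {y \<in> UNIV. y \<in> ?R}"
    by (rule bij_betw_Collect_image) (use w in \<open>simp add: coords_def\<close>)
  ultimately have "card (null {1..m} (gram w S)) = card ?R" using bij_betw_same_card by fastforce
  then have "q ^ nullity {1..m} (gram w S) = q ^ dim ?R"
    using card_null[OF _ G] card_subspace[OF subspace_sym_radical[OF S]] by simp
  then have "nullity {1..m} (gram w S) = dim ?R" by (simp only: q_pow_eq_iff)
  then show ?thesis by (simp add: sym_rank_def codim_def dim_m rk_def)
qed

text \<open>As \<open>normal_sum\<close> is linear in its matrix argument, one matrix A serves
  twice: with \<open>x i * x j\<close> it is a coefficient matrix of the normal form, and with a
  Gram matrix it computes the trace.\<close>

lemma normal_sum_matrix: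
  assumes "2 * s + kernel_dim K \<le> m"
  obtains A where "\<forall>M. (\<Sum>i=1..m. \<Sum>j=1..m. A i j * M i j) = normal_sum lam s K M"
proof -
  define lin where "lin = (\<lambda>\<phi>. \<exists>A. \<forall>M. (\<Sum>i=1..m. \<Sum>j=1..m. A i j * M i j) = (\<phi> M :: 'a))"
  have entry: "lin (\<lambda>M. c * M a b)" if "a \<in> {1..m}" "b \<in> {1..m}" for a b c
    unfolding lin_def
    by (intro exI[of _ "\<lambda>i j. if i = a \<and> j = b then c else 0"] allI sum_sum_unit) (use that in auto)
  have add: "lin (\<lambda>M. \<phi> M + \<psi> M)" if "lin \<phi>" "lin \<psi>" for \<phi> \<psi>
  proof -
    obtain A B where "\<forall>M. (\<Sum>i=1..m. \<Sum>j=1..m. A i j * M i j) = \<phi> M" "\<forall>M. (\<Sum>i=1..m. \<Sum>j=1..m. B i j * M i j) = \<psi> M"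
      using \<open>lin \<phi>\<close> \<open>lin \<psi>\<close> unfolding lin_def by blast
    then show ?thesis
      unfolding lin_def by (intro exI[of _ "\<lambda>i j. A i j + B i j"]) (simp add: algebra_simps sum.distrib)
  qed
  have zero: "lin (\<lambda>_. 0)" unfolding lin_def by (intro exI[of _ "\<lambda>_ _. 0"]) simp
  have entry1: "lin (\<lambda>M. M a b)" if "a \<in> {1..m}" "b \<in> {1..m}" for a b
    using entry[OF that, of 1] by simp
  have sum: "lin (\<lambda>M. \<Sum>i=1..t. M (2*i-1) (2*i))" if "2 * t \<le> m" for t
    using that
  proof (induction t)
    case (Suc t)
    have "lin (\<lambda>M. M (2 * Suc t - 1) (2 * Suc t))" by (rule entry1) (use Suc.prems in auto)
    then have "lin (\<lambda>M. (\<Sum>i=1..t. M (2*i-1) (2*i)) + M (2 * Suc t - 1) (2 * Suc t))"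
      using Suc by (intro add) auto
    then show ?case by simp
  qed (simp add: zero)
  have "lin (kernel_part lam s K)"
  proof (cases K)
    case Trivial
    then show ?thesis using zero by (simp add: kernel_part_def[abs_def])
  next
    case Square
    have "lin (\<lambda>M. M (2*s+1) (2*s+1))" by (rule entry1) (use assms Square in auto)
    then show ?thesis using Square by (simp add: kernel_part_def[abs_def])
  next
    case Elliptic
    have "lin (\<lambda>M. M (2*s+1) (2*s+1) + M (2*s+1) (2*s+2) + lam * M (2*s+2) (2*s+2))"
      by (intro add entry entry1) (use assms Elliptic in auto)
    then show ?thesis using Elliptic by (simp add: kernel_part_def[abs_def])
  qed
  then have "lin (normal_sum lam s K)"
    unfolding normal_sum_def[abs_def] using assms by (intro add sum) auto
  then show thesis using that unfolding lin_def by blast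
qed

text \<open>Rounding up also suits \<open>D = {0}\<close>, where all ranks are even.\<close>

definition class_sum :: "'a set \<Rightarrow> (nat \<Rightarrow> 'v) \<Rightarrow> (nat \<Rightarrow> real) \<Rightarrow> ('v \<Rightarrow> 'a) \<Rightarrow> real" where
  "class_sum D w g Q = (\<Sum>S\<in>sym_forms D. g ((sym_rank S + 1) div 2) * rpair w Q S)"

text \<open>Coefficient matrices refer to the basis u, so Q is replaced by an equivalent form Q'
  whose normal shape appears in u itself. Its pairing with S is then \<chi> of
  \<open>normal_sum\<close> at the Gram matrix.\<close>

lemma class_sum_normal_at:
  assumes D: "D = UNIV \<or> D = {0}" and w: "coords UNIV m w" and Q: "quadratic_form Q" and n: "normal_at Q b s K"
  shows "class_sum D w g Q = esum D {1..m} (normal_sum lam s K) g"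
proof -
  have le: "2 * s + kernel_dim K \<le> m" and b: "coords UNIV m b"
    and Qb: "\<And>x. Q (lc m b x) = normal_sum lam s K (\<lambda>i j. x i * x j)"
    using n by (auto simp: normal_at_def)
  define Q' where "Q' = (\<lambda>v. Q (lc m b (coord u v)))"
  have "quad_equiv Q Q'"
    unfolding quad_equiv_def Q'_def
    by (intro exI[of _ 1] exI[of _ "\<lambda>v. lc m b (coord u v)"]) (simp add: general_linear_change_basis[OF coords_u b])
  then have "class_sum D w g Q = class_sum D w g Q'"
    unfolding class_sum_def
    by (intro sum_rpair_equiv[symmetric, OF w invariant_sym_forms[OF D] _ Q])
      (auto simp: sym_rank_transform sym_forms_def)
  also have "\<dots> = (\<Sum>S\<in>sym_forms D. g (hrk {1..m} (gram w S)) * \<chi> (normal_sum lam s K (gram w S)))"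
    unfolding class_sum_def
  proof (rule sum.cong[OF refl])
    fix S assume "S \<in> sym_forms D"
    then have S: "symmetric_form S" by (simp add: sym_forms_def)
    obtain A where A: "\<forall>M. (\<Sum>i=1..m. \<Sum>j=1..m. A i j * M i j) = normal_sum lam s K M"
      using normal_sum_matrix[OF le] .
    have "represents A Q'"
      unfolding represents_def
    proof
      fix x
      have "lc m b (coord u (lc m u x)) = lc m b x" by (rule lc_cong) (simp_all add: coord_lc[OF coords_u])
      then have "Q' (lc m u x) = normal_sum lam s K (\<lambda>i j. x i * x j)"
        unfolding Q'_def Qb[symmetric] by (rule arg_cong)
      also have "\<dots> = (\<Sum>i=1..m. \<Sum>j=1..m. A i j * (x i * x j))"
        by (rule A[rule_format, symmetric])
      finally show "Q' (lc m u x) = (\<Sum>i=1..m. \<Sum>j=1..m. A i j * x i * x j)"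
        by (simp only: mult.assoc)
    qed
    then have "rpair w Q' S = \<chi> (normal_sum lam s K (\<lambda>i j. S (w j) (w i)))"
      using rpair_eq[OF _ S, of A Q' w] A[rule_format, of "\<lambda>i j. S (w j) (w i)"] by (simp only: trace_pair_def)
    also have "normal_sum lam s K (\<lambda>i j. S (w j) (w i)) = normal_sum lam s K (gram w S)"
      by (rule normal_sum_cong) (use le symmetric_commute[OF S] in \<open>auto simp: gram_def\<close>)
    finally show "g ((sym_rank S + 1) div 2) * rpair w Q' S = g (hrk {1..m} (gram w S)) * \<chi> (normal_sum lam s K (gram w S))"
      by (simp add: sym_rank_gram[OF S w] hrk_def)
  qed
  also have "\<dots> = esum D {1..m} (normal_sum lam s K) g"
    unfolding esum_def by (rule sum.reindex_bij_betw[OF bij_gram[OF D w]])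
  finally show ?thesis .
qed

theorem class_sum_qpoly:
  assumes w: "coords UNIV m w" and Q: "quadratic_form Q"
  shows "j \<le> (m + 1) div 2 \<Longrightarrow> class_sum UNIV w (qpoly q ((m + 1) div 2) j) Q =
      real q ^ (cexp (m + 1) * j) * qbinom (real q ^ 2) ((m + 1) div 2 - (quad_rank Q + 1) div 2) j"
    and "j \<le> m div 2 \<Longrightarrow> class_sum {0} w (qpoly q (m div 2) j) Q =
      real q ^ (cexp m * j) * qbinom (real q ^ 2) (m div 2 - quad_rank Q div 2) j"
proof -
  obtain b s K where n: "normal_at Q b s K" using normal_at_exists[OF Q] .
  have le: "2 * s + kernel_dim K \<le> m" using n by (simp add: normal_at_def)
  have r: "quad_rank Q = 2 * s + kernel_dim K" by (rule quad_rank_normal_at[OF Q n])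
  have key: "key_identity D {1..m} (normal_sum lam s K) (pair_count D s K)" if "D = UNIV \<or> D = {0}" for D
    by (rule key_identity_normal_sum[OF that le])
  have "pair_count UNIV s K = (quad_rank Q + 1) div 2" "pair_count {0} s K = quad_rank Q div 2"
    using UNIV_neq_0 by (cases K; simp add: pair_count_def r)+
  then show "j \<le> (m + 1) div 2 \<Longrightarrow> class_sum UNIV w (qpoly q ((m + 1) div 2) j) Q =
      real q ^ (cexp (m + 1) * j) * qbinom (real q ^ 2) ((m + 1) div 2 - (quad_rank Q + 1) div 2) j"
    and "j \<le> m div 2 \<Longrightarrow> class_sum {0} w (qpoly q (m div 2) j) Q =
      real q ^ (cexp m * j) * qbinom (real q ^ 2) (m div 2 - quad_rank Q div 2) j"
    using key[of UNIV] key[of "{0}"] UNIV_neq_0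
      class_sum_normal_at[OF _ w Q n, of UNIV] class_sum_normal_at[OF _ w Q n, of "{0}"]
    by (auto simp: key_identity_def ambient_def)
qed

section \<open>The linear programming bound\<close>

lemma quadratic_diff:
  assumes "quadratic_form Q" "quadratic_form Q'"
  shows "quadratic_form (\<lambda>x. Q x - Q' x)"
proof -
  have "polar (\<lambda>x. Q x - Q' x) = (\<lambda>x y. polar Q x y - polar Q' x y)"
    by (intro ext) (simp add: polar_def)
  then show ?thesis
    using assms by (simp add: quadratic_form_def bilinear_iff algebra_simps)
qed

lemma general_linear_inv:
  assumes "general_linear L"
  shows "general_linear (inv L)"
proof -
  have bij: "bij L" and lin: "\<And>x y. L (x + y) = L x + L y" "\<And>c x. L (scale c x) = scale c (L x)"
    using assms by (auto simp: general_linear_def linear_endo_iff)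
  have L: "L (inv L x) = x" for x using bij by (simp add: bij_is_surj surj_f_inv_f)
  have inj: "L x = L y \<Longrightarrow> x = y" for x y using bij by (simp add: bij_is_inj inj_eq)
  show ?thesis
    unfolding general_linear_def linear_endo_iff
  proof (intro conjI allI)
    show "inv L (x + y) = inv L x + inv L y" for x y by (rule inj) (simp add: lin L)
    show "inv L (scale c x) = scale c (inv L x)" for c x by (rule inj) (simp add: lin L)
    show "bij (inv L)" by (rule bij_imp_bij_inv[OF bij])
  qed
qed

lemma quad_equiv_sym:
  assumes "quad_equiv Q Q'"
  shows "quad_equiv Q' Q"
proof -
  obtain a L where a: "a \<noteq> 0" and L: "general_linear L" and eq: "\<And>x. Q' x = a * Q (L x)"
    using assms by (auto simp: quad_equiv_def)
  have "L (inv L x) = x" for x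
    using L by (simp add: general_linear_def bij_is_surj surj_f_inv_f)
  then show ?thesis
    unfolding quad_equiv_def using a general_linear_inv[OF L]
    by (intro exI[of _ "1 / a"] exI[of _ "inv L"]) (simp add: eq)
qed

lemma quad_equiv_trans:
  assumes "quad_equiv Q Q'" "quad_equiv Q' Q''"
  shows "quad_equiv Q Q''"
proof -
  obtain a L where a: "a \<noteq> 0" "general_linear L" "\<And>x. Q' x = a * Q (L x)"
    using assms(1) by (auto simp: quad_equiv_def)
  obtain c M where c: "c \<noteq> 0" "general_linear M" "\<And>x. Q'' x = c * Q' (M x)"
    using assms(2) by (auto simp: quad_equiv_def)
  show ?thesis
    unfolding quad_equiv_def using a c general_linear_compose[OF a(2) c(2)]
    by (intro exI[of _ "c * a"] exI[of _ "\<lambda>x. L (M x)"]) (simp add: mult.assoc)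
qed

lemma normal_at_equiv:
  assumes "normal_at Q b s K" "normal_at Q' b' s K"
  shows "quad_equiv Q Q'"
proof -
  have b: "coords UNIV m b" and b': "coords UNIV m b'" using assms by (simp_all add: normal_at_def)
  have "Q' v = Q (lc m b (coord b' v))" for v
  proof -
    have "Q' (lc m b' (coord b' v)) = Q (lc m b (coord b' v))" using assms by (simp add: normal_at_def)
    then show ?thesis by (simp add: lc_coord[OF b'])
  qed
  then show ?thesis
    unfolding quad_equiv_def using general_linear_change_basis[OF b' b]
    by (intro exI[of _ 1] exI[of _ "\<lambda>v. lc m b (coord b' v)"]) simp
qed

lemma normal_index_inj: "normal_index s K = normal_index s' K' \<Longrightarrow> s = s' \<and> K = K'"
  by (cases K; cases K') auto

text \<open>The index determines s and the kernel, and two forms with the same normal shape in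
  different bases differ by the change of basis.\<close>

lemma quad_class_equiv:
  assumes "Q \<in> quad_class lam i" "Q' \<in> quad_class lam i"
  shows "quad_equiv Q Q'"
proof -
  obtain P b s K where 1: "normal_at P b s K" "quad_equiv P Q" "i = normal_index s K"
    using quad_class_normal_form[OF assms(1)] .
  obtain P' b' s' K' where 2: "normal_at P' b' s' K'" "quad_equiv P' Q'" "i = normal_index s' K'"
    using quad_class_normal_form[OF assms(2)] .
  have "quad_equiv P P'" using normal_index_inj[of s K s' K'] 1 2 normal_at_equiv by auto
  then show ?thesis using 1(2) 2(2) quad_equiv_sym quad_equiv_trans by blast
qed

lemma quad_class_quadratic: "Q \<in> quad_class lam i \<Longrightarrow> quadratic_form Q"
  by (cases i) (auto simp: quad_class_def)

lemma sum_sym_class_quad_class: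
  assumes w: "coords UNIV m w" and Q: "Q \<in> quad_class lam i" "Q' \<in> quad_class lam i"
  shows "(\<Sum>S\<in>sym_class k. rpair w Q S) = (\<Sum>S\<in>sym_class k. rpair w Q' S)"
  using sum_rpair_equiv[OF w invariant_sym_class[of k], of "\<lambda>_. 1", OF refl quad_class_quadratic[OF Q(1)] quad_class_equiv[OF Q]]
  by simp

section \<open>The dual inner distribution\<close>

definition char_sum :: "(nat \<Rightarrow> 'v) \<Rightarrow> ('v \<Rightarrow> 'a) set \<Rightarrow> ('v \<Rightarrow> 'v \<Rightarrow> 'a) \<Rightarrow> real" where
  "char_sum w Y S = (\<Sum>Q\<in>Y. rpair w Q S)"

lemma sum_rpair_diff:
  assumes Y: "Y \<subseteq> {Q. quadratic_form Q}" and S: "symmetric_form S"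
  shows "(\<Sum>Q\<in>Y. \<Sum>Q'\<in>Y. rpair w (\<lambda>x. Q x - Q' x) S) = (char_sum w Y S)\<^sup>2"
proof -
  have "(\<Sum>Q\<in>Y. \<Sum>Q'\<in>Y. rpair w (\<lambda>x. Q x - Q' x) S) = (\<Sum>Q\<in>Y. \<Sum>Q'\<in>Y. rpair w Q S * rpair w Q' S)"
    by (intro sum.cong refl) (use Y S in \<open>auto intro: rpair_diff\<close>)
  then show ?thesis by (simp add: char_sum_def power2_eq_square sum_product)
qed

text \<open>Each difference lies in exactly one class, so the pairs can be grouped by class index,
  and f at the chosen representative is f at every member. The index type is infinite; finitely many
  classes are nonempty because there are finitely many forms.\<close>

lemma sum_over_classes:
  assumes Y: "Y \<subseteq> {Q. quadratic_form Q}"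
    and f: "\<And>Q Q' i. Q \<in> quad_class lam i \<Longrightarrow> Q' \<in> quad_class lam i \<Longrightarrow> f Q = (f Q' :: real)"
  shows "(\<Sum>i | quad_class lam i \<noteq> {}. f (SOME Q. Q \<in> quad_class lam i) *
      real (card {(Q, Q'). Q \<in> Y \<and> Q' \<in> Y \<and> (\<lambda>x. Q x - Q' x) \<in> quad_class lam i}))
    = (\<Sum>Q\<in>Y. \<Sum>Q'\<in>Y. f (\<lambda>x. Q x - Q' x))"
proof -
  define idx where "idx = (\<lambda>Q. THE i. Q \<in> quad_class lam i)"
  have idx: "Q \<in> quad_class lam i \<longleftrightarrow> idx Q = i" if "quadratic_form Q" for Q i
  proof -
    obtain i0 where i0: "Q \<in> quad_class lam i0" using quad_class_exists[OF \<open>quadratic_form Q\<close>] by blast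
    have "idx Q = i0" unfolding idx_def using i0 quad_class_unique by blast
    then show ?thesis using i0 quad_class_unique by blast
  qed
  let ?I = "{i. quad_class lam i \<noteq> {}}"
  let ?d = "\<lambda>(Q, Q'). (\<lambda>x. Q x - Q' x) :: 'v \<Rightarrow> 'a"
  have qd: "quadratic_form (?d p)" if "p \<in> Y \<times> Y" for p
    using that Y by (auto intro!: quadratic_diff)
  have mem: "?d p \<in> quad_class lam i \<longleftrightarrow> idx (?d p) = i" if "p \<in> Y \<times> Y" for p i
    by (rule idx[OF qd[OF that]])
  have "?I \<subseteq> idx ` UNIV"
  proof
    fix i assume "i \<in> ?I"
    then obtain Q where "Q \<in> quad_class lam i" by blast
    then have "idx Q = i" using idx[OF quad_class_quadratic] by blast
    then show "i \<in> idx ` UNIV" by blast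
  qed
  then have finI: "finite ?I" by (rule finite_subset) simp
  have "(\<Sum>i\<in>?I. f (SOME Q. Q \<in> quad_class lam i) *
      real (card {(Q, Q'). Q \<in> Y \<and> Q' \<in> Y \<and> (\<lambda>x. Q x - Q' x) \<in> quad_class lam i}))
    = (\<Sum>i\<in>?I. \<Sum>p\<in>{p \<in> Y \<times> Y. idx (?d p) = i}. f (?d p))"
  proof (rule sum.cong[OF refl])
    fix i assume "i \<in> ?I"
    then have some: "(SOME Q. Q \<in> quad_class lam i) \<in> quad_class lam i" by (simp add: some_in_eq)
    have eq: "{(Q, Q'). Q \<in> Y \<and> Q' \<in> Y \<and> (\<lambda>x. Q x - Q' x) \<in> quad_class lam i} = {p \<in> Y \<times> Y. idx (?d p) = i}"
    proof -
      have "{(Q, Q'). Q \<in> Y \<and> Q' \<in> Y \<and> (\<lambda>x. Q x - Q' x) \<in> quad_class lam i} =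
        {p \<in> Y \<times> Y. ?d p \<in> quad_class lam i}" by auto
      also have "\<dots> = {p \<in> Y \<times> Y. idx (?d p) = i}" using mem by (intro Collect_cong conj_cong refl)
      finally show ?thesis .
    qed
    have "(\<Sum>p\<in>{p \<in> Y \<times> Y. idx (?d p) = i}. f (?d p)) = (\<Sum>p\<in>{p \<in> Y \<times> Y. idx (?d p) = i}. f (SOME Q. Q \<in> quad_class lam i))"
    proof (rule sum.cong[OF refl])
      fix p assume "p \<in> {p \<in> Y \<times> Y. idx (?d p) = i}"
      then have "?d p \<in> quad_class lam i" using mem by blast
      then show "f (?d p) = f (SOME Q. Q \<in> quad_class lam i)" by (rule f[OF _ some])
    qed
    then show "f (SOME Q. Q \<in> quad_class lam i) *
      real (card {(Q, Q'). Q \<in> Y \<and> Q' \<in> Y \<and> (\<lambda>x. Q x - Q' x) \<in> quad_class lam i}) = (\<Sum>p\<in>{p \<in> Y \<times> Y. idx (?d p) = i}. f (?d p))"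
      unfolding eq by simp
  qed
  also have "\<dots> = (\<Sum>p\<in>Y \<times> Y. f (?d p))"
  proof (rule sum.group[OF _ finI])
    show "(\<lambda>p. idx (?d p)) ` (Y \<times> Y) \<subseteq> ?I"
    proof (rule image_subsetI)
      fix p assume "p \<in> Y \<times> Y"
      then have "?d p \<in> quad_class lam (idx (?d p))" using mem by blast
      then show "idx (?d p) \<in> ?I" by blast
    qed
  qed simp
  also have "\<dots> = (\<Sum>Q\<in>Y. \<Sum>Q'\<in>Y. f (\<lambda>x. Q x - Q' x))"
    by (simp add: sum.cartesian_product case_prod_unfold)
  finally show ?thesis .
qed

lemma dual_inner_distribution_eq:
  assumes w: "coords UNIV m w" and Y: "Y \<subseteq> {Q. quadratic_form Q}"
  shows "dual_inner_distribution lam (\<lambda>x. complex_of_real (\<chi> x)) u w Y k =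
    complex_of_real ((\<Sum>S\<in>sym_class k. (char_sum w Y S)\<^sup>2) / real (card Y))"
proof -
  define f where "f = (\<lambda>Q. \<Sum>S\<in>sym_class k. rpair w Q S)"
  have num: "Q_number lam (\<lambda>x. complex_of_real (\<chi> x)) u w k i = complex_of_real (f (SOME Q. Q \<in> quad_class lam i))" for i
    by (simp add: Q_number_def pairing_eq f_def)
  define c where "c i = real (card {(Q, Q'). Q \<in> Y \<and> Q' \<in> Y \<and> (\<lambda>x. Q x - Q' x) \<in> quad_class lam i})" for i
  have inner: "inner_distribution lam Y i = c i / real (card Y)" for i
    by (simp only: inner_distribution_def c_def)
  have "dual_inner_distribution lam (\<lambda>x. complex_of_real (\<chi> x)) u w Y k =
    complex_of_real ((\<Sum>i | quad_class lam i \<noteq> {}. f (SOME Q. Q \<in> quad_class lam i) * c i) / real (card Y))"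
    unfolding dual_inner_distribution_def num inner sum_divide_distrib of_real_sum
    by (intro sum.cong refl) (simp only: of_real_mult of_real_divide times_divide_eq_right)
  also have "(\<Sum>i | quad_class lam i \<noteq> {}. f (SOME Q. Q \<in> quad_class lam i) * c i)
    = (\<Sum>Q\<in>Y. \<Sum>Q'\<in>Y. f (\<lambda>x. Q x - Q' x))"
    unfolding c_def
  proof (rule sum_over_classes[OF Y, of f])
    show "f Q = f Q'" if "Q \<in> quad_class lam i" "Q' \<in> quad_class lam i" for Q Q' i
      unfolding f_def by (rule sum_sym_class_quad_class[OF w that])
  qed
  also have "\<dots> = (\<Sum>Q\<in>Y. \<Sum>S\<in>sym_class k. \<Sum>Q'\<in>Y. rpair w (\<lambda>x. Q x - Q' x) S)"
    unfolding f_def by (rule sum.cong[OF refl]) (rule sum.swap)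
  also have "\<dots> = (\<Sum>S\<in>sym_class k. \<Sum>Q\<in>Y. \<Sum>Q'\<in>Y. rpair w (\<lambda>x. Q x - Q' x) S)"
    by (rule sum.swap)
  also have "\<dots> = (\<Sum>S\<in>sym_class k. (char_sum w Y S)\<^sup>2)"
  proof (rule sum.cong[OF refl])
    fix S assume "S \<in> sym_class k"
    then have "symmetric_form S" using invariant_sym_class[of k] by (simp add: invariant_class_def)
    then show "(\<Sum>Q\<in>Y. \<Sum>Q'\<in>Y. rpair w (\<lambda>x. Q x - Q' x) S) = (char_sum w Y S)\<^sup>2"
      by (rule sum_rpair_diff[OF Y])
  qed
  finally show ?thesis .
qed

text \<open>Each condition states that a sum of real squares is zero, hence that every term is. The
  classes in \<open>index_upto t\<close> exhaust the ranks from 1 to t, since both types are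
  included and every form of even rank has one.\<close>

lemma is_design_iff:
  assumes w: "coords UNIV m w" and Y: "Y \<subseteq> {Q. quadratic_form Q}" "Y \<noteq> {}"
  shows "is_design lam (\<lambda>x. complex_of_real (\<chi> x)) u w t Y \<longleftrightarrow>
    (\<forall>S. symmetric_form S \<longrightarrow> 1 \<le> sym_rank S \<longrightarrow> sym_rank S \<le> t \<longrightarrow> char_sum w Y S = 0)"
proof -
  have cY: "card Y \<noteq> 0" using Y by simp
  have "is_design lam (\<lambda>x. complex_of_real (\<chi> x)) u w t Y \<longleftrightarrow>
    (\<forall>k\<in>index_upto t. \<forall>S\<in>sym_class k. char_sum w Y S = 0)"
    unfolding is_design_def dual_inner_distribution_eq[OF w Y(1)] of_real_eq_0_iff divide_eq_0_iff
    using cY by (simp add: sum_nonneg_eq_0_iff)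
  also have "\<dots> \<longleftrightarrow> (\<forall>S. symmetric_form S \<longrightarrow> 1 \<le> sym_rank S \<longrightarrow> sym_rank S \<le> t \<longrightarrow> char_sum w Y S = 0)"
  proof (intro iffI allI impI ballI)
    fix S assume *: "\<forall>k\<in>index_upto t. \<forall>S\<in>sym_class k. char_sum w Y S = 0"
      and S: "symmetric_form S" "1 \<le> sym_rank S" "sym_rank S \<le> t"
    show "char_sum w Y S = 0"
    proof (cases "even (sym_rank S)")
      case True
      then obtain s where s: "sym_rank S = 2 * s" by (elim evenE)
      obtain \<tau> where "sym_has_type S \<tau>" using sym_even_rank_has_type[OF S(1) s] by blast
      then have "S \<in> sym_class (EvenRank (int s) \<tau>)" using S s by (simp add: sym_class_def)
      moreover have "EvenRank (int s) \<tau> \<in> index_upto t" using S s by (auto simp: index_upto_def)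
      ultimately show ?thesis using * by blast
    next
      case False
      then obtain s where s: "sym_rank S = 2 * s + 1" by (elim oddE)
      then have "S \<in> sym_class (OddRank (int s))" using S by (simp add: sym_class_def)
      moreover have "OddRank (int s) \<in> index_upto t" using S s by (auto simp: index_upto_def)
      ultimately show ?thesis using * by blast
    qed
  next
    fix k S assume *: "\<forall>S. symmetric_form S \<longrightarrow> 1 \<le> sym_rank S \<longrightarrow> sym_rank S \<le> t \<longrightarrow> char_sum w Y S = 0"
      and k: "k \<in> index_upto t" and S: "S \<in> sym_class k"
    have "symmetric_form S \<and> 1 \<le> sym_rank S \<and> sym_rank S \<le> t"
    proof (cases k)
      case (OddRank s)
      then have "1 \<le> 2 * s + 1" "2 * s + 1 \<le> int t" using k by (auto simp: index_upto_def)
      moreover have "symmetric_form S" "int (sym_rank S) = 2 * s + 1" using S OddRank by (auto simp: sym_class_def)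
      ultimately show ?thesis by linarith
    next
      case (EvenRank s \<tau>)
      then have "2 \<le> 2 * s" "2 * s \<le> int t" using k by (auto simp: index_upto_def)
      moreover have "symmetric_form S" "int (sym_rank S) = 2 * s" using S EvenRank by (auto simp: sym_class_def)
      ultimately show ?thesis by linarith
    qed
    then show "char_sum w Y S = 0" using * by blast
  qed
  finally show ?thesis .
qed

lemma symmetric_zero: "symmetric_form (\<lambda>_ _. 0)"
  by (simp add: symmetric_form_def bilinear_iff)

lemma sym_rank_eq_0_iff:
  assumes S: "symmetric_form S"
  shows "sym_rank S = 0 \<longleftrightarrow> S = (\<lambda>_ _. 0)"
proof
  let ?R = "{x. \<forall>y. S x y = 0}"
  assume "sym_rank S = 0"
  then have "m \<le> dim ?R" by (simp add: sym_rank_def codim_def dim_m)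
  then have "q ^ m \<le> card ?R" using card_subspace[OF subspace_sym_radical[OF S]] q_ge_2 by simp
  then have "?R = UNIV" using card_V by (intro card_seteq) auto
  then show "S = (\<lambda>_ _. 0)" by auto
next
  assume "S = (\<lambda>_ _. 0)"
  then show "sym_rank S = 0" by (simp add: sym_rank_def codim_def)
qed

lemma rpair_zero: "quadratic_form Q \<Longrightarrow> rpair w Q (\<lambda>_ _. 0) = 1"
  by (simp add: rpair_def trace_pair_def chi_0)

lemma quad_rank_zero: "quad_rank (\<lambda>_. 0) = 0"
  by (simp add: quad_rank_def codim_def polar_def)

section \<open>The bound and its equality case\<close>

text \<open>The squares are expanded over pairs from Y and the sums exchanged. A pair of distinct
  codewords has a difference of rank at least d, which \<open>vanish\<close> annihilates; the
  diagonal pairs contribute the zero form.\<close>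

lemma code_class_sum:
  assumes Y: "Y \<subseteq> {Q. quadratic_form Q}" and code: "is_code d Y"
    and vanish: "\<And>Q. quadratic_form Q \<Longrightarrow> d \<le> quad_rank Q \<Longrightarrow> class_sum D w g Q = 0"
  shows "(\<Sum>S\<in>sym_forms D. g ((sym_rank S + 1) div 2) * (char_sum w Y S)\<^sup>2) = real (card Y) * class_sum D w g (\<lambda>_. 0)"
proof -
  have "(\<Sum>S\<in>sym_forms D. g ((sym_rank S + 1) div 2) * (char_sum w Y S)\<^sup>2)
    = (\<Sum>S\<in>sym_forms D. \<Sum>Q\<in>Y. \<Sum>Q'\<in>Y. g ((sym_rank S + 1) div 2) * rpair w (\<lambda>x. Q x - Q' x) S)"
  proof (rule sum.cong[OF refl])
    fix S assume "S \<in> sym_forms D"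
    then have "symmetric_form S" by (simp add: sym_forms_def)
    show "g ((sym_rank S + 1) div 2) * (char_sum w Y S)\<^sup>2 =
      (\<Sum>Q\<in>Y. \<Sum>Q'\<in>Y. g ((sym_rank S + 1) div 2) * rpair w (\<lambda>x. Q x - Q' x) S)"
      unfolding sum_rpair_diff[OF Y \<open>symmetric_form S\<close>, symmetric] sum_distrib_left ..
  qed
  also have "\<dots> = (\<Sum>Q\<in>Y. \<Sum>S\<in>sym_forms D. \<Sum>Q'\<in>Y. g ((sym_rank S + 1) div 2) * rpair w (\<lambda>x. Q x - Q' x) S)"
    by (rule sum.swap)
  also have "\<dots> = (\<Sum>Q\<in>Y. \<Sum>Q'\<in>Y. class_sum D w g (\<lambda>x. Q x - Q' x))"
    unfolding class_sum_def by (rule sum.cong[OF refl]) (rule sum.swap)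
  also have "\<dots> = (\<Sum>Q\<in>Y. \<Sum>Q'\<in>Y. if Q' = Q then class_sum D w g (\<lambda>_. 0) else 0)"
  proof (intro sum.cong refl)
    fix Q Q' assume QQ: "Q \<in> Y" "Q' \<in> Y"
    show "class_sum D w g (\<lambda>x. Q x - Q' x) = (if Q' = Q then class_sum D w g (\<lambda>_. 0) else 0)"
    proof (cases "Q' = Q")
      case False
      then have "d \<le> quad_rank (\<lambda>x. Q x - Q' x)" using code QQ by (auto simp: is_code_def)
      moreover have "quadratic_form (\<lambda>x. Q x - Q' x)" using QQ Y by (auto intro: quadratic_diff)
      ultimately show ?thesis using False vanish by simp
    qed simp
  qed
  also have "\<dots> = real (card Y) * class_sum D w g (\<lambda>_. 0)" by simp
  finally show ?thesis .
qed

lemma linear_programming_bound: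
  assumes D: "D = UNIV \<or> D = {0}" and Y: "Y \<subseteq> {Q. quadratic_form Q}" "Y \<noteq> {}" and code: "is_code d Y"
    and vanish: "\<And>Q. quadratic_form Q \<Longrightarrow> d \<le> quad_rank Q \<Longrightarrow> class_sum D w g Q = 0"
    and F0: "class_sum D w g (\<lambda>_. 0) = real N * g 0" and g0: "0 < g 0" and g: "\<And>\<sigma>. 0 \<le> g \<sigma>"
  shows "card Y \<le> N"
    and "card Y = N \<longleftrightarrow> (\<forall>S\<in>sym_forms D. 1 \<le> sym_rank S \<longrightarrow> g ((sym_rank S + 1) div 2) \<noteq> 0 \<longrightarrow> char_sum w Y S = 0)"
proof -
  let ?Z = "\<lambda>_ _. 0 :: 'a"
  let ?T = "\<Sum>S\<in>sym_forms D - {?Z}. g ((sym_rank S + 1) div 2) * (char_sum w Y S)\<^sup>2"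
  have Z: "?Z \<in> sym_forms D" using D symmetric_zero by (auto simp: sym_forms_def)
  have cZ: "char_sum w Y ?Z = real (card Y)"
  proof -
    have "char_sum w Y ?Z = (\<Sum>Q\<in>Y. 1)"
      unfolding char_sum_def by (rule sum.cong[OF refl]) (use Y rpair_zero in auto)
    then show ?thesis by simp
  qed
  have "(\<Sum>S\<in>sym_forms D. g ((sym_rank S + 1) div 2) * (char_sum w Y S)\<^sup>2) = g 0 * (real (card Y))\<^sup>2 + ?T"
    using sum.remove[OF finite_syms Z, of "\<lambda>S. g ((sym_rank S + 1) div 2) * (char_sum w Y S)\<^sup>2"]
    by (simp add: cZ sym_rank_eq_0_iff[OF symmetric_zero, THEN iffD2])
  then have eq: "g 0 * (real (card Y))\<^sup>2 + ?T = real (card Y) * (real N * g 0)"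
    using code_class_sum[OF Y(1) code vanish] F0 by simp
  have T: "0 \<le> ?T" by (intro sum_nonneg mult_nonneg_nonneg g) simp
  have cY: "0 < real (card Y)" using Y by (simp add: card_gt_0_iff)
  \<comment> \<open>The sign of this expression gives the bound, and its vanishing the equality
    case.\<close>
  have id: "g 0 * real (card Y) * (real N - real (card Y)) = ?T"
    using eq by (simp add: algebra_simps power2_eq_square)
  have pos: "0 < g 0 * real (card Y)" using g0 cY by simp
  then have "0 \<le> real N - real (card Y)" using T id by (metis zero_le_mult_iff not_le order_less_imp_le)
  then show "card Y \<le> N" by simp
  have "card Y = N \<longleftrightarrow> ?T = 0" using id pos by auto
  also have "\<dots> \<longleftrightarrow> (\<forall>S\<in>sym_forms D - {?Z}. g ((sym_rank S + 1) div 2) * (char_sum w Y S)\<^sup>2 = 0)"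
    by (rule sum_nonneg_eq_0_iff) (simp_all add: mult_nonneg_nonneg g)
  also have "\<dots> \<longleftrightarrow> (\<forall>S\<in>sym_forms D. 1 \<le> sym_rank S \<longrightarrow> g ((sym_rank S + 1) div 2) \<noteq> 0 \<longrightarrow> char_sum w Y S = 0)"
  proof -
    have "S \<in> sym_forms D - {?Z} \<longleftrightarrow> S \<in> sym_forms D \<and> 1 \<le> sym_rank S" for S
      using sym_rank_eq_0_iff[of S] by (auto simp: sym_forms_def Suc_le_eq)
    then show ?thesis by auto
  qed
  finally show "card Y = N \<longleftrightarrow> (\<forall>S\<in>sym_forms D. 1 \<le> sym_rank S \<longrightarrow> g ((sym_rank S + 1) div 2) \<noteq> 0 \<longrightarrow> char_sum w Y S = 0)" .
qed

lemma quadratic_zero: "quadratic_form (\<lambda>_. 0)"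
  by (simp add: quadratic_form_def polar_def bilinear_iff)

lemma qpoly_nonneg: "0 \<le> qpoly q n j \<sigma>"
  by (simp add: qpoly_def qbinom_nonneg)

lemma qpoly_0_pos: "0 < qpoly q n j 0"
  by (simp add: qpoly_def qbinom_pos)

lemma qpoly_0: "j \<le> n \<Longrightarrow> qpoly q n j 0 = qbinom (real q ^ 2) n j"
  by (simp add: qpoly_def qbinom_symmetric)

lemma qpoly_neq_0_iff: "\<sigma> \<le> n \<Longrightarrow> j \<le> n \<Longrightarrow> qpoly q n j \<sigma> \<noteq> 0 \<longleftrightarrow> \<sigma> \<le> j"
proof
  assume "\<sigma> \<le> n" "j \<le> n" "qpoly q n j \<sigma> \<noteq> 0"
  then have "\<not> n - \<sigma> < n - j" by (auto simp: qpoly_def)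
  then show "\<sigma> \<le> j" using \<open>j \<le> n\<close> \<open>\<sigma> \<le> n\<close> by linarith
next
  assume "\<sigma> \<le> j"
  then have "0 < qbinom (real q ^ 2) (n - \<sigma>) (n - j)" by (intro qbinom_pos) auto
  then show "qpoly q n j \<sigma> \<noteq> 0" by (simp add: qpoly_def)
qed

text \<open>With \<open>d = 2 * d' + 1\<close>, rank at least d means half rank, rounded up, at
  least \<open>d' + 1\<close>, and \<open>n - (d' + 1) < n - d' = j\<close> makes the binomial
  vanish. The weight is nonzero exactly for half rank at most j, that is for rank at most
  \<open>2 * j\<close>; this is the strength of the design.\<close>

lemma odd_distance_bound:
  assumes w: "coords UNIV m w" and Y: "Y \<subseteq> {Q. quadratic_form Q}" "Y \<noteq> {}" and code: "is_code d Y"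
    and d: "odd d" "d \<le> m"
  defines "j \<equiv> (m + 1) div 2 - (d - 1) div 2"
  shows "card Y \<le> q ^ (cexp (m + 1) * j)"
    and "card Y = q ^ (cexp (m + 1) * j) \<longleftrightarrow> is_design lam (\<lambda>x. complex_of_real (\<chi> x)) u w (2 * j) Y"
proof -
  let ?n = "(m + 1) div 2"
  obtain d' where d': "d = 2 * d' + 1" using d(1) by (elim oddE)
  have jn: "j \<le> ?n" by (simp add: j_def)
  have vanish: "class_sum UNIV w (qpoly q ?n j) Q = 0" if "quadratic_form Q" "d \<le> quad_rank Q" for Q
  proof -
    have "d' + 1 \<le> ?n" using d d' by simp
    moreover have "d' + 1 \<le> (quad_rank Q + 1) div 2" using that d' by simp
    ultimately have "?n - (quad_rank Q + 1) div 2 < j" unfolding j_def d' by simp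
    then show ?thesis using class_sum_qpoly(1)[OF w that(1) jn] by simp
  qed
  have F0: "class_sum UNIV w (qpoly q ?n j) (\<lambda>_. 0) = real (q ^ (cexp (m + 1) * j)) * qpoly q ?n j 0"
    using class_sum_qpoly(1)[OF w quadratic_zero jn] unfolding qpoly_0[OF jn] by (simp add: quad_rank_zero)
  have D: "UNIV = UNIV \<or> (UNIV :: 'a set) = {0}" by simp
  note lp = linear_programming_bound[OF D Y code vanish F0 qpoly_0_pos qpoly_nonneg]
  show "card Y \<le> q ^ (cexp (m + 1) * j)" using lp(1) .
  have "sym_rank S \<le> m" for S by (simp add: sym_rank_def codim_le)
  then have "(sym_rank S + 1) div 2 \<le> ?n" for S by (simp add: div_le_mono)
  then have nz: "qpoly q ?n j ((sym_rank S + 1) div 2) \<noteq> 0 \<longleftrightarrow> sym_rank S \<le> 2 * j" for S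
    using qpoly_neq_0_iff[OF _ jn, of "(sym_rank S + 1) div 2"] by auto
  show "card Y = q ^ (cexp (m + 1) * j) \<longleftrightarrow> is_design lam (\<lambda>x. complex_of_real (\<chi> x)) u w (2 * j) Y"
    using lp(2) unfolding is_design_iff[OF w Y] nz by (simp add: sym_forms_def)
qed

text \<open>Half ranks of Q are rounded down here, so \<open>d = 2 * d'\<close> yields only half
  rank at least d', and j must be one larger than \<open>n - d'\<close>. It still is at most n
  because \<open>d' \<ge> 1\<close>.\<close>

lemma even_distance_bound:
  assumes w: "coords UNIV m w" and Y: "Y \<subseteq> {Q. quadratic_form Q}" "Y \<noteq> {}" and code: "is_code d Y"
    and d: "even d" "1 \<le> d" "d \<le> m"
  shows "card Y \<le> q ^ (cexp m * (m div 2 - d div 2 + 1))"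
proof -
  let ?n = "m div 2"
  define j where "j = m div 2 - d div 2 + 1"
  obtain d' where d': "d = 2 * d'" using d(1) by (elim evenE)
  have dn: "1 \<le> d'" "d' \<le> ?n" using d d' by auto
  then have jn: "j \<le> ?n" by (simp add: j_def d')
  have vanish: "class_sum {0} w (qpoly q ?n j) Q = 0" if "quadratic_form Q" "d \<le> quad_rank Q" for Q
  proof -
    have "d' \<le> quad_rank Q div 2" using that d' by simp
    then have "?n - quad_rank Q div 2 < j" using dn unfolding j_def d' by simp
    then show ?thesis using class_sum_qpoly(2)[OF w that(1) jn] by simp
  qed
  have F0: "class_sum {0} w (qpoly q ?n j) (\<lambda>_. 0) = real (q ^ (cexp m * j)) * qpoly q ?n j 0"
    using class_sum_qpoly(2)[OF w quadratic_zero jn] unfolding qpoly_0[OF jn] by (simp add: quad_rank_zero)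
  have D: "{0} = UNIV \<or> ({0} :: 'a set) = {0}" by simp
  show ?thesis
    using linear_programming_bound(1)[OF D Y code vanish F0 qpoly_0_pos qpoly_nonneg] by (simp add: j_def)
qed

end

section \<open>Finite fields of even order\<close>

lemma of_nat_card_eq_0: "of_nat CARD('a) = (0 :: 'a::{field,finite})"
proof -
  have "(\<Sum>x\<in>UNIV. x :: 'a) = (\<Sum>x\<in>UNIV. x + 1)"
    by (rule sum.reindex_bij_betw[symmetric]) (simp add: bij_plus_right)
  then show ?thesis by (simp add: sum.distrib)
qed

lemma power_card_eq_self:
  fixes x :: "'a::{field,finite}"
  shows "x ^ CARD('a) = x"
proof (cases "x = 0")
  case True
  then show ?thesis by (simp add: zero_power card_gt_0_iff)
next
  case False
  have "bij_betw ((*) x) (UNIV - {0}) (UNIV - {0})"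
    by (rule bij_betwI[where g = "\<lambda>y. y / x"]) (use False in auto)
  from prod.reindex_bij_betw[OF this, of "\<lambda>y. y"]
  have "x ^ (CARD('a) - 1) * (\<Prod>y\<in>UNIV - {0}. y) = (\<Prod>y\<in>UNIV - {0}. y)"
    by (simp add: prod.distrib)
  then have "x ^ (CARD('a) - 1) = 1" by (simp add: prod_zero_iff)
  then have "x ^ Suc (CARD('a) - 1) = x" by (simp only: power_Suc mult_1_right)
  moreover have "Suc (CARD('a) - 1) = CARD('a)" by (rule Suc_diff_1) (simp add: card_gt_0_iff)
  ultimately show ?thesis by (simp only:)
qed

text \<open>Powers by \<open>2 ^ i\<close> are additive, so the trace telescopes to
  \<open>z ^ (2 ^ e) + z\<close>, which is \<open>z + z = 0\<close>. An element of trace 1 therefore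
  lies outside the Artin-Schreier image.\<close>

lemma abs_trace_artin_schreier:
  fixes z :: "'a::{field,finite}"
  assumes "CARD('a) = 2 ^ e" and two: "\<And>x::'a. x + x = 0"
  shows "abs_trace e (z\<^sup>2 + z) = 0"
proof -
  have sq: "(x + y)\<^sup>2 = x\<^sup>2 + (y::'a)\<^sup>2" for x y
    using two[of "x * y"] by (simp add: power2_eq_square algebra_simps)
  have pow: "(x + y) ^ (2 ^ i) = x ^ (2 ^ i) + (y::'a) ^ (2 ^ i)" for x y i
  proof (induction i)
    case (Suc i)
    have "(x + y) ^ (2 ^ Suc i) = ((x + y) ^ (2 ^ i))\<^sup>2" by (simp add: mult.commute flip: power_mult)
    then show ?case unfolding Suc sq by (simp add: mult.commute flip: power_mult)
  qed simp
  have "(\<Sum>i<n. (z\<^sup>2 + z) ^ (2 ^ i)) = z ^ (2 ^ n) + z" for n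
  proof (induction n)
    case 0
    then show ?case by (simp add: two)
  next
    case (Suc n)
    have "(z\<^sup>2 + z) ^ (2 ^ n) = z ^ (2 ^ Suc n) + z ^ (2 ^ n)"
      by (simp add: pow flip: power_mult)
    then have "(\<Sum>i<Suc n. (z\<^sup>2 + z) ^ (2 ^ i)) = z ^ (2 ^ Suc n) + z + (z ^ (2 ^ n) + z ^ (2 ^ n))"
      unfolding sum.lessThan_Suc Suc.IH by (simp only: add_ac)
    then show ?case by (simp only: two add_0_right)
  qed
  from this[of e] show ?thesis
    using power_card_eq_self[of z] by (simp add: abs_trace_def assms(1) two)
qed

theorem theorem4p5:
  fixes scale :: "'a::{field,finite} \<Rightarrow> 'v::ab_group_add \<Rightarrow> 'v"
    and q e m d :: nat
    and lam :: 'a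
    and \<chi> :: "'a \<Rightarrow> complex"
    and u w :: "nat \<Rightarrow> 'v"
    and Y :: "('v \<Rightarrow> 'a) set"
  assumes "CARD('a) = q" and "q = 2 ^ e" and "1 \<le> e"
    and "vector_space scale" and "vector_space.dim scale UNIV = m"
    and "abs_trace e lam = 1"
    and "nontrivial_character \<chi>"
    and "form_space.indexed_basis scale u" and "form_space.indexed_basis scale w"
    and "1 \<le> d" and "d \<le> m"
    and "Y \<subseteq> {Q. form_space.quadratic_form scale Q}" and "Y \<noteq> {}"
    and "form_space.is_code scale d Y"
  shows "let N = (if odd m \<and> odd d then q ^ (m * (m - d + 2) div 2)
                  else if even m \<and> odd d then q ^ ((m + 1) * (m - d + 1) div 2)
                  else if even m \<and> even d then q ^ ((m - 1) * (m - d + 2) div 2)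
                  else q ^ (m * (m - d + 1) div 2))
         in card Y \<le> N \<and>
            (odd d \<longrightarrow>
              (card Y = N \<longleftrightarrow>
               form_space.is_design scale lam \<chi> u w (2 * ((m + 1) div 2 - (d - 1) div 2)) Y))"
proof -
  have "(2::'a) ^ e = 0"
    using of_nat_card_eq_0[where 'a = 'a] assms(1,2) by simp
  then have two: "x + x = (0::'a)" for x
    using mult_2[of x] by simp
  have \<chi>: "\<chi> 0 = 1" "\<chi> (x + y) = \<chi> x * \<chi> y" "\<exists>x. \<chi> x \<noteq> 1" for x y
    using assms(7) by (auto simp: nontrivial_character_def additive_character_def)
  define \<chi>' where "\<chi>' x = Re (\<chi> x)" for x
  have real: "\<chi> x = complex_of_real (\<chi>' x)" for x
  proof -
    have "\<chi> x * \<chi> x = 1" using \<chi>(2)[of x x] by (simp add: two \<chi>(1))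
    then have "\<chi> x = 1 \<or> \<chi> x = -1" by (simp add: square_eq_1_iff)
    then show ?thesis by (auto simp: \<chi>'_def)
  qed
  interpret vector_space scale by (rule assms(4))
  interpret form_space scale by unfold_locales
  interpret even_form_space scale \<chi>' q lam m u
  proof unfold_locales
    show "\<exists>x. \<chi>' x \<noteq> 1" using \<chi>(3) by (metis of_real_1 real)
    show "\<chi>' (x + y) = \<chi>' x * \<chi>' y" for x y
      using \<chi>(2)[of x y] by (metis of_real_eq_iff of_real_mult real)
    show "z\<^sup>2 + z \<noteq> lam" for z
      using abs_trace_artin_schreier[of e z] assms(1,2,6) two by auto
  qed (use assms(1,5,8) \<chi>(1) in \<open>auto simp: two \<chi>'_def\<close>)
  have w: "coords UNIV m w" using assms(9) by (rule indexed_basis_coords)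
  have chi: "\<chi> = (\<lambda>x. complex_of_real (\<chi>' x))" using real by blast
  note odd_bound = odd_distance_bound[OF w assms(12,13,14), folded chi]
  note even_bound = even_distance_bound[OF w assms(12,13,14)]
  consider (oo) "odd m" "odd d" | (eo) "even m" "odd d" | (ee) "even m" "even d" | (oe) "odd m" "even d" by blast
  then show ?thesis
  proof cases
    case oo
    then obtain a b where ab: "m = 2 * a + 1" "d = 2 * b + 1" by (elim oddE)
    \<comment> \<open>In all four cases the second factor of the stated exponent is exactly twice j,
      so the halving loses nothing and leaves \<open>cexp\<close> times j.\<close>
    have "cexp (m + 1) * ((m + 1) div 2 - (d - 1) div 2) = m * (m - d + 2) div 2"
    proof -
      have "m - d + 2 = 2 * ((m + 1) div 2 - (d - 1) div 2)" using ab assms(11) by simp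
      then show ?thesis using oo by (simp add: cexp_def)
    qed
    then show ?thesis using odd_bound oo assms(11) by (simp add: Let_def)
  next
    case eo
    then obtain a b where ab: "m = 2 * a" "d = 2 * b + 1" by (elim evenE oddE)
    have "cexp (m + 1) * ((m + 1) div 2 - (d - 1) div 2) = (m + 1) * (m - d + 1) div 2"
    proof -
      have "m - d + 1 = 2 * ((m + 1) div 2 - (d - 1) div 2)" using ab assms(11) by simp
      then show ?thesis using eo by (simp add: cexp_def)
    qed
    then show ?thesis using odd_bound eo assms(11) by (simp add: Let_def)
  next
    case ee
    then obtain a b where ab: "m = 2 * a" "d = 2 * b" by (elim evenE)
    have "cexp m * (m div 2 - d div 2 + 1) = (m - 1) * (m - d + 2) div 2"
    proof -
      have "m - d + 2 = 2 * (m div 2 - d div 2 + 1)" using ab assms(11) by simp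
      then show ?thesis using ee by (simp add: cexp_def)
    qed
    then show ?thesis using even_bound ee assms(10,11) by (simp add: Let_def)
  next
    case oe
    then obtain a b where ab: "m = 2 * a + 1" "d = 2 * b" by (elim oddE evenE)
    have "cexp m * (m div 2 - d div 2 + 1) = m * (m - d + 1) div 2"
    proof -
      have "m - d + 1 = 2 * (m div 2 - d div 2 + 1)" using ab assms(11) by simp
      then show ?thesis using oe by (simp add: cexp_def)
    qed
    then show ?thesis using even_bound oe assms(10,11) by (simp add: Let_def)
  qed
qed

end
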